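(* Consider the $G/G/1$ workload model described in the context. Assume that $\mathbb{E}U^3<\infty$, $\mathbb{E}S^3<\infty$, $\rho<1$ and $U$ is nonlattice. Let $Y$ be exponentially distributed with mean $\rho\,\mathbb{E}S\,(c_U^2+c_S^2)/2$. Then $$d_W(X,Y)\le \sup_{h\in \mathrm{Lip}(1)}\big(|\epsilon_0(f_h)|+|\epsilon_A(f_h)|\big).$$ Furthermore, for every $h\in\mathrm{Lip}(1)$, $$|\epsilon_0(f_h)|\le \delta\rho\lambda\,\mathbb{E}U^2/2+\rho\,\mathbb{E}\big(1(X=0)R_a\big),$$ $$|\epsilon_A(f_h)|\le \frac{2\delta\,\mathbb{E}|S-\rho U|^3}{3(\mathbb{E}S)^2(c_U^2+c_S^2)}+2\delta\big(\mathbb{E}S+\lambda\,\mathbb{E}U^2\big).$$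
   Context: Model: a single-server queue under any non-idling policy. Arrivals form a renewal process with interarrival distribution $U$ and rate $\lambda=1/\mathbb{E}U$; service times are i.i.d. copies of $S$, independent of arrivals, with rate $\mu=1/\mathbb{E}S$. Put $\rho=\lambda/\mu$, $\delta=1-\rho$, $c_U^2=\lambda^2\mathrm{Var}(U)$, $c_S^2=\mu^2\mathrm{Var}(S)$. With probability one, simultaneous events (arrivals/departures) do not occur. $V(t)$ is the remaining workload and $R_a(t)$ the residual interarrival time (time until the next arrival) at time $t$; $X(t)=\delta V(t)$ and $Z(t)=(X(t),R_a(t))$ is right-continuous with left limits with values in $\mathbb{S}=\{(x,r):x\ge 0,\ r>0\}$. Between arrivals $X$ decreases at rate $\delta$ while positive and stays at $0$ once there, and $R_a$ decreases at rate 1; when $R_a$ hits $0$ an arrival occurs instantaneously, $X$ jumps up by $\delta$ times a fresh copy of $S$ and $R_a$ is reset to a fresh copy of $U$. $Z=(X,R_a)$ denotes a random vector with the stationary distribution. $A(t)$ is the number of arrivals on $[0,t]$; if an arrival occurs at time $t$, $U(t)$ is the subsequent interarrival time and $S(t)$ the workload brought by the arriving customer. For arrival times $\tau_m$, $\int_0^t g(s)\,dA(s)=\sum_m g(\tau_m)1(\tau_m\le t)$. Expectations of integrals against $dA$ are taken under $Z(0)\sim Z$. $\mathrm{Lip}(1)$ is the set of functions $h:\mathbb{R}\to\mathbb{R}$ with Lipschitz constant at most 1, and $d_W(X,Y)=\sup_{h\in\mathrm{Lip}(1)}|\mathbb{E}h(X)-\mathbb{E}h(Y)|$. For $h\in\mathrm{Lip}(1)$,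 $f_h:\mathbb{R}\to\mathbb{R}$ is the solution with $f_h(0)=0$, $f_h'(0)=0$ of $-\theta f_h'(x)+\tfrac12\sigma^2 f_h''(x)=\mathbb{E}h(Y)-h(x)$, $x\in\mathbb{R}$, where $\theta=\delta^2$, $\sigma^2=\delta^2\rho\,\mathbb{E}S(c_U^2+c_S^2)$; explicitly $f_h'(x)=-e^{2\theta x/\sigma^2}\int_x^\infty \frac{2}{\sigma^2}(\mathbb{E}h(Y)-h(y))e^{-2\theta y/\sigma^2}dy$. For $f\in C^2(\mathbb{R})$ with $f''$ absolutely continuous, $$\epsilon_0(f)=\delta^3\rho\,\mathbb{E}(R_a f''(\xi))-\delta^2\rho\,\mathbb{E}(1(X=0)R_af''(\xi)),$$ $$\epsilon_A(f)=\tfrac16\delta^3\mathbb{E}\int_0^1(S(t)-\rho U(t))^3f'''(\xi(t))\,dA(t)-\tfrac12\delta^2\lambda\,\mathbb{E}(S-\rho U)^2\,\mathbb{E}\int_0^1\int_0^{U(t)}(X(t+u)-X(t-))f'''(\xi(t+u))\,du\,dA(t).$$ Here $f^{(k)}(\xi)$ denotes a generic Taylor remainder coefficient which may change from expression to expression, namely the quantity making the following expansions exact. In the two terms of $\epsilon_0$, respectively: $f'(X-\delta\rho R_a)=f'(X)-\delta\rho R_af''(\xi)$, and, on $\{X=0\}$, $f'(-\delta\rho R_a)=f'(0)-\delta\rho R_af''(\xi)$. In the two terms of $\epsilon_A$, respectively: $f(X(t-)+\Delta)=f(X(t-))+\Delta f'(X(t-))+\tfrac12\Delta^2f''(X(t-))+\tfrac16\Delta^3f'''(\xi(t))$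 with $\Delta=\delta(S(t)-\rho U(t))$, and $f''(X(t+u))=f''(X(t-))+(X(t+u)-X(t-))f'''(\xi(t+u))$. *)

theory Defs
  imports "HOL-Probability.Probability"
begin

section \<open>Workload and residual interarrival time along a sample path\<close>

text \<open>
  A sample path is determined by the initial workload \<open>v\<close>, the initial residual interarrival
  time \<open>r\<close>, and two sequences: arrivals are numbered from 0, arrival \<open>m\<close> brings the workload
  \<open>s m\<close>, and \<open>u m\<close> is the time between arrivals \<open>m\<close> and \<open>m + 1\<close>. Hence, at the time of
  arrival \<open>m\<close>, the paper's \<open>U(t)\<close> and \<open>S(t)\<close> are \<open>u m\<close> and \<open>s m\<close>.
  The server works at unit rate whenever there is work, so the workload does not depend on
  the non-idling policy.
\<close>

definition arrival_time :: "real \<Rightarrow> (nat \<Rightarrow> real) \<Rightarrow> nat \<Rightarrow> real" where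
  "arrival_time r u m = r + (\<Sum>k<m. u k)"

text \<open>If \<open>r\<close> and all \<open>u k\<close> are positive, arrival \<open>m\<close> is preceded by exactly \<open>m\<close> arrivals. The
  set below is finite for almost every path of the model; \<open>card\<close> is 0 on the others.\<close>

definition arrivals :: "real \<Rightarrow> (nat \<Rightarrow> real) \<Rightarrow> real \<Rightarrow> nat" where
  "arrivals r u t = card {m. arrival_time r u m \<le> t}"

text \<open>The workload immediately after arrival \<open>m\<close>.\<close>

primrec workload_after ::
  "real \<Rightarrow> real \<Rightarrow> (nat \<Rightarrow> real) \<Rightarrow> (nat \<Rightarrow> real) \<Rightarrow> nat \<Rightarrow> real" where
  "workload_after v r u s 0 = max 0 (v - r) + s 0"
| "workload_after v r u s (Suc m) = max 0 (workload_after v r u s m - u m) + s (Suc m)"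

definition workload ::
  "real \<Rightarrow> real \<Rightarrow> (nat \<Rightarrow> real) \<Rightarrow> (nat \<Rightarrow> real) \<Rightarrow> real \<Rightarrow> real" where
  "workload v r u s t =
     (case arrivals r u t of
        0 \<Rightarrow> max 0 (v - t)
      | Suc m \<Rightarrow> max 0 (workload_after v r u s m - (t - arrival_time r u m)))"

definition residual_interarrival :: "real \<Rightarrow> (nat \<Rightarrow> real) \<Rightarrow> real \<Rightarrow> real" where
  "residual_interarrival r u t = arrival_time r u (arrivals r u t) - t"

text \<open>A positive workload is depleted exactly at time \<open>t\<close>: under every non-idling policy
  there is then a departure at time \<open>t\<close>.\<close>

definition depletes_at :: "(real \<Rightarrow> real) \<Rightarrow> real \<Rightarrow> bool" where
  "depletes_at w t \<longleftrightarrow> (\<forall>\<^sub>F x in at_left t. 0 < w x) \<and> (w \<longlongrightarrow> 0) (at_left t)"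


section \<open>Distributional quantities\<close>

definition rate :: "'a measure \<Rightarrow> ('a \<Rightarrow> real) \<Rightarrow> real" where
  "rate M T = 1 / (\<integral>\<omega>. T \<omega> \<partial>M)"

text \<open>The squared coefficient of variation.\<close>

definition scv :: "'a measure \<Rightarrow> ('a \<Rightarrow> real) \<Rightarrow> real" where
  "scv M T = (rate M T)\<^sup>2 * prob_space.variance M T"

definition nonlattice :: "'a measure \<Rightarrow> ('a \<Rightarrow> real) \<Rightarrow> bool" where
  "nonlattice M T \<longleftrightarrow> \<not> (\<exists>d>0. AE \<omega> in M. \<exists>k::int. T \<omega> = of_int k * d)"

definition Lip1 :: "(real \<Rightarrow> real) set" where
  "Lip1 = {h. 1-lipschitz_on UNIV h}"

text \<open>Extended reals, because the supremum of an unbounded set of reals is unspecified.\<close>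

definition wasserstein ::
  "'a measure \<Rightarrow> ('a \<Rightarrow> real) \<Rightarrow> 'b measure \<Rightarrow> ('b \<Rightarrow> real) \<Rightarrow> ereal" where
  "wasserstein M X N Y =
     (SUP h\<in>Lip1. ereal \<bar>(\<integral>\<omega>. h (X \<omega>) \<partial>M) - (\<integral>\<omega>. h (Y \<omega>) \<partial>N)\<bar>)"


section \<open>The Stein equation\<close>

text \<open>Used with \<open>c\<close> the expectation of \<open>h(Y)\<close> and \<open>s2\<close> the paper's \<open>\<sigma>\<^sup>2\<close>. For \<open>s2 > 0\<close> and continuous
  \<open>h\<close>, the equation is a linear first-order equation for \<open>f'\<close>, so the two initial conditions
  determine the solution uniquely.\<close>

definition stein_solution :: "real \<Rightarrow> real \<Rightarrow> real \<Rightarrow> (real \<Rightarrow> real) \<Rightarrow> real \<Rightarrow> real" where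
  "stein_solution \<theta> s2 c h =
     (THE f. f 0 = 0 \<and> deriv f 0 = 0 \<and>
        (\<forall>x. f field_differentiable at x \<and> deriv f field_differentiable at x) \<and>
        (\<forall>x. - \<theta> * deriv f x + 1/2 * s2 * deriv (deriv f) x = c - h x))"


section \<open>The error terms\<close>

text \<open>The Taylor remainder coefficients are the quantities making these expansions exact:
  \<open>g (x + d) = g x + d * taylor_coeff1 g x d\<close> and
  \<open>g (x + d) = g x + d * g' x + d\<^sup>2/2 * g'' x + d\<^sup>3/6 * taylor_coeff3 g x d\<close>.
  For \<open>d = 0\<close> every value of the coefficient is admissible, and the coefficient is only
  used multiplied by a power of \<open>d\<close> (up to nonzero constants); division by zero selects 0.\<close>

definition taylor_coeff1 :: "(real \<Rightarrow> real) \<Rightarrow> real \<Rightarrow> real \<Rightarrow> real" where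
  "taylor_coeff1 g x d = (g (x + d) - g x) / d"

definition taylor_coeff3 :: "(real \<Rightarrow> real) \<Rightarrow> real \<Rightarrow> real \<Rightarrow> real" where
  "taylor_coeff3 g x d =
     (g (x + d) - g x - d * deriv g x - 1/2 * d\<^sup>2 * deriv (deriv g) x) / (1/6 * d ^ 3)"

text \<open>The integral of \<open>g\<close> over \<open>[0,1]\<close> against the arrival process with arrival times \<open>\<tau>\<close>; the
  integrand at the time of arrival \<open>m\<close> is \<open>g m\<close>.\<close>

definition arrival_integral :: "(nat \<Rightarrow> real) \<Rightarrow> (nat \<Rightarrow> real) \<Rightarrow> real" where
  "arrival_integral \<tau> g = (\<Sum>m. g m * of_bool (\<tau> m \<le> 1))"

definition left_limit :: "(real \<Rightarrow> real) \<Rightarrow> real \<Rightarrow> real" where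
  "left_limit x t = Lim (at_left t) x"

text \<open>The random variables whose expectations enter \<open>\<epsilon>\<^sub>0\<close> and \<open>\<epsilon>\<^sub>A\<close>. The processes \<open>X\<close> and
  \<open>R\<close> take the time first and the sample point second.\<close>

definition residual_term ::
  "real \<Rightarrow> real \<Rightarrow> (real \<Rightarrow> 'a \<Rightarrow> real) \<Rightarrow> (real \<Rightarrow> 'a \<Rightarrow> real) \<Rightarrow> (real \<Rightarrow> real) \<Rightarrow> 'a \<Rightarrow> real" where
  "residual_term \<delta> \<rho> X R f \<omega> =
     R 0 \<omega> * taylor_coeff1 (deriv f) (X 0 \<omega>) (- (\<delta> * \<rho> * R 0 \<omega>))"

definition idle_term ::
  "real \<Rightarrow> real \<Rightarrow> (real \<Rightarrow> 'a \<Rightarrow> real) \<Rightarrow> (real \<Rightarrow> 'a \<Rightarrow> real) \<Rightarrow> (real \<Rightarrow> real) \<Rightarrow> 'a \<Rightarrow> real" where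
  "idle_term \<delta> \<rho> X R f \<omega> =
     of_bool (X 0 \<omega> = 0) * R 0 \<omega> * taylor_coeff1 (deriv f) 0 (- (\<delta> * \<rho> * R 0 \<omega>))"

definition jump_term ::
  "real \<Rightarrow> real \<Rightarrow> (real \<Rightarrow> 'a \<Rightarrow> real) \<Rightarrow> (nat \<Rightarrow> 'a \<Rightarrow> real) \<Rightarrow> (nat \<Rightarrow> 'a \<Rightarrow> real) \<Rightarrow>
   (nat \<Rightarrow> 'a \<Rightarrow> real) \<Rightarrow> (real \<Rightarrow> real) \<Rightarrow> 'a \<Rightarrow> real" where
  "jump_term \<delta> \<rho> X \<tau> U S f \<omega> =
     arrival_integral (\<lambda>m. \<tau> m \<omega>)
       (\<lambda>m. (S m \<omega> - \<rho> * U m \<omega>) ^ 3 *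
            taylor_coeff3 f (left_limit (\<lambda>t. X t \<omega>) (\<tau> m \<omega>)) (\<delta> * (S m \<omega> - \<rho> * U m \<omega>)))"

definition cycle_term ::
  "(real \<Rightarrow> 'a \<Rightarrow> real) \<Rightarrow> (nat \<Rightarrow> 'a \<Rightarrow> real) \<Rightarrow> (nat \<Rightarrow> 'a \<Rightarrow> real) \<Rightarrow> (real \<Rightarrow> real) \<Rightarrow> 'a \<Rightarrow> real" where
  "cycle_term X \<tau> U f \<omega> =
     arrival_integral (\<lambda>m. \<tau> m \<omega>)
       (\<lambda>m. LINT u:{0..U m \<omega>}|lborel.
          (let x = left_limit (\<lambda>t. X t \<omega>) (\<tau> m \<omega>); d = X (\<tau> m \<omega> + u) \<omega> - x
           in d * taylor_coeff1 (deriv (deriv f)) x d))"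

definition eps0 ::
  "'a measure \<Rightarrow> real \<Rightarrow> real \<Rightarrow> (real \<Rightarrow> 'a \<Rightarrow> real) \<Rightarrow> (real \<Rightarrow> 'a \<Rightarrow> real) \<Rightarrow> (real \<Rightarrow> real) \<Rightarrow> real"
  where
  "eps0 M \<delta> \<rho> X R f =
     \<delta> ^ 3 * \<rho> * (\<integral>\<omega>. residual_term \<delta> \<rho> X R f \<omega> \<partial>M)
     - \<delta>\<^sup>2 * \<rho> * (\<integral>\<omega>. idle_term \<delta> \<rho> X R f \<omega> \<partial>M)"

definition epsA ::
  "'a measure \<Rightarrow> real \<Rightarrow> real \<Rightarrow> real \<Rightarrow> (real \<Rightarrow> 'a \<Rightarrow> real) \<Rightarrow> (nat \<Rightarrow> 'a \<Rightarrow> real) \<Rightarrow>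
   (nat \<Rightarrow> 'a \<Rightarrow> real) \<Rightarrow> (nat \<Rightarrow> 'a \<Rightarrow> real) \<Rightarrow> (real \<Rightarrow> real) \<Rightarrow> real" where
  "epsA M lam \<delta> \<rho> X \<tau> U S f =
     1/6 * \<delta> ^ 3 * (\<integral>\<omega>. jump_term \<delta> \<rho> X \<tau> U S f \<omega> \<partial>M)
     - 1/2 * \<delta>\<^sup>2 * lam * (\<integral>\<omega>. (S 0 \<omega> - \<rho> * U 0 \<omega>)\<^sup>2 \<partial>M) * (\<integral>\<omega>. cycle_term X \<tau> U f \<omega> \<partial>M)"

end

theory Submission
  imports Defs
begin

text \<open>
  The proof combines Stein's method with rate conservation. Write \<open>c\<close> for the expectation of \<open>h(Y)\<close>
  and \<open>f\<close> for the solution of the Stein equation. Evaluating the equation at the stationary \<open>X\<close> and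
  taking expectations gives \<open>E h(X) - c = E(\<theta> f'(X) - \<sigma>\<^sup>2/2 f''(X))\<close>, so it suffices to show that the
  right-hand side is \<open>\<epsilon>\<^sub>0 + \<epsilon>\<^sub>A\<close>.

  Between arrivals the state \<open>(v, r)\<close> (workload, time to the next arrival) follows the deterministic flow
  \<open>(max 0 (v - t), r - t)\<close>. Along a path, \<open>F(Z(1)) - F(Z(0))\<close> is therefore the time integral of the derivative
  \<open>D\<close> of \<open>F\<close> along the flow plus the jumps of \<open>F\<close> at the arrivals in \<open>[0,1]\<close>. Stationarity annihilates the
  expectation of the left-hand side and turns the time integral into \<open>E D(Z)\<close>; this is lemma
  \<open>rate_conservation\<close>. It is used with two kinds of test functions.

  First, \<open>F = f(X - \<delta>\<rho>R)\<close>. The correction \<open>\<delta>\<rho>R\<close> compensates the drift of the input: the derivative is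
  \<open>-\<delta>\<^sup>2 f'(X - \<delta>\<rho>R)\<close> plus an idle-time term, which after replacing \<open>X - \<delta>\<rho>R\<close> by \<open>X\<close> is \<open>-\<theta> f'(X)\<close> plus the
  random variables in \<open>\<epsilon>\<^sub>0\<close>. A jump is \<open>f(x + \<Delta>) - f(x)\<close> with \<open>x = X(t-)\<close> and \<open>\<Delta> = \<delta>(S - \<rho>U)\<close>, where \<open>\<Delta>\<close> has mean zero
  and is independent of \<open>x\<close>. Hence the first-order Taylor term vanishes, the third-order
  remainder is the first part of \<open>\<epsilon>\<^sub>A\<close>, and the second-order term is a multiple of the sum of \<open>f''(X(t-))\<close>
  over arrivals (lemma \<open>smooth_balance\<close>).

  Second, \<open>F\<close> is the integral of \<open>k(X)\<close> from now to the next arrival. It identifies \<open>E k(X)\<close> with an expected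
  sum over arrivals of integrals over the subsequent interarrival times (lemma \<open>cycle_formula\<close>). With
  \<open>k = f''\<close>, the average over arrivals becomes \<open>\<lambda>(E f''(X) - E cycle_term)\<close>, and the difference
  is the second part of \<open>\<epsilon>\<^sub>A\<close> (lemma \<open>cycle_expansion\<close>). Adding up gives the identity
  (lemma \<open>error_terms\<close>).

  The bounds follow from \<open>f'(x) = (E h(x + Y) - E h(Y)) / \<theta>\<close>: this function is \<open>1/\<theta>\<close>-Lipschitz, and by the
  equation its derivative is bounded by \<open>1/\<theta>\<close> and \<open>4/\<sigma>\<^sup>2\<close>-Lipschitz (lemma \<open>stein_solution_properties\<close>).

  The delicate point is integrability, since \<open>f\<close> grows quadratically and nothing is known beforehand about
  the moments of \<open>X\<close>. A difference of two identically distributed variables has mean zero as soon as the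
  difference is integrable (lemma \<open>same_law_integrable_difference\<close>), which covers the case that \<open>F(Z)\<close> has
  infinite mean. Rate conservation for truncated quadratic test functions then yields a finite mean
  of \<open>R\<close>, of \<open>X\<close>, and of the sum of \<open>X(t-)\<close> over arrivals, in this order (lemmas \<open>residual_mean\<close>,
  \<open>workload_integrable\<close>, \<open>palm_integrable_workload\<close>).
\<close>

section \<open>Taylor bounds and antiderivatives\<close>

lemma antiderivative_exists:
  fixes g :: "real \<Rightarrow> real"
  assumes "continuous_on UNIV g"
  obtains G where "G 0 = 0" "\<And>x. (G has_real_derivative g x) (at x)"
proof -
  obtain F where F: "\<And>x. (F has_vector_derivative g x) (at x)"
    using einterval_antiderivative[of "-\<infinity>" "\<infinity>" g] assms
    by (auto simp: continuous_on_eq_continuous_at)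
  show thesis
  proof (rule that[of "\<lambda>x. F x - F 0"])
    show "((\<lambda>x. F x - F 0) has_real_derivative g x) (at x)" for x
      using F[of x] by (auto intro!: derivative_eq_intros simp: has_real_derivative_iff_has_vector_derivative)
  qed simp
qed

lemma DERIV_borel_measurable:
  assumes "\<And>x. (\<phi> has_real_derivative \<phi>' x) (at x)"
  shows "\<phi> \<in> borel_measurable borel"
  using assms by (intro borel_measurable_continuous_onI)
    (auto simp: continuous_on_eq_continuous_at intro: DERIV_isCont)

lemma Lipschitz_continuous:
  fixes g :: "real \<Rightarrow> real"
  assumes L: "\<And>x y. \<bar>g x - g y\<bar> \<le> L * \<bar>x - y\<bar>"
  shows "continuous_on UNIV g"
proof (rule lipschitz_on_continuous_on)
  have "0 \<le> L" using L[of 0 1] by simp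
  then show "L-lipschitz_on UNIV g" using L by (auto simp: lipschitz_on_def dist_real_def)
qed

lemma nonneg_at_1:
  fixes \<psi> \<psi>' :: "real \<Rightarrow> real"
  assumes "\<psi> 0 = 0" and D: "\<And>t. (\<psi> has_real_derivative \<psi>' t) (at t)"
    and "\<And>t. 0 \<le> t \<Longrightarrow> t \<le> 1 \<Longrightarrow> 0 \<le> \<psi>' t"
  shows "0 \<le> \<psi> 1"
  using DERIV_nonneg_imp_nondecreasing[of 0 1 \<psi>] assms by fastforce

text \<open>
  A Lipschitz derivative replaces a bounded second derivative: on the segment from \<open>x\<close> to \<open>x + d\<close>, the
  bound minus the remainder vanishes at the start and has a nonnegative derivative.
\<close>

lemma taylor2_one_sided:
  fixes \<phi> \<phi>' :: "real \<Rightarrow> real"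
  assumes D: "\<And>x. (\<phi> has_real_derivative \<phi>' x) (at x)"
    and L: "\<And>x y. \<bar>\<phi>' x - \<phi>' y\<bar> \<le> L * \<bar>x - y\<bar>"
  shows "\<phi> (x + d) - \<phi> x - d * \<phi>' x \<le> L * d\<^sup>2 / 2"
proof -
  have "0 \<le> (\<lambda>t. L * t\<^sup>2 * d\<^sup>2 / 2 - (\<phi> (x + t * d) - \<phi> x - t * d * \<phi>' x)) 1"
  proof (rule nonneg_at_1)
    show "((\<lambda>t. L * t\<^sup>2 * d\<^sup>2 / 2 - (\<phi> (x + t * d) - \<phi> x - t * d * \<phi>' x)) has_real_derivative
       L * t * d\<^sup>2 - (\<phi>' (x + t * d) * d - d * \<phi>' x)) (at t)" for t
      by (auto intro!: derivative_eq_intros DERIV_chain'[OF _ D])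
    fix t :: real assume t: "0 \<le> t" "t \<le> 1"
    have "(\<phi>' (x + t * d) - \<phi>' x) * d \<le> \<bar>\<phi>' (x + t * d) - \<phi>' x\<bar> * \<bar>d\<bar>"
      using abs_ge_self[of "(\<phi>' (x + t * d) - \<phi>' x) * d"] by (simp only: abs_mult)
    also have "\<dots> \<le> (L * \<bar>t * d\<bar>) * \<bar>d\<bar>"
      using L[of "x + t * d" x] by (intro mult_right_mono) auto
    also have "\<dots> = L * t * d\<^sup>2"
      using t by (simp add: abs_mult power2_eq_square)
    finally show "0 \<le> L * t * d\<^sup>2 - (\<phi>' (x + t * d) * d - d * \<phi>' x)"
      by (simp add: algebra_simps)
  qed simp
  then show ?thesis by simp
qed

lemma taylor2_bound:
  fixes \<phi> \<phi>' :: "real \<Rightarrow> real"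
  assumes D: "\<And>x. (\<phi> has_real_derivative \<phi>' x) (at x)"
    and L: "\<And>x y. \<bar>\<phi>' x - \<phi>' y\<bar> \<le> L * \<bar>x - y\<bar>"
  shows "\<bar>\<phi> (x + d) - \<phi> x - d * \<phi>' x\<bar> \<le> L * d\<^sup>2 / 2"
proof -
  have "(- \<phi> (x + d)) - (- \<phi> x) - d * (- \<phi>' x) \<le> L * d\<^sup>2 / 2"
  proof (rule taylor2_one_sided[where \<phi> = "\<lambda>x. - \<phi> x" and \<phi>' = "\<lambda>x. - \<phi>' x"])
    show "\<bar>- \<phi>' x - - \<phi>' y\<bar> \<le> L * \<bar>x - y\<bar>" for x y
      using L[of y x] by (simp add: abs_minus_commute)
  qed (auto intro!: derivative_eq_intros D)
  with taylor2_one_sided[OF D L, of x d] show ?thesis by linarith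
qed

text \<open>
  The argument of the second-order bound, one order higher: the derivative of the remainder
  along the segment is a second-order remainder of \<open>\<phi>'\<close>. A Lipschitz constant of \<open>\<phi>''\<close> takes the place
  of a bound on a third derivative.
\<close>

lemma taylor3_one_sided:
  fixes \<phi> \<phi>' \<phi>'' :: "real \<Rightarrow> real"
  assumes D: "\<And>x. (\<phi> has_real_derivative \<phi>' x) (at x)"
    and D': "\<And>x. (\<phi>' has_real_derivative \<phi>'' x) (at x)"
    and L: "\<And>x y. \<bar>\<phi>'' x - \<phi>'' y\<bar> \<le> L * \<bar>x - y\<bar>"
  shows "\<phi> (x + d) - \<phi> x - d * \<phi>' x - 1/2 * d\<^sup>2 * \<phi>'' x \<le> L * \<bar>d\<bar> ^ 3 / 6"
proof -
  define B where "B = L * \<bar>d\<bar> ^ 3 / 6"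
  have cube: "\<bar>d\<bar> ^ 3 = d\<^sup>2 * \<bar>d\<bar>"
    by (simp add: power3_eq_cube power2_eq_square)
  define \<psi> where "\<psi> t = B * t ^ 3
      - (\<phi> (x + t * d) - \<phi> x - t * d * \<phi>' x - t\<^sup>2 * (1/2 * d\<^sup>2 * \<phi>'' x))" for t
  define \<psi>' where "\<psi>' t = 3 * B * t\<^sup>2 - (\<phi>' (x + t * d) * d - d * \<phi>' x - t * d\<^sup>2 * \<phi>'' x)" for t
  have "0 \<le> \<psi> 1"
  proof (rule nonneg_at_1[of \<psi> \<psi>'])
    show "(\<psi> has_real_derivative \<psi>' t) (at t)" for t
      unfolding \<psi>_def \<psi>'_def by (auto intro!: derivative_eq_intros DERIV_chain'[OF _ D])
    fix t :: real assume t: "0 \<le> t" "t \<le> 1"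
    let ?e = "\<phi>' (x + t * d) - \<phi>' x - t * d * \<phi>'' x"
    have "?e * d \<le> \<bar>?e\<bar> * \<bar>d\<bar>"
      using abs_ge_self[of "?e * d"] by (simp only: abs_mult)
    also have "\<dots> \<le> (L * (t * d)\<^sup>2 / 2) * \<bar>d\<bar>"
      using taylor2_bound[OF D' L, of x "t * d"] by (intro mult_right_mono) auto
    also have "\<dots> = L * t\<^sup>2 * \<bar>d\<bar> ^ 3 / 2"
      unfolding cube by (simp add: power_mult_distrib)
    finally show "0 \<le> \<psi>' t"
      by (simp add: \<psi>'_def B_def algebra_simps power2_eq_square)
  qed (simp add: \<psi>_def)
  then show ?thesis by (simp add: \<psi>_def B_def)
qed

lemma taylor3_bound:
  fixes \<phi> \<phi>' \<phi>'' :: "real \<Rightarrow> real"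
  assumes D: "\<And>x. (\<phi> has_real_derivative \<phi>' x) (at x)"
    and D': "\<And>x. (\<phi>' has_real_derivative \<phi>'' x) (at x)"
    and L: "\<And>x y. \<bar>\<phi>'' x - \<phi>'' y\<bar> \<le> L * \<bar>x - y\<bar>"
  shows "\<bar>\<phi> (x + d) - \<phi> x - d * \<phi>' x - 1/2 * d\<^sup>2 * \<phi>'' x\<bar> \<le> L * \<bar>d\<bar> ^ 3 / 6"
proof -
  have "(- \<phi> (x + d)) - (- \<phi> x) - d * (- \<phi>' x) - 1/2 * d\<^sup>2 * (- \<phi>'' x) \<le> L * \<bar>d\<bar> ^ 3 / 6"
  proof (rule taylor3_one_sided[where \<phi> = "\<lambda>x. - \<phi> x" and \<phi>' = "\<lambda>x. - \<phi>' x"])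
    show "\<bar>- \<phi>'' x - - \<phi>'' y\<bar> \<le> L * \<bar>x - y\<bar>" for x y
      using L[of y x] by (simp add: abs_minus_commute)
  qed (auto intro!: derivative_eq_intros D D')
  with taylor3_one_sided[OF D D' L, of x d] show ?thesis by linarith
qed

lemma taylor_coeff1_mult: "d * taylor_coeff1 g x d = g (x + d) - g x"
  by (simp add: taylor_coeff1_def)

text \<open>
  An antiderivative of the truncated identity behaves like \<open>y\<^sup>2/2\<close> for \<open>0 \<le> y \<le> n\<close> but has a bounded derivative.
  As a test function it yields first moments by letting \<open>n\<close> tend to infinity.
\<close>

lemma truncated_square:
  fixes n :: nat
  obtains \<phi> where "\<And>y. (\<phi> has_real_derivative min (max y 0) (real n)) (at y)"
    "\<phi> 0 = 0"
proof -
  have "continuous_on UNIV (\<lambda>y::real. min (max y 0) (real n))"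
    by (intro continuous_intros)
  then show thesis
    using antiderivative_exists that by blast
qed

lemma truncation_Lipschitz:
  "\<bar>min (max x 0) (real n) - min (max y 0) (real n)\<bar> \<le> 1 * \<bar>x - y\<bar>"
  by auto

lemma min_sum_le:
  fixes x :: "nat \<Rightarrow> real"
  assumes "\<And>i. 0 \<le> x i" "0 \<le> c"
  shows "min (\<Sum>i<K. x i) c \<le> (\<Sum>i<K. min (x i) c)"
proof (induction K)
  case (Suc K)
  have "0 \<le> (\<Sum>i<K. x i)" using assms by (intro sum_nonneg) auto
  then show ?case using Suc assms(1)[of K] assms(2) by simp
qed (use assms in auto)

section \<open>The Stein equation for the exponential distribution\<close>

text \<open>
  The mean of \<open>h(x + Y)\<close> for an exponential \<open>Y\<close> with rate \<open>l\<close>. Up to an affine transformation this is the derivative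
  of the Stein solution, and all its regularity can be read off from this probabilistic form.
\<close>

definition exp_shift_mean :: "real \<Rightarrow> (real \<Rightarrow> real) \<Rightarrow> real \<Rightarrow> real" where
  "exp_shift_mean l h x = (\<integral>z. exponential_density l z * h (x + z) \<partial>lborel)"

lemma Lip1_D: "h \<in> Lip1 \<Longrightarrow> \<bar>h x - h y\<bar> \<le> \<bar>x - y\<bar>"
  by (auto simp: Lip1_def lipschitz_on_def dist_real_def)

lemma Lip1_continuous: "h \<in> Lip1 \<Longrightarrow> continuous_on UNIV h"
  by (auto simp: Lip1_def intro: lipschitz_on_continuous_on)

lemma Lip1_measurable: "h \<in> Lip1 \<Longrightarrow> h \<in> borel_measurable borel"
  by (intro borel_measurable_continuous_onI Lip1_continuous)

context
  fixes l :: real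
  assumes l: "0 < l"
begin

lemma exponential_moments:
  "integrable lborel (exponential_density l)" "(\<integral>z. exponential_density l z \<partial>lborel) = 1"
  "integrable lborel (\<lambda>z. exponential_density l z * z)"
  "(\<integral>z. exponential_density l z * z \<partial>lborel) = 1 / l"
proof -
  have "has_bochner_integral lborel (\<lambda>z. exponential_density l z * z ^ i) (fact i / l ^ i)" for i
    using nn_integral_erlang_ith_moment[OF l, of 0 i] l
    by (intro has_bochner_integral_nn_integral) (auto simp: erlang_density_def)
  from this[of 0] this[of 1]
  show "integrable lborel (exponential_density l)" "(\<integral>z. exponential_density l z \<partial>lborel) = 1"
  "integrable lborel (\<lambda>z. exponential_density l z * z)"
  "(\<integral>z. exponential_density l z * z \<partial>lborel) = 1 / l"
    by (auto simp: has_bochner_integral_iff)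
qed

lemma exp_shift_integrable:
  assumes h: "h \<in> Lip1"
  shows "integrable lborel (\<lambda>z. exponential_density l z * h (x + z))"
proof (rule Bochner_Integration.integrable_bound)
  show "integrable lborel (\<lambda>z. exponential_density l z * \<bar>h x\<bar> + exponential_density l z * z)"
    using exponential_moments by auto
  have [measurable]: "h \<in> borel_measurable borel"
    by (rule Lip1_measurable[OF h])
  show "(\<lambda>z. exponential_density l z * h (x + z)) \<in> borel_measurable lborel"
    by measurable
  show "AE z in lborel. norm (exponential_density l z * h (x + z))
    \<le> norm (exponential_density l z * \<bar>h x\<bar> + exponential_density l z * z)"
  proof (rule AE_I2)
    fix z :: real
    have "\<bar>h (x + z)\<bar> \<le> \<bar>h x\<bar> + z" if "0 \<le> z"
      using Lip1_D[OF h, of "x + z" x] that by auto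
    then show "norm (exponential_density l z * h (x + z))
      \<le> norm (exponential_density l z * \<bar>h x\<bar> + exponential_density l z * z)"
      using l by (auto simp: exponential_density_def abs_mult simp flip: distrib_left)
  qed
qed

lemma exp_shift_mean_Lipschitz:
  assumes h: "h \<in> Lip1"
  shows "\<bar>exp_shift_mean l h x - exp_shift_mean l h y\<bar> \<le> \<bar>x - y\<bar>"
proof -
  have "\<bar>exp_shift_mean l h x - exp_shift_mean l h y\<bar>
    = \<bar>\<integral>z. exponential_density l z * h (x + z) - exponential_density l z * h (y + z) \<partial>lborel\<bar>"
    unfolding exp_shift_mean_def by (subst Bochner_Integration.integral_diff) (auto intro: exp_shift_integrable h)
  also have "\<dots> \<le> (\<integral>z. exponential_density l z * \<bar>x - y\<bar> \<partial>lborel)"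
  proof (rule integral_abs_bound[THEN order_trans], rule integral_mono)
    fix z :: real
    show "\<bar>exponential_density l z * h (x + z) - exponential_density l z * h (y + z)\<bar>
      \<le> exponential_density l z * \<bar>x - y\<bar>"
      using Lip1_D[OF h, of "x + z" "y + z"] l
      by (auto simp: abs_mult intro!: mult_left_mono simp flip: right_diff_distrib)
  qed (auto intro!: exp_shift_integrable h exponential_moments)
  also have "\<dots> = \<bar>x - y\<bar>"
    using exponential_moments by simp
  finally show ?thesis .
qed

lemma exp_shift_mean_near:
  assumes h: "h \<in> Lip1"
  shows "\<bar>exp_shift_mean l h x - h x\<bar> \<le> 1 / l"
proof -
  have "\<bar>exp_shift_mean l h x - h x\<bar>
    = \<bar>\<integral>z. exponential_density l z * h (x + z) - exponential_density l z * h x \<partial>lborel\<bar>"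
    unfolding exp_shift_mean_def using exponential_moments
    by (subst Bochner_Integration.integral_diff) (auto intro: exp_shift_integrable h)
  also have "\<dots> \<le> (\<integral>z. exponential_density l z * z \<partial>lborel)"
  proof (rule integral_abs_bound[THEN order_trans], rule integral_mono)
    fix z :: real
    show "\<bar>exponential_density l z * h (x + z) - exponential_density l z * h x\<bar>
      \<le> exponential_density l z * z"
      using Lip1_D[OF h, of "x + z" "x"] l
      by (cases "z < 0")
        (auto simp: abs_mult exponential_density_def intro!: mult_left_mono simp flip: right_diff_distrib)
  qed (intro integrable_abs Bochner_Integration.integrable_diff integrable_mult_left
      exp_shift_integrable h exponential_moments)+
  also have "\<dots> = 1 / l"
    using exponential_moments by simp
  finally show ?thesis .
qed

text \<open>
  Substituting \<open>y = x + z\<close> exhibits the mean as \<open>e\<^sup>l\<^sup>x\<close> times the integral of \<open>l e\<^sup>-\<^sup>l\<^sup>y h(y)\<close> over \<open>[x, \<infinity>)\<close>,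
  to which the fundamental theorem of calculus applies.
\<close>

lemma exp_shift_mean_derivative:
  assumes h: "h \<in> Lip1"
  shows "(exp_shift_mean l h has_real_derivative l * (exp_shift_mean l h x - h x)) (at x)"
proof -
  define q where "q y = l * exp (- (l * y)) * h y" for y
  have q: "continuous_on UNIV q"
    unfolding q_def by (intro continuous_intros Lip1_continuous[OF h])
  obtain Q where Q: "Q 0 = 0" "\<And>x. (Q has_real_derivative q x) (at x)"
    using antiderivative_exists[OF q] by blast
  define K where "K x = (\<integral>y. indicator {x..} y * q y \<partial>lborel)" for x
  have *: "exponential_density l z * h (x + z) = exp (l * x) * (indicator {x..} (x + z) * q (x + z))" for x z
    by (auto simp: exponential_density_def q_def indicator_def field_simps simp flip: exp_add)
  have H: "exp_shift_mean l h x = exp (l * x) * K x" for x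
    unfolding exp_shift_mean_def K_def *
    by (subst (2) lborel_integral_real_affine[of 1 _ x]) auto
  have int: "integrable lborel (\<lambda>y. indicator {x..} y * q y)" for x
  proof -
    have "integrable lborel (\<lambda>z. exp (l * x) * (indicator {x..} (x + z) * q (x + z)))"
      using exp_shift_integrable[OF h, of x] unfolding * .
    then have "integrable lborel (\<lambda>z. indicator {x..} (x + 1 * z) * q (x + 1 * z))"
      by simp
    then show ?thesis
      by (subst (asm) lborel_integrable_real_affine_iff[of 1 "\<lambda>y. indicator {x..} y * q y" x]) auto
  qed
  \<comment> \<open>Tail integral plus antiderivative is constant; this treats both signs of \<open>x\<close> at once.\<close>
  have step: "K x + Q x = K y + Q y" if "x \<le> y" for x y
  proof -
    have "K x - K y = (\<integral>t. indicator {x..} t * q t - indicator {y..} t * q t \<partial>lborel)"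
      unfolding K_def by (subst Bochner_Integration.integral_diff) (auto intro: int)
    also have "\<dots> = (\<integral>t. q t * indicator {x..y} t \<partial>lborel)"
    proof (rule integral_cong_AE)
      show "AE t in lborel. indicator {x..} t * q t - indicator {y..} t * q t = q t * indicator {x..y} t"
        using AE_lborel_singleton[of y] by eventually_elim (use that in \<open>auto simp: indicator_def\<close>)
    qed (use borel_measurable_continuous_onI[OF q] in \<open>auto simp: measurable_lborel1\<close>)
    also have "\<dots> = Q y - Q x"
      by (rule integral_FTC_Icc_real) (use that Q q in \<open>auto simp: continuous_on_eq_continuous_at\<close>)
    finally show ?thesis by simp
  qed
  have "K x = K 0 - Q x" for x
    using step[of x 0] step[of 0 x] Q(1) by (cases "x \<le> 0") auto
  then have "exp_shift_mean l h = (\<lambda>x. exp (l * x) * (K 0 - Q x))"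
    using H by metis
  moreover have "((\<lambda>x. exp (l * x) * (K 0 - Q x)) has_real_derivative
      l * (exp (l * x) * (K 0 - Q x)) - exp (l * x) * q x) (at x)"
    by (auto intro!: derivative_eq_intros Q simp: algebra_simps)
  moreover have "exp (l * x) * q x = l * h x"
    by (simp add: q_def flip: exp_add)
  ultimately show ?thesis
    by (simp add: algebra_simps)
qed

end

lemma linear_ode_unique:
  fixes w :: "real \<Rightarrow> real"
  assumes "w 0 = 0" "\<And>x. (w has_real_derivative l * w x) (at x)"
  shows "w x = 0"
proof -
  have "((\<lambda>x. w x * exp (- (l * x))) has_real_derivative 0) (at x)" for x
    by (auto intro!: derivative_eq_intros assms simp: algebra_simps)
  then have "w x * exp (- (l * x)) = w 0 * exp (- (l * 0))"
    by (intro DERIV_isconst_all) auto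
  then show ?thesis using assms by simp
qed

text \<open>
  The equation is linear of first order in \<open>f'\<close>, and \<open>f'(x) = (E h(x + Y) - c) / \<theta>\<close> solves it; the value of \<open>c\<close> is exactly
  what makes \<open>f'(0) = 0\<close>. The Lipschitz constants of the shifted mean and of \<open>h\<close> are both 1, whence the factors
  \<open>1/\<theta>\<close> for \<open>f'\<close> and \<open>(2/\<sigma>\<^sup>2)(1 + 1)\<close> for \<open>f''\<close>; the bound on \<open>f''\<close> comes from \<open>E Y = \<sigma>\<^sup>2/(2\<theta>)\<close>.
\<close>

lemma stein_solution_properties:
  fixes \<theta> s2 c :: real and h :: "real \<Rightarrow> real"
  assumes pos: "0 < \<theta>" "0 < s2" and h: "h \<in> Lip1"
    and c: "c = exp_shift_mean (2 * \<theta> / s2) h 0"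
  obtains f f' f'' where
    "stein_solution \<theta> s2 c h = f" "deriv f = f'" "deriv f' = f''" "f' 0 = 0"
    "\<And>x. (f has_real_derivative f' x) (at x)" "\<And>x. (f' has_real_derivative f'' x) (at x)"
    "\<And>x y. \<bar>f' x - f' y\<bar> \<le> (1 / \<theta>) * \<bar>x - y\<bar>" "\<And>x. \<bar>f'' x\<bar> \<le> 1 / \<theta>"
    "\<And>x y. \<bar>f'' x - f'' y\<bar> \<le> (4 / s2) * \<bar>x - y\<bar>"
    "\<And>x. - \<theta> * f' x + 1/2 * s2 * f'' x = c - h x"
proof -
  define l where "l = 2 * \<theta> / s2"
  have l: "0 < l" using pos by (simp add: l_def)
  define H where "H = exp_shift_mean l h"
  define f' where "f' x = (H x - c) / \<theta>" for x
  define f'' where "f'' x = 2 / s2 * (H x - h x)" for x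
  have f'0: "f' 0 = 0" by (simp add: f'_def H_def c l_def)
  have df': "(f' has_real_derivative f'' x) (at x)" for x
    unfolding f'_def f''_def H_def
    by (rule derivative_eq_intros exp_shift_mean_derivative[OF l h] refl)+
      (use pos in \<open>auto simp: l_def field_simps\<close>)
  have contf': "continuous_on UNIV f'"
    using df' by (auto simp: continuous_on_eq_continuous_at intro: DERIV_isCont)
  obtain f where f: "f 0 = 0" "\<And>x. (f has_real_derivative f' x) (at x)"
    using antiderivative_exists[OF contf'] by blast
  have d1: "deriv f = f'" and d2: "deriv f' = f''"
    using f df' by (auto intro!: DERIV_imp_deriv)
  have eq: "- \<theta> * f' x + 1/2 * s2 * f'' x = c - h x" for x
    using pos by (simp add: f'_def f''_def field_simps)
  have "stein_solution \<theta> s2 c h = f"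
    unfolding stein_solution_def
  proof (rule the_equality)
    show "f 0 = 0 \<and> deriv f 0 = 0 \<and>
      (\<forall>x. f field_differentiable at x \<and> deriv f field_differentiable at x) \<and>
      (\<forall>x. - \<theta> * deriv f x + 1 / 2 * s2 * deriv (deriv f) x = c - h x)"
      using f df' f'0 eq by (auto simp: d1 d2 field_differentiable_def)
  next
    fix g assume g: "g 0 = 0 \<and> deriv g 0 = 0 \<and>
      (\<forall>x. g field_differentiable at x \<and> deriv g field_differentiable at x) \<and>
      (\<forall>x. - \<theta> * deriv g x + 1 / 2 * s2 * deriv (deriv g) x = c - h x)"
    have dg: "(g has_real_derivative deriv g x) (at x)" for x
      using g by (simp add: DERIV_deriv_iff_field_differentiable)
    have dg': "(deriv g has_real_derivative deriv (deriv g) x) (at x)" for x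
      using g by (simp add: DERIV_deriv_iff_field_differentiable)
    have "deriv g x - f' x = 0" for x
    proof (rule linear_ode_unique[where w = "\<lambda>x. deriv g x - f' x" and l = l])
      fix x
      have "- \<theta> * deriv g x + 1 / 2 * s2 * deriv (deriv g) x = - \<theta> * f' x + 1/2 * s2 * f'' x"
        using g eq[of x] by simp
      then have "deriv (deriv g) x - f'' x = l * (deriv g x - f' x)"
        using pos by (simp add: l_def field_simps)
      then show "((\<lambda>x. deriv g x - f' x) has_real_derivative l * (deriv g x - f' x)) (at x)"
        using DERIV_diff[OF dg' df', of x] by simp
    qed (use g f'0 in auto)
    then have "((\<lambda>x. g x - f x) has_real_derivative 0) (at x)" for x
      using DERIV_diff[OF dg f(2), of x] by simp
    then have "g x - f x = g 0 - f 0" for x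
      by (intro DERIV_isconst_all) auto
    then show "g = f" using g f by auto
  qed
  then show thesis
  proof (rule that[OF _ d1 d2 f'0 f(2) df' _ _ _ eq])
    show "\<bar>f' x - f' y\<bar> \<le> (1 / \<theta>) * \<bar>x - y\<bar>" for x y
      using exp_shift_mean_Lipschitz[OF l h, of x y] pos
      by (simp add: f'_def H_def divide_right_mono flip: diff_divide_distrib)
    show "\<bar>f'' x\<bar> \<le> 1 / \<theta>" for x
    proof -
      have "2 / s2 * \<bar>H x - h x\<bar> \<le> 2 / s2 * (1 / l)"
        using exp_shift_mean_near[OF l h, of x] pos by (intro mult_left_mono) (auto simp: H_def)
      also have "\<dots> = 1 / \<theta>" using pos by (simp add: l_def)
      finally show ?thesis using pos unfolding f''_def abs_mult by simp
    qed
    show "\<bar>f'' x - f'' y\<bar> \<le> (4 / s2) * \<bar>x - y\<bar>" for x y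
    proof -
      have "f'' x - f'' y = 2 / s2 * ((H x - H y) - (h x - h y))"
        using pos by (simp add: f''_def field_simps)
      then have "\<bar>f'' x - f'' y\<bar> = 2 / s2 * \<bar>(H x - H y) - (h x - h y)\<bar>"
        using pos by (simp only: abs_mult) simp
      also have "\<dots> \<le> 2 / s2 * (2 * \<bar>x - y\<bar>)"
        using exp_shift_mean_Lipschitz[OF l h, of x y] Lip1_D[OF h, of x y] pos
          abs_triangle_ineq4[of "H x - H y" "h x - h y"]
        unfolding H_def by (intro mult_left_mono) auto
      finally show ?thesis by simp
    qed
  qed
qed

section \<open>Rate conservation along a sample path\<close>

text \<open>
  The left limit of the workload at the time of arrival \<open>m\<close>; removing the work brought by the arrival gives
  one formula for \<open>m = 0\<close> and for successors.
\<close>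

definition workload_before ::
  "real \<Rightarrow> real \<Rightarrow> (nat \<Rightarrow> real) \<Rightarrow> (nat \<Rightarrow> real) \<Rightarrow> nat \<Rightarrow> real" where
  "workload_before v r u s m = workload_after v r u s m - s m"

lemma workload_before_simps:
  "workload_before v r u s 0 = max 0 (v - r)"
  "workload_before v r u s (Suc m) = max 0 (workload_after v r u s m - u m)"
  by (simp_all add: workload_before_def)

lemma workload_before_nonneg: "0 \<le> workload_before v r u s m"
  by (cases m) (simp_all add: workload_before_simps)

lemma workload_after_cong:
  assumes "\<And>k. k < m \<Longrightarrow> u k = u' k" "\<And>k. k \<le> m \<Longrightarrow> s k = s' k"
  shows "workload_after v r u s m = workload_after v r u' s' m"
  using assms by (induction m) auto

lemma workload_before_cong:
  assumes "\<And>k. k < m \<Longrightarrow> u k = u' k" "\<And>k. k < m \<Longrightarrow> s k = s' k"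
  shows "workload_before v r u s m = workload_before v r u' s' m"
proof (cases m)
  case (Suc k)
  then have "workload_after v r u s k = workload_after v r u' s' k"
    using assms by (intro workload_after_cong) auto
  then show ?thesis using Suc assms by (simp add: workload_before_simps)
qed (simp add: workload_before_simps)

text \<open>
  \<open>D\<close> is the derivative of \<open>F\<close> along the flow between arrivals, in integrated form. The integrated form tolerates the
  kink of \<open>max 0 (v - t)\<close> at the moment when the server becomes idle. The case \<open>b = r\<close> is included: it gives the state
  just before an arrival, whose second component is 0.
\<close>

definition flow_antiderivative :: "(real \<times> real \<Rightarrow> real) \<Rightarrow> (real \<times> real \<Rightarrow> real) \<Rightarrow> bool" where
  "flow_antiderivative F D \<longleftrightarrow> (\<forall>v\<ge>0. \<forall>r\<ge>0. \<forall>b. 0 \<le> b \<and> b \<le> r \<longrightarrow>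
     ((\<lambda>t. D (max 0 (v - t), r - t)) has_integral F (max 0 (v - b), r - b) - F (v, r)) {0..b})"

lemma flow_antiderivativeD:
  "flow_antiderivative F D \<Longrightarrow> 0 \<le> v \<Longrightarrow> 0 \<le> b \<Longrightarrow> b \<le> r \<Longrightarrow>
     ((\<lambda>t. D (max 0 (v - t), r - t)) has_integral F (max 0 (v - b), r - b) - F (v, r)) {0..b}"
  by (auto simp: flow_antiderivative_def)

lemma has_integral_translate:
  fixes g :: "real \<Rightarrow> real"
  assumes "(g has_integral i) {0..b}"
  shows "((\<lambda>t. g (t - a)) has_integral i) {a..a + b}"
proof -
  have "((\<lambda>x. x + a) ` {0..b}) = {a..a + b}"
    by (subst image_add_atLeastAtMost') (simp add: add.commute)
  then show ?thesis
    using has_integral_affinity[of g i 0 b 1 "- a"] assms by (simp add: add.commute)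
qed

locale queue_path =
  fixes v r :: real and u s :: "nat \<Rightarrow> real"
  assumes v: "0 \<le> v" and r: "0 < r" and u: "\<And>k. 0 < u k" and s: "\<And>k. 0 \<le> s k"
begin

abbreviation "t_arr \<equiv> arrival_time r u"

abbreviation "w_before \<equiv> workload_before v r u s"

abbreviation "w_after \<equiv> workload_after v r u s"

abbreviation "w_path \<equiv> workload v r u s"

abbreviation "r_path \<equiv> residual_interarrival r u"

lemma t_arr_0: "t_arr 0 = r" and t_arr_Suc: "t_arr (Suc m) = t_arr m + u m"
  by (simp_all add: arrival_time_def)

lemma t_arr_strict: "strict_mono t_arr"
  by (rule strict_monoI_Suc) (simp add: t_arr_Suc u)

lemma t_arr_pos: "0 < t_arr m"
  by (induction m) (auto simp: t_arr_0 t_arr_Suc r intro: add_pos_pos u)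

lemma w_after_nonneg: "0 \<le> w_after m"
  by (cases m) (auto intro: add_nonneg_nonneg s)

lemma w_after_eq: "w_after m = w_before m + s m"
  by (simp add: workload_before_def)

lemma arrivals_early:
  assumes "t < r"
  shows "{k. t_arr k \<le> t} = {}"
proof -
  have "r \<le> t_arr k" for k
    using strict_mono_less_eq[OF t_arr_strict, of 0 k] t_arr_0 by simp
  then show ?thesis using assms by (auto simp: not_le intro: less_le_trans)
qed

lemma arrivals_between:
  assumes "t_arr m \<le> t" "t < t_arr (Suc m)"
  shows "{k. t_arr k \<le> t} = {..m}"
proof safe
  fix k assume "t_arr k \<le> t"
  then have "t_arr k < t_arr (Suc m)" using assms by simp
  then show "k \<le> m" using t_arr_strict by (simp add: strict_mono_less)
next
  fix k assume "k \<le> m"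
  then have "t_arr k \<le> t_arr m" using t_arr_strict by (simp add: strict_mono_less_eq)
  then show "t_arr k \<le> t" using assms by simp
qed

lemma state_early:
  assumes "t < r"
  shows "w_path t = max 0 (v - t)" "r_path t = r - t"
  by (simp_all add: workload_def residual_interarrival_def arrivals_def arrivals_early[OF assms] t_arr_0)

lemma state_between:
  assumes "t_arr m \<le> t" "t < t_arr (Suc m)"
  shows "w_path t = max 0 (w_after m - (t - t_arr m))" "r_path t = u m - (t - t_arr m)"
  by (simp_all add: workload_def residual_interarrival_def arrivals_def arrivals_between[OF assms] t_arr_Suc)

lemma state_0: "w_path 0 = v" "r_path 0 = r"
  using state_early[of 0] r v by auto

lemma w_path_left_limit: "(w_path \<longlongrightarrow> w_before m) (at_left (t_arr m))"
proof (cases m)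
  case 0
  have "eventually (\<lambda>t. max 0 (v - t) = w_path t) (at_left r)"
    by (rule eventually_at_leftI[of "r - 1"]) (auto simp: state_early)
  moreover have "((\<lambda>t. max 0 (v - t)) \<longlongrightarrow> max 0 (v - r)) (at_left r)"
    by (intro tendsto_intros)
  ultimately show ?thesis
    using 0 by (auto simp: t_arr_0 workload_before_simps intro: Lim_transform_eventually)
next
  case (Suc k)
  have "eventually (\<lambda>t. max 0 (w_after k - (t - t_arr k)) = w_path t) (at_left (t_arr m))"
    by (rule eventually_at_leftI[of "t_arr k"]) (use Suc u[of k] in \<open>auto simp: state_between(1)[of k] t_arr_Suc\<close>)
  moreover have "((\<lambda>t. max 0 (w_after k - (t - t_arr k))) \<longlongrightarrow> max 0 (w_after k - (t_arr m - t_arr k)))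
      (at_left (t_arr m))"
    by (intro tendsto_intros)
  ultimately show ?thesis
    using Suc by (auto simp: t_arr_Suc workload_before_simps intro: Lim_transform_eventually)
qed

lemma left_limit_workload: "left_limit (\<lambda>t. c * w_path t) (t_arr m) = c * w_before m"
  unfolding left_limit_def
  by (intro tendsto_Lim tendsto_mult_left w_path_left_limit) simp

lemma integral_between:
  assumes FD: "flow_antiderivative F D" and b: "0 \<le> b" "b \<le> u m"
  shows "((\<lambda>t. D (w_path t, r_path t)) has_integral
     F (max 0 (w_after m - b), u m - b) - F (w_after m, u m)) {t_arr m..t_arr m + b}"
proof (rule has_integral_spike_finite[of "{t_arr m + b}"])
  show "((\<lambda>t. D (max 0 (w_after m - (t - t_arr m)), u m - (t - t_arr m))) has_integral
     F (max 0 (w_after m - b), u m - b) - F (w_after m, u m)) {t_arr m..t_arr m + b}"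
    using flow_antiderivativeD[OF FD w_after_nonneg b] by (rule has_integral_translate)
  show "D (w_path t, r_path t) = D (max 0 (w_after m - (t - t_arr m)), u m - (t - t_arr m))"
    if "t \<in> {t_arr m..t_arr m + b} - {t_arr m + b}" for t
    using that b state_between[of m t] by (auto simp: t_arr_Suc)
qed simp

lemma integral_early:
  assumes FD: "flow_antiderivative F D" and b: "0 \<le> b" "b \<le> r"
  shows "((\<lambda>t. D (w_path t, r_path t)) has_integral F (max 0 (v - b), r - b) - F (v, r)) {0..b}"
proof (rule has_integral_spike_finite[of "{b}"])
  show "((\<lambda>t. D (max 0 (v - t), r - t)) has_integral F (max 0 (v - b), r - b) - F (v, r)) {0..b}"
    using FD v b by (rule flow_antiderivativeD)
qed (use b in \<open>auto simp: state_early\<close>)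

text \<open>
  Induction over arrivals, each step appending one interarrival interval. The path is stopped just before arrival \<open>m\<close>,
  so that only the jumps at earlier arrivals have been made.
\<close>

lemma integral_to_arrival:
  assumes FD: "flow_antiderivative F D"
  shows "((\<lambda>t. D (w_path t, r_path t)) has_integral
     F (w_before m, 0) - F (v, r) - (\<Sum>k<m. F (w_after k, u k) - F (w_before k, 0))) {0..t_arr m}"
proof (induction m)
  case 0
  show ?case
    using integral_early[OF FD, of r] r by (simp add: workload_before_simps t_arr_0)
next
  case (Suc m)
  have "((\<lambda>t. D (w_path t, r_path t)) has_integral
    (F (w_before m, 0) - F (v, r) - (\<Sum>k<m. F (w_after k, u k) - F (w_before k, 0)))
    + (F (max 0 (w_after m - u m), u m - u m) - F (w_after m, u m))) {0..t_arr m + u m}"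
    by (rule has_integral_combine[OF _ _ Suc integral_between[OF FD]])
      (use u[of m] t_arr_pos[of m] in auto)
  then show ?case
    by (simp add: t_arr_Suc workload_before_simps algebra_simps)
qed

theorem rate_conservation_path:
  assumes FD: "flow_antiderivative F D" and fin: "finite {m. t_arr m \<le> 1}"
  shows "((\<lambda>t. D (w_path t, r_path t)) has_integral F (w_path 1, r_path 1) - F (v, r)
    - arrival_integral t_arr (\<lambda>m. F (w_after m, u m) - F (w_before m, 0))) {0..1}"
proof (cases "1 < r")
  case True
  then have "arrival_integral t_arr g = 0" for g
    using arrivals_early[of 1] by (auto simp: arrival_integral_def of_bool_def)
  then show ?thesis
    using integral_early[OF FD, of 1] True by (simp add: state_early)
next
  case False
  define m where "m = Max {m. t_arr m \<le> 1}"
  have ne: "{m. t_arr m \<le> 1} \<noteq> {}" using False t_arr_0 by (metis empty_iff mem_Collect_eq not_less)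
  have m: "t_arr m \<le> 1" "1 < t_arr (Suc m)"
    using Max_in[OF fin ne] Max_ge[OF fin, of "Suc m"] by (auto simp: m_def not_le[symmetric])
  note between = arrivals_between[OF m]
  have sum: "arrival_integral t_arr g = (\<Sum>k<m. g k) + g m" for g
  proof -
    have "arrival_integral t_arr g = (\<Sum>k\<in>{..m}. g k * of_bool (t_arr k \<le> 1))"
      unfolding arrival_integral_def using between
      by (intro suminf_finite) auto
    also have "\<dots> = (\<Sum>k\<in>{..m}. g k)"
      using between by (intro sum.cong) auto
    finally show ?thesis by (simp add: lessThan_Suc_atMost[symmetric])
  qed
  have "((\<lambda>t. D (w_path t, r_path t)) has_integral
    (F (w_before m, 0) - F (v, r) - (\<Sum>k<m. F (w_after k, u k) - F (w_before k, 0)))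
    + (F (max 0 (w_after m - (1 - t_arr m)), u m - (1 - t_arr m)) - F (w_after m, u m)))
    {0..1}"
    using integral_between[OF FD, of "1 - t_arr m" m] m
    by (intro has_integral_combine[OF _ _ integral_to_arrival[OF FD]]) (use t_arr_pos[of m] in \<open>auto simp: t_arr_Suc\<close>)
  moreover have "F (w_path 1, r_path 1) = F (max 0 (w_after m - (1 - t_arr m)), u m - (1 - t_arr m))"
    using state_between[OF m] by simp
  ultimately show ?thesis
    unfolding sum by (simp add: algebra_simps)
qed

text \<open>
  The interarrival times that start before time 1 cover, up to the last one, disjoint parts of \<open>[0,1]\<close>, and
  the last one contributes at most 1. Taking expectations bounds the mean number of arrivals.
\<close>

lemma sum_truncated_interarrivals:
  "(\<Sum>m<K. of_bool (t_arr m \<le> 1) * min (u m) 1) \<le> 2"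
proof -
  have "(\<Sum>m<K. of_bool (t_arr m \<le> 1) * min (u m) 1) \<le> min 2 (t_arr K)"
  proof (induction K)
    case 0
    then show ?case using r by (simp add: t_arr_0)
  next
    case (Suc K)
    then show ?case using u[of K] by (auto simp: t_arr_Suc)
  qed
  then show ?thesis by simp
qed

end

subsection \<open>Two families of test functions\<close>

text \<open>
  The test functions \<open>\<phi>(a v + b r)\<close>. With \<open>(a, b) = (\<delta>, -\<delta>\<rho>)\<close> they depend on the drift-compensated workload, with
  \<open>(0, 1)\<close> on the residual interarrival time alone.
\<close>

lemma flow_antiderivative_linear_argument:
  fixes \<phi> \<phi>' :: "real \<Rightarrow> real"
  assumes D: "\<And>x. (\<phi> has_real_derivative \<phi>' x) (at x)"
  shows "flow_antiderivative (\<lambda>(v, r). \<phi> (a * v + b * r))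
    (\<lambda>(v, r). - (a * of_bool (0 < v) + b) * \<phi>' (a * v + b * r))"
  unfolding flow_antiderivative_def
proof (intro allI impI)
  fix v r t :: real
  assume v: "0 \<le> v" and r: "0 \<le> r" and t: "0 \<le> t \<and> t \<le> r"
  let ?y = "\<lambda>x. a * max 0 (v - x) + b * (r - x)"
  have cont: "continuous_on UNIV \<phi>"
    using D by (auto simp: continuous_on_eq_continuous_at intro: DERIV_isCont)
  have der: "((\<lambda>x. \<phi> (?y x)) has_vector_derivative - (a * of_bool (0 < max 0 (v - x)) + b) * \<phi>' (?y x)) (at x)"
    if "x \<noteq> v" for x
  proof -
    have "(?y has_real_derivative - (a * of_bool (0 < max 0 (v - x)) + b)) (at x)"
    proof (cases "x < v")
      case True
      have "((\<lambda>x. a * (v - x) + b * (r - x)) has_real_derivative - (a * of_bool (0 < max 0 (v - x)) + b)) (at x)"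
        using True by (auto intro!: derivative_eq_intros)
      then show ?thesis
        by (rule has_field_derivative_transform_within_open[of _ _ _ "{..<v}"]) (use True in auto)
    next
      case False
      with that have "v < x" by simp
      have "((\<lambda>x. b * (r - x)) has_real_derivative - (a * of_bool (0 < max 0 (v - x)) + b)) (at x)"
        using \<open>v < x\<close> by (auto intro!: derivative_eq_intros)
      then show ?thesis
        by (rule has_field_derivative_transform_within_open[of _ _ _ "{v<..}"]) (use \<open>v < x\<close> in auto)
    qed
    from DERIV_chain2[OF D this] show ?thesis
      by (simp add: has_real_derivative_iff_has_vector_derivative[symmetric] mult.commute)
  qed
  have "((\<lambda>x. - (a * of_bool (0 < max 0 (v - x)) + b) * \<phi>' (?y x)) has_integral \<phi> (?y t) - \<phi> (?y 0)) {0..t}"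
  proof (rule fundamental_theorem_of_calculus_strong[of "{v}"])
    show "continuous_on {0..t} (\<lambda>x. \<phi> (?y x))"
      by (intro continuous_on_compose2[OF cont] continuous_intros) auto
  qed (use t der in auto)
  then show "((\<lambda>x. (\<lambda>(v, r). - (a * of_bool (0 < v) + b) * \<phi>' (a * v + b * r)) (max 0 (v - x), r - x)) has_integral
     (\<lambda>(v, r). \<phi> (a * v + b * r)) (max 0 (v - t), r - t) - (\<lambda>(v, r). \<phi> (a * v + b * r)) (v, r)) {0..t}"
    using v by simp
qed

text \<open>
  The integral of \<open>k(workload)\<close> from now until the next arrival, as a function of the current state: it decreases
  at rate \<open>k(v)\<close>.
\<close>

lemma flow_antiderivative_running_integral:
  fixes k :: "real \<Rightarrow> real"
  assumes k: "continuous_on UNIV k"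
  shows "flow_antiderivative (\<lambda>(v, r). integral {0..r} (\<lambda>t. k (max 0 (v - t)))) (\<lambda>(v, r). - k v)"
  unfolding flow_antiderivative_def
proof (intro allI impI)
  fix v r b :: real
  assume v: "0 \<le> v" and r: "0 \<le> r" and b: "0 \<le> b \<and> b \<le> r"
  let ?g = "\<lambda>t. k (max 0 (v - t))"
  have cont: "continuous_on A ?g" for A
    by (intro continuous_on_compose2[OF k] continuous_intros) auto
  have int: "?g integrable_on {x..y}" for x y
    by (intro integrable_continuous_interval cont)
  have "((\<lambda>t. k (max 0 (max 0 (v - b) - t))) has_integral integral {b..r} ?g) {0..r - b}"
  proof -
    have *: "(?g has_integral integral {b..r} ?g) {b..r}"
      by (intro integrable_integral int)
    have eq: "k (max 0 (max 0 (v - b) - t)) = ?g (t + b)" if "0 \<le> t" for t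
      using that b by (intro arg_cong[of _ _ k]) (auto simp: max_def)
    have "((\<lambda>t. ?g (t + b)) has_integral integral {b..r} ?g) {0..r - b}"
      using has_integral_affinity[of ?g "integral {b..r} ?g" b r 1 b] * by simp
    then show ?thesis
      by (rule has_integral_eq[rotated]) (use eq in auto)
  qed
  then have 1: "integral {0..r - b} (\<lambda>t. k (max 0 (max 0 (v - b) - t))) = integral {b..r} ?g"
    by (rule integral_unique)
  have 2: "integral {0..b} ?g + integral {b..r} ?g = integral {0..r} ?g"
    using b by (intro Henstock_Kurzweil_Integration.integral_combine int) auto
  then have 3: "integral {b..r} ?g - integral {0..r} ?g = - integral {0..b} ?g"
    by simp
  have "((\<lambda>t. - ?g t) has_integral - integral {0..b} ?g) {0..b}"
    by (intro has_integral_neg integrable_integral int)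
  then show "((\<lambda>t. (\<lambda>(v, r). - k v) (max 0 (v - t), r - t)) has_integral
      (\<lambda>(v, r). integral {0..r} (\<lambda>t. k (max 0 (v - t)))) (max 0 (v - b), r - b)
      - (\<lambda>(v, r). integral {0..r} (\<lambda>t. k (max 0 (v - t)))) (v, r)) {0..b}"
    using 1 3 by simp
qed

lemma running_integral_LINT:
  fixes k :: "real \<Rightarrow> real"
  assumes k: "continuous_on UNIV k"
  shows "integral {0..r} (\<lambda>t. k (max 0 (v - t))) = (LINT t:{0..r}|lborel. k (max 0 (v - t)))"
    and "set_integrable lborel {0..r} (\<lambda>t. k (max 0 (v - t)))"
proof -
  have "continuous_on {0..r} (\<lambda>t. k (max 0 (v - t)))"
    by (intro continuous_on_compose2[OF k] continuous_intros) auto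
  then show si: "set_integrable lborel {0..r} (\<lambda>t. k (max 0 (v - t)))"
    by (rule borel_integrable_atLeastAtMost')
  show "integral {0..r} (\<lambda>t. k (max 0 (v - t))) = (LINT t:{0..r}|lborel. k (max 0 (v - t)))"
    using set_borel_integral_eq_integral(2)[OF si] by simp
qed

lemma running_integral_meas:
  fixes k :: "real \<Rightarrow> real"
  assumes k: "continuous_on UNIV k"
  shows "(\<lambda>p. integral {0..snd p} (\<lambda>t. k (max 0 (fst p - t)))) \<in> borel_measurable borel"
proof -
  note [measurable] = borel_measurable_continuous_onI[OF k]
  have ind: "indicator {0..r} t = (of_bool (0 \<le> t \<and> t \<le> r) :: real)" for r t :: real
    by (auto simp: indicator_def)
  have "(\<lambda>p. \<integral>t. indicator {0..snd p} t * k (max 0 (fst p - t)) \<partial>lborel) \<in> borel_measurable ((borel :: real measure) \<Otimes>\<^sub>M (borel :: real measure))"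
    unfolding ind by measurable
  then show ?thesis
    unfolding running_integral_LINT(1)[OF k] set_lebesgue_integral_def by (simp add: borel_prod)
qed

section \<open>Laws, truncations and moments\<close>

text \<open>
  The point is the case of two variables with infinite mean. Clamping both to \<open>[-n, n]\<close> is a contraction, so the clamped
  differences, which have mean zero, are dominated by the difference itself.
\<close>

lemma (in prob_space) same_law_integrable_difference:
  fixes P Q :: "'a \<Rightarrow> real"
  assumes [measurable]: "P \<in> borel_measurable M" "Q \<in> borel_measurable M"
    and law: "distr M borel P = distr M borel Q"
    and int: "integrable M (\<lambda>\<omega>. P \<omega> - Q \<omega>)"
  shows "expectation (\<lambda>\<omega>. P \<omega> - Q \<omega>) = 0"
proof -
  define c where "c n x = max (- real n) (min (real n) x)" for n x
  have [measurable]: "c n \<in> borel_measurable borel" for n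
    unfolding c_def by measurable
  have bdd: "integrable M (\<lambda>\<omega>. c n (T \<omega>))" if [measurable]: "T \<in> borel_measurable M" for n T
    by (rule integrable_const_bound[where B = "real n"]) (auto simp: c_def)
  have zero: "expectation (\<lambda>\<omega>. c n (P \<omega>) - c n (Q \<omega>)) = 0" for n
  proof -
    have "expectation (\<lambda>\<omega>. c n (P \<omega>)) = expectation (\<lambda>\<omega>. c n (Q \<omega>))"
      using integral_distr[of P M borel "c n"] integral_distr[of Q M borel "c n"] law by simp
    then show ?thesis by (simp add: bdd)
  qed
  have "(\<lambda>n. expectation (\<lambda>\<omega>. c n (P \<omega>) - c n (Q \<omega>))) \<longlonglongrightarrow> expectation (\<lambda>\<omega>. P \<omega> - Q \<omega>)"
  proof (rule integral_dominated_convergence[where w = "\<lambda>\<omega>. \<bar>P \<omega> - Q \<omega>\<bar>"])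
    have lim: "(\<lambda>n. c n x) \<longlonglongrightarrow> x" for x
    proof (rule tendsto_eventually)
      obtain N where "\<bar>x\<bar> \<le> real N" using real_arch_simple by blast
      then show "\<forall>\<^sub>F n in sequentially. c n x = x"
        by (intro eventually_sequentiallyI[of N]) (auto simp: c_def)
    qed
    show "AE \<omega> in M. (\<lambda>n. c n (P \<omega>) - c n (Q \<omega>)) \<longlonglongrightarrow> P \<omega> - Q \<omega>"
      by (intro AE_I2 tendsto_diff lim)
    show "AE \<omega> in M. norm (c n (P \<omega>) - c n (Q \<omega>)) \<le> \<bar>P \<omega> - Q \<omega>\<bar>" for n
      by (rule AE_I2) (auto simp: c_def max_def min_def)
  qed (use int in auto)
  then show ?thesis
    unfolding zero by (simp add: LIMSEQ_const_iff)
qed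

text \<open>
  Monotone convergence in the form in which moments of the stationary law are obtained.
\<close>

lemma (in prob_space) integrable_of_truncations:
  fixes Q :: "'a \<Rightarrow> real"
  assumes [measurable]: "Q \<in> borel_measurable M" and pos: "\<And>\<omega>. \<omega> \<in> space M \<Longrightarrow> 0 \<le> Q \<omega>"
    and bound: "\<And>n::nat. expectation (\<lambda>\<omega>. min (Q \<omega>) (real n)) \<le> C"
  shows "integrable M Q" "expectation Q \<le> C"
proof -
  define q where "q n \<omega> = min (Q \<omega>) (real n)" for n \<omega>
  have int: "integrable M (q n)" for n
    unfolding q_def by (rule integrable_const_bound[where B = "real n"]) (auto intro!: AE_I2 dest: pos)
  have mono: "mono (\<lambda>n. q n \<omega>)" for \<omega>
    by (auto simp: mono_def q_def)
  have "incseq (\<lambda>n. expectation (q n))"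
    using mono by (intro incseq_SucI integral_mono int) (auto simp: mono_def)
  moreover have "\<forall>n. expectation (q n) \<le> C"
    using bound unfolding q_def[abs_def] by blast
  ultimately obtain L where L: "(\<lambda>n. expectation (q n)) \<longlonglongrightarrow> L" "\<forall>n. expectation (q n) \<le> L"
    using incseq_convergent by blast
  have lim: "(\<lambda>n. q n \<omega>) \<longlonglongrightarrow> Q \<omega>" for \<omega>
  proof (rule tendsto_eventually)
    obtain N where "\<bar>Q \<omega>\<bar> \<le> real N" using real_arch_simple by blast
    then show "\<forall>\<^sub>F n in sequentially. q n \<omega> = Q \<omega>"
      by (intro eventually_sequentiallyI[of N]) (auto simp: q_def)
  qed
  have "AE \<omega> in M. 0 \<le> q n \<omega>" for n
    by (auto simp: q_def pos)
  note conv = integral_monotone_convergence_nonneg[OF int AE_I2[OF mono] this AE_I2[OF lim] L(1) assms(1)]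
  show "integrable M Q" by (rule conv)
  have "L \<le> C" using L(1) bound by (intro LIMSEQ_le_const2[OF L(1)]) (auto simp: q_def[abs_def])
  then show "expectation Q \<le> C" using conv(2) by simp
qed

lemma (in prob_space) lower_moments:
  fixes T :: "'a \<Rightarrow> real"
  assumes [measurable]: "T \<in> borel_measurable M" and pos: "\<And>\<omega>. \<omega> \<in> space M \<Longrightarrow> 0 \<le> T \<omega>"
    and third: "integrable M (\<lambda>\<omega>. T \<omega> ^ 3)"
  shows "integrable M T" "integrable M (\<lambda>\<omega>. (T \<omega>)\<^sup>2)"
proof -
  have le: "x \<le> 1 + x ^ 3 \<and> x\<^sup>2 \<le> 1 + x ^ 3" if "0 \<le> x" for x :: real
  proof (cases "x \<le> 1")
    case True
    then have "x\<^sup>2 \<le> 1" using that by (simp add: power_le_one)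
    then show ?thesis using True that zero_le_power[OF that, of 3] by linarith
  next
    case False
    then have "x ^ 1 \<le> x ^ 3" "x\<^sup>2 \<le> x ^ 3" by (intro power_increasing; simp)+
    then show ?thesis by simp
  qed
  have int: "integrable M (\<lambda>\<omega>. 1 + T \<omega> ^ 3)"
    using third by auto
  show "integrable M T"
    by (rule Bochner_Integration.integrable_bound[OF int], simp, rule AE_I2) (use pos le in auto)
  show "integrable M (\<lambda>\<omega>. (T \<omega>)\<^sup>2)"
    by (rule Bochner_Integration.integrable_bound[OF int], simp, rule AE_I2) (use pos le in auto)
qed

lemma (in prob_space) expectation_positive:
  fixes T :: "'a \<Rightarrow> real"
  assumes "integrable M T" "\<And>\<omega>. \<omega> \<in> space M \<Longrightarrow> 0 < T \<omega>"
  shows "0 < expectation T"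
  using integral_less_AE_space[of "\<lambda>_. 0" T] assms by (simp add: emeasure_space_1)

text \<open>
  A variable with variance zero is almost surely its mean, hence lattice with span its mean.
\<close>

lemma nonlattice_variance_pos:
  assumes M: "prob_space M" and int: "integrable M T" "integrable M (\<lambda>\<omega>. (T \<omega>)\<^sup>2)"
    and pos: "0 < (\<integral>\<omega>. T \<omega> \<partial>M)" and nl: "nonlattice M T"
  shows "0 < prob_space.variance M T"
proof -
  interpret prob_space M by (rule M)
  have "variance T \<noteq> 0"
  proof
    assume "variance T = 0"
    moreover have "integrable M (\<lambda>\<omega>. (T \<omega> - expectation T)\<^sup>2)"
      using int by (auto simp: power2_diff)
    ultimately have "AE \<omega> in M. (T \<omega> - expectation T)\<^sup>2 = 0"
      by (subst (asm) integral_nonneg_eq_0_iff_AE) auto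
    then have "AE \<omega> in M. \<exists>k::int. T \<omega> = of_int k * expectation T"
      by eventually_elim (auto intro: exI[of _ 1])
    with pos nl show False by (auto simp: nonlattice_def)
  qed
  moreover have "0 \<le> variance T" by (rule variance_positive)
  ultimately show ?thesis by linarith
qed

section \<open>The stationary workload process\<close>

lemma arrival_integral_finite:
  assumes "finite {m. t m \<le> 1}"
  shows "arrival_integral t g = (\<Sum>m | t m \<le> 1. g m)"
proof -
  have "arrival_integral t g = (\<Sum>m | t m \<le> 1. g m * of_bool (t m \<le> 1))"
    unfolding arrival_integral_def using assms by (intro suminf_finite) auto
  then show ?thesis by simp
qed

locale workload_model = prob_space M for M :: "'a measure" +
  fixes V0 R0 :: "'a \<Rightarrow> real" and U S :: "nat \<Rightarrow> 'a \<Rightarrow> real"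
  assumes V0_meas[measurable]: "V0 \<in> borel_measurable M"
    and R0_meas[measurable]: "R0 \<in> borel_measurable M"
    and U_meas[measurable]: "\<And>m. U m \<in> borel_measurable M"
    and S_meas[measurable]: "\<And>m. S m \<in> borel_measurable M"
    and V0_nonneg: "\<And>\<omega>. \<omega> \<in> space M \<Longrightarrow> 0 \<le> V0 \<omega>"
    and R0_pos: "\<And>\<omega>. \<omega> \<in> space M \<Longrightarrow> 0 < R0 \<omega>"
    and U_pos: "\<And>m \<omega>. \<omega> \<in> space M \<Longrightarrow> 0 < U m \<omega>"
    and S_nonneg: "\<And>m \<omega>. \<omega> \<in> space M \<Longrightarrow> 0 \<le> S m \<omega>"
begin

definition \<tau> :: "nat \<Rightarrow> 'a \<Rightarrow> real" where
  "\<tau> m \<omega> = arrival_time (R0 \<omega>) (\<lambda>k. U k \<omega>) m"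

definition before :: "nat \<Rightarrow> 'a \<Rightarrow> real" where
  "before m \<omega> = workload_before (V0 \<omega>) (R0 \<omega>) (\<lambda>k. U k \<omega>) (\<lambda>k. S k \<omega>) m"

definition W :: "real \<Rightarrow> 'a \<Rightarrow> real" where
  "W t \<omega> = workload (V0 \<omega>) (R0 \<omega>) (\<lambda>k. U k \<omega>) (\<lambda>k. S k \<omega>) t"

definition R :: "real \<Rightarrow> 'a \<Rightarrow> real" where
  "R t \<omega> = residual_interarrival (R0 \<omega>) (\<lambda>k. U k \<omega>) t"

text \<open>
  The indicator of arrival \<open>m\<close> occurring in \<open>[0,1]\<close>, as a real number so that it can be a factor under expectations.
\<close>

definition arr :: "nat \<Rightarrow> 'a \<Rightarrow> real" where
  "arr m \<omega> = of_bool (\<tau> m \<omega> \<le> 1)"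

lemma path: "\<omega> \<in> space M \<Longrightarrow> queue_path (V0 \<omega>) (R0 \<omega>) (\<lambda>k. U k \<omega>) (\<lambda>k. S k \<omega>)"
  by unfold_locales (auto intro: V0_nonneg R0_pos U_pos S_nonneg)

lemma initial_state: "\<omega> \<in> space M \<Longrightarrow> W 0 \<omega> = V0 \<omega>" "\<omega> \<in> space M \<Longrightarrow> R 0 \<omega> = R0 \<omega>"
  using queue_path.state_0[OF path] by (auto simp: W_def R_def)

lemma before_nonneg: "0 \<le> before m \<omega>"
  by (simp add: before_def workload_before_nonneg)

lemma after_eq: "workload_after (V0 \<omega>) (R0 \<omega>) (\<lambda>k. U k \<omega>) (\<lambda>k. S k \<omega>) m = before m \<omega> + S m \<omega>"
  by (simp add: before_def workload_before_def)

lemma tau_meas[measurable]: "\<tau> m \<in> borel_measurable M"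
  unfolding \<tau>_def arrival_time_def by measurable

lemma after_meas[measurable]:
  "(\<lambda>\<omega>. workload_after (V0 \<omega>) (R0 \<omega>) (\<lambda>k. U k \<omega>) (\<lambda>k. S k \<omega>) m) \<in> borel_measurable M"
  by (induction m) auto

lemma before_meas[measurable]: "before m \<in> borel_measurable M"
  unfolding before_def workload_before_def by measurable

lemma arr_meas[measurable]: "arr m \<in> borel_measurable M"
  unfolding arr_def by measurable

lemma arrivals_meas[measurable]:
  "(\<lambda>(t, \<omega>). arrivals (R0 \<omega>) (\<lambda>k. U k \<omega>) t) \<in> measurable (borel \<Otimes>\<^sub>M M) (count_space UNIV)"
proof -
  have "(\<lambda>x. card {m. \<tau> m (snd x) \<le> fst x}) \<in> measurable (borel \<Otimes>\<^sub>M M) (count_space UNIV)"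
    by (rule measurable_card) simp
  then show ?thesis by (simp add: arrivals_def \<tau>_def case_prod_beta)
qed

lemma state_meas:
  "(\<lambda>(t, \<omega>). W t \<omega>) \<in> borel_measurable (borel \<Otimes>\<^sub>M M)"
  "(\<lambda>(t, \<omega>). R t \<omega>) \<in> borel_measurable (borel \<Otimes>\<^sub>M M)"
proof -
  have [measurable]: "(\<lambda>x. arrivals (R0 (snd x)) (\<lambda>k. U k (snd x)) (fst x))
      \<in> measurable (borel \<Otimes>\<^sub>M M) (count_space UNIV)"
    using arrivals_meas by (simp add: case_prod_beta)
  have "(\<lambda>x. (\<lambda>n x. case n of 0 \<Rightarrow> max 0 (V0 (snd x) - fst x)
      | Suc m \<Rightarrow> max 0 (workload_after (V0 (snd x)) (R0 (snd x)) (\<lambda>k. U k (snd x)) (\<lambda>k. S k (snd x)) m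
           - (fst x - \<tau> m (snd x)))) (arrivals (R0 (snd x)) (\<lambda>k. U k (snd x)) (fst x)) x)
      \<in> borel_measurable (borel \<Otimes>\<^sub>M M)"
    by (rule measurable_compose_countable) (simp_all split: nat.split)
  then show "(\<lambda>(t, \<omega>). W t \<omega>) \<in> borel_measurable (borel \<Otimes>\<^sub>M M)"
    by (simp only: W_def workload_def \<tau>_def case_prod_beta')
  have "(\<lambda>x. (\<lambda>n x. \<tau> n (snd x) - fst x) (arrivals (R0 (snd x)) (\<lambda>k. U k (snd x)) (fst x)) x)
      \<in> borel_measurable (borel \<Otimes>\<^sub>M M)"
    by (rule measurable_compose_countable) simp_all
  then show "(\<lambda>(t, \<omega>). R t \<omega>) \<in> borel_measurable (borel \<Otimes>\<^sub>M M)"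
    by (simp add: R_def residual_interarrival_def \<tau>_def case_prod_beta)
qed

lemma W_meas[measurable]: "W t \<in> borel_measurable M"
  using measurable_compose[OF measurable_Pair1' state_meas(1), of t] by simp

lemma R_meas[measurable]: "R t \<in> borel_measurable M"
  using measurable_compose[OF measurable_Pair1' state_meas(2), of t] by simp

end

locale stationary_queue = workload_model +
  assumes U_law: "\<And>m. distr M borel (U m) = distr M borel (U 0)"
    and S_law: "\<And>m. distr M borel (S m) = distr M borel (S 0)"
    and indep_seq: "indep_vars (\<lambda>_. borel)
        (case_nat (\<lambda>\<omega>. (V0 \<omega>, R0 \<omega>)) (\<lambda>m \<omega>. (U m \<omega>, S m \<omega>))) UNIV"
    and indep_US: "\<And>m. indep_var borel (U m) borel (S m)"
    and stationary: "\<And>t. 0 \<le> t \<Longrightarrow>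
        distr M borel (\<lambda>\<omega>. (W t \<omega>, R t \<omega>)) = distr M borel (\<lambda>\<omega>. (V0 \<omega>, R0 \<omega>))"
    and U_third_moment: "integrable M (\<lambda>\<omega>. U 0 \<omega> ^ 3)"
    and S_third_moment: "integrable M (\<lambda>\<omega>. S 0 \<omega> ^ 3)"
    and stable: "expectation (S 0) < expectation (U 0)"
begin

lemma state_law:
  assumes "0 \<le> t" and [measurable]: "D \<in> borel_measurable borel"
  shows "distr M borel (\<lambda>\<omega>. D (W t \<omega>, R t \<omega>)) = distr M borel (\<lambda>\<omega>. D (V0 \<omega>, R0 \<omega>) :: real)"
proof -
  have [measurable]: "(\<lambda>\<omega>. (W t \<omega>, R t \<omega>)) \<in> measurable M borel" "(\<lambda>\<omega>. (V0 \<omega>, R0 \<omega>)) \<in> measurable M borel"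
    by (auto simp flip: borel_prod)
  have "distr (distr M borel (\<lambda>\<omega>. (W t \<omega>, R t \<omega>))) borel D
      = distr (distr M borel (\<lambda>\<omega>. (V0 \<omega>, R0 \<omega>))) borel D"
    using stationary[OF assms(1)] by simp
  then show ?thesis
    by (subst (asm) (1 2) distr_distr) (simp_all add: comp_def)
qed

lemma state_expectation:
  fixes D :: "real \<times> real \<Rightarrow> real"
  assumes t: "0 \<le> t" and D[measurable]: "D \<in> borel_measurable borel"
  shows "integrable M (\<lambda>\<omega>. D (W t \<omega>, R t \<omega>)) \<longleftrightarrow> integrable M (\<lambda>\<omega>. D (V0 \<omega>, R0 \<omega>))"
    "expectation (\<lambda>\<omega>. D (W t \<omega>, R t \<omega>)) = expectation (\<lambda>\<omega>. D (V0 \<omega>, R0 \<omega>))"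
proof -
  have [measurable]: "(\<lambda>\<omega>. (W t \<omega>, R t \<omega>)) \<in> measurable M borel" "(\<lambda>\<omega>. (V0 \<omega>, R0 \<omega>)) \<in> measurable M borel"
    by (auto simp flip: borel_prod)
  have m: "(\<lambda>\<omega>. D (W t \<omega>, R t \<omega>)) \<in> borel_measurable M" "(\<lambda>\<omega>. D (V0 \<omega>, R0 \<omega>)) \<in> borel_measurable M"
    by measurable
  have id: "(\<lambda>x::real. x) \<in> borel_measurable borel"
    by measurable
  show "integrable M (\<lambda>\<omega>. D (W t \<omega>, R t \<omega>)) \<longleftrightarrow> integrable M (\<lambda>\<omega>. D (V0 \<omega>, R0 \<omega>))"
    using integrable_distr_eq[OF m(1) id] integrable_distr_eq[OF m(2) id]
    unfolding state_law[OF t D] by blast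
  show "expectation (\<lambda>\<omega>. D (W t \<omega>, R t \<omega>)) = expectation (\<lambda>\<omega>. D (V0 \<omega>, R0 \<omega>))"
    using integral_distr[OF m(1) id] integral_distr[OF m(2) id]
    unfolding state_law[OF t D] by metis
qed

text \<open>
  Fubini's theorem, with stationarity applied at each fixed time.
\<close>

lemma expectation_of_time_integral:
  fixes D :: "real \<times> real \<Rightarrow> real"
  assumes D[measurable]: "D \<in> borel_measurable borel"
    and int: "integrable M (\<lambda>\<omega>. D (V0 \<omega>, R0 \<omega>))"
  shows "AE \<omega> in M. set_integrable lborel {0..1} (\<lambda>t. D (W t \<omega>, R t \<omega>))" (is ?A)
    and "integrable M (\<lambda>\<omega>. LINT t:{0..1}|lborel. D (W t \<omega>, R t \<omega>))" (is ?B)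
    and "expectation (\<lambda>\<omega>. LINT t:{0..1}|lborel. D (W t \<omega>, R t \<omega>)) = expectation (\<lambda>\<omega>. D (V0 \<omega>, R0 \<omega>))" (is ?C)
proof -
  interpret L: pair_sigma_finite lborel M
    by unfold_locales
  interpret L': pair_sigma_finite M lborel
    by unfold_locales
  define G where "G = (\<lambda>(t, \<omega>). indicator {0..1} t * D (W t \<omega>, R t \<omega>))"
  have [measurable]: "(\<lambda>x. W (fst x) (snd x)) \<in> borel_measurable (borel \<Otimes>\<^sub>M M)"
    "(\<lambda>x. R (fst x) (snd x)) \<in> borel_measurable (borel \<Otimes>\<^sub>M M)"
    using state_meas by (simp_all add: case_prod_beta)
  have [measurable]: "(\<lambda>x. (W (fst x) (snd x), R (fst x) (snd x))) \<in> measurable (borel \<Otimes>\<^sub>M M) borel"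
    by (subst borel_prod[symmetric]) measurable
  have "(\<lambda>x. indicator {0..1} (fst x) * D (W (fst x) (snd x), R (fst x) (snd x)))
      \<in> borel_measurable (borel \<Otimes>\<^sub>M M)"
    by measurable
  moreover have "sets (lborel \<Otimes>\<^sub>M M) = sets (borel \<Otimes>\<^sub>M M)"
    by (intro sets_pair_measure_cong) auto
  ultimately have G: "G \<in> borel_measurable (lborel \<Otimes>\<^sub>M M)"
    unfolding G_def case_prod_beta' using measurable_cong_sets by blast
  have norm: "(\<integral>\<omega>. norm (G (t, \<omega>)) \<partial>M) = indicator {0..1} t * expectation (\<lambda>\<omega>. \<bar>D (V0 \<omega>, R0 \<omega>)\<bar>)" for t
    using state_expectation(2)[of t "\<lambda>x. \<bar>D x\<bar>"] by (auto simp: G_def indicator_def)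
  \<comment> \<open>Integrability is checked by integrating over the sample space first, where stationarity makes the norm constant in time.\<close>
  have GI: "integrable (lborel \<Otimes>\<^sub>M M) G"
  proof (rule L.Fubini_integrable[OF G])
    show "integrable lborel (\<lambda>t. \<integral>\<omega>. norm (G (t, \<omega>)) \<partial>M)"
      unfolding norm by simp
    show "AE t in lborel. integrable M (\<lambda>\<omega>. G (t, \<omega>))"
      using state_expectation(1)[OF _ D] int by (auto simp: G_def indicator_def)
  qed
  note GI' = L.integrable_product_swap[OF GI]
  show ?A
    using L'.AE_integrable_fst'[OF GI'] by (simp add: G_def set_integrable_def)
  show ?B
    using L'.integrable_fst'[OF GI'] by (simp add: G_def set_lebesgue_integral_def)
  have "expectation (\<lambda>\<omega>. LINT t:{0..1}|lborel. D (W t \<omega>, R t \<omega>)) = integral\<^sup>L (M \<Otimes>\<^sub>M lborel) (\<lambda>(\<omega>, t). G (t, \<omega>))"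
    using L'.integral_fst'[OF GI'] by (simp add: G_def set_lebesgue_integral_def)
  also have "\<dots> = (\<integral>t. (\<integral>\<omega>. G (t, \<omega>) \<partial>M) \<partial>lborel)"
    using L.integral_product_swap[OF G] L.integral_fst'[OF GI] by simp
  also have "\<dots> = (\<integral>t. indicator {0..1::real} t * expectation (\<lambda>\<omega>. D (V0 \<omega>, R0 \<omega>)) \<partial>lborel)"
  proof -
    have "(\<integral>\<omega>. G (t, \<omega>) \<partial>M) = indicator {0..1} t * expectation (\<lambda>\<omega>. D (V0 \<omega>, R0 \<omega>))" for t
      using state_expectation(2)[OF _ D, of t] by (auto simp: G_def indicator_def)
    then show ?thesis by (simp only:)
  qed
  finally show ?C by simp
qed

section \<open>Sums over arrivals\<close>

subsection \<open>Independence of an arrival from the past\<close>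

text \<open>
  The time of arrival \<open>m\<close> and the workload it finds are functions of the initial state and of the marks of earlier arrivals,
  that is, of the coordinates \<open>{..m}\<close> of the independent sequence; the marks of arrival \<open>m\<close> are coordinate
  \<open>Suc m\<close>, since coordinate 0 is the initial state.
\<close>

lemma past_future_independent:
  fixes a b :: "real \<times> real \<Rightarrow> real"
  assumes [measurable]: "a \<in> borel_measurable borel" "b \<in> borel_measurable borel"
  shows "indep_var borel (\<lambda>\<omega>. a (\<tau> m \<omega>, before m \<omega>)) borel (\<lambda>\<omega>. b (U m \<omega>, S m \<omega>))"
proof -
  let ?Z = "case_nat (\<lambda>\<omega>. (V0 \<omega>, R0 \<omega>)) (\<lambda>m \<omega>. (U m \<omega>, S m \<omega>))"
  let ?P = "PiM {..m} (\<lambda>_. borel :: (real \<times> real) measure)"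
  define v r u s where "v = (\<lambda>z :: nat \<Rightarrow> real \<times> real. fst (z 0))" and "r = (\<lambda>z :: nat \<Rightarrow> real \<times> real. snd (z 0))"
    and "u = (\<lambda>(z :: nat \<Rightarrow> real \<times> real) k. fst (z (Suc k)))" and "s = (\<lambda>(z :: nat \<Rightarrow> real \<times> real) k. snd (z (Suc k)))"
  have fst_snd[measurable]: "(fst :: real \<times> real \<Rightarrow> real) \<in> borel_measurable borel" "(snd :: real \<times> real \<Rightarrow> real) \<in> borel_measurable borel"
    by (auto simp flip: borel_prod)
  have comp: "(\<lambda>z. z k) \<in> measurable ?P borel" if "k \<le> m" for k
    using that by (intro measurable_component_singleton) auto
  have vr[measurable]: "v \<in> borel_measurable ?P" "r \<in> borel_measurable ?P"
    unfolding v_def r_def by (auto intro: measurable_compose[OF comp] fst_snd)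
  have us: "(\<lambda>z. u z k) \<in> borel_measurable ?P" "(\<lambda>z. s z k) \<in> borel_measurable ?P" if "k < m" for k
    using that unfolding u_def s_def by (auto intro!: measurable_compose[OF comp] fst_snd)
  have t_meas[measurable]: "(\<lambda>z. arrival_time (r z) (u z) m) \<in> borel_measurable ?P"
    unfolding arrival_time_def by (intro borel_measurable_add vr borel_measurable_sum us) auto
  have w: "(\<lambda>z. workload_after (v z) (r z) (u z) (s z) k) \<in> borel_measurable ?P" if "k < m" for k
    using that
  proof (induction k)
    case 0
    note [measurable] = us[of 0]
    from 0 show ?case by simp
  next
    case (Suc k)
    note [measurable] = us[of k] us[of "Suc k"]
    from Suc have [measurable]: "(\<lambda>z. workload_after (v z) (r z) (u z) (s z) k) \<in> borel_measurable ?P" by simp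
    show ?case using Suc by simp
  qed
  have w_meas[measurable]: "(\<lambda>z. workload_before (v z) (r z) (u z) (s z) m) \<in> borel_measurable ?P"
  proof (cases m)
    case 0
    show ?thesis unfolding 0 workload_before_simps using vr unfolding 0 by simp
  next
    case (Suc k)
    have "(\<lambda>z. max 0 (workload_after (v z) (r z) (u z) (s z) k - u z k)) \<in> borel_measurable ?P"
      using w[of k] us[of k] Suc by (intro borel_measurable_max borel_measurable_diff) auto
    then show ?thesis unfolding Suc workload_before_simps .
  qed
  have past: "(\<lambda>z. a (arrival_time (r z) (u z) m, workload_before (v z) (r z) (u z) (s z) m)) \<in> borel_measurable ?P"
    by (rule measurable_compose[OF measurable_Pair[OF t_meas w_meas, unfolded borel_prod] assms(1)])
  have future: "(\<lambda>z. b (z (Suc m))) \<in> borel_measurable (PiM {Suc m} (\<lambda>_. borel :: (real \<times> real) measure))"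
    by (rule measurable_compose[OF _ assms(2)], rule measurable_component_singleton) simp
  let ?z = "\<lambda>\<omega>. restrict (\<lambda>i. ?Z i \<omega>) {..m}"
  have tau_eq: "arrival_time (r (?z \<omega>)) (u (?z \<omega>)) m = \<tau> m \<omega>" for \<omega>
    by (simp add: arrival_time_def \<tau>_def r_def u_def)
  have before_eq: "workload_before (v (?z \<omega>)) (r (?z \<omega>)) (u (?z \<omega>)) (s (?z \<omega>)) m = before m \<omega>" for \<omega>
  proof -
    have "v (?z \<omega>) = V0 \<omega>" "r (?z \<omega>) = R0 \<omega>"
      by (simp_all add: v_def r_def)
    moreover have "workload_before x y (u (?z \<omega>)) (s (?z \<omega>)) m = workload_before x y (\<lambda>k. U k \<omega>) (\<lambda>k. S k \<omega>) m" for x y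
      by (rule workload_before_cong) (simp_all add: u_def s_def)
    ultimately show ?thesis by (simp add: before_def)
  qed
  have "indep_var ?P ?z (PiM {Suc m} (\<lambda>_. borel)) (\<lambda>\<omega>. restrict (\<lambda>i. ?Z i \<omega>) {Suc m})"
    by (rule indep_var_restrict[OF indep_seq]) auto
  from indep_var_compose[OF this past future] show ?thesis
    by (simp add: comp_def tau_eq before_eq)
qed

lemma US_law:
  fixes b :: "real \<times> real \<Rightarrow> real"
  assumes b[measurable]: "b \<in> borel_measurable borel"
  shows "distr M borel (\<lambda>\<omega>. b (U m \<omega>, S m \<omega>)) = distr M borel (\<lambda>\<omega>. b (U 0 \<omega>, S 0 \<omega>))"
proof -
  have prod: "distr M (borel \<Otimes>\<^sub>M borel) (\<lambda>\<omega>. (U k \<omega>, S k \<omega>)) = distr M borel (U k) \<Otimes>\<^sub>M distr M borel (S k)" for k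
    using indep_US[of k] by (simp add: indep_var_distribution_eq)
  have "distr M (borel \<Otimes>\<^sub>M borel) (\<lambda>\<omega>. (U m \<omega>, S m \<omega>)) = distr M (borel \<Otimes>\<^sub>M borel) (\<lambda>\<omega>. (U 0 \<omega>, S 0 \<omega>))"
    unfolding prod by (simp add: U_law[of m] S_law[of m])
  then have "distr (distr M (borel \<Otimes>\<^sub>M borel) (\<lambda>\<omega>. (U m \<omega>, S m \<omega>))) borel b
    = distr (distr M (borel \<Otimes>\<^sub>M borel) (\<lambda>\<omega>. (U 0 \<omega>, S 0 \<omega>))) borel b"
    by simp
  moreover have "b \<in> borel_measurable (borel \<Otimes>\<^sub>M borel)"
    using b by (simp add: borel_prod)
  ultimately show ?thesis
    by (subst (asm) (1 2) distr_distr) (simp_all add: comp_def)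
qed

lemma US_expectation:
  fixes b :: "real \<times> real \<Rightarrow> real"
  assumes b[measurable]: "b \<in> borel_measurable borel"
  shows "integrable M (\<lambda>\<omega>. b (U m \<omega>, S m \<omega>)) \<longleftrightarrow> integrable M (\<lambda>\<omega>. b (U 0 \<omega>, S 0 \<omega>))"
    and "expectation (\<lambda>\<omega>. b (U m \<omega>, S m \<omega>)) = expectation (\<lambda>\<omega>. b (U 0 \<omega>, S 0 \<omega>))"
proof -
  have [measurable]: "(\<lambda>\<omega>. (U k \<omega>, S k \<omega>)) \<in> measurable M borel" for k
    by (auto simp flip: borel_prod)
  have m: "(\<lambda>\<omega>. b (U k \<omega>, S k \<omega>)) \<in> borel_measurable M" for k
    by measurable
  have id: "(\<lambda>x::real. x) \<in> borel_measurable borel"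
    by measurable
  show "integrable M (\<lambda>\<omega>. b (U m \<omega>, S m \<omega>)) \<longleftrightarrow> integrable M (\<lambda>\<omega>. b (U 0 \<omega>, S 0 \<omega>))"
    using integrable_distr_eq[OF m id, of m] integrable_distr_eq[OF m id, of 0]
    unfolding US_law[OF b, of m] by blast
  show "expectation (\<lambda>\<omega>. b (U m \<omega>, S m \<omega>)) = expectation (\<lambda>\<omega>. b (U 0 \<omega>, S 0 \<omega>))"
    using integral_distr[OF m id, of m] integral_distr[OF m id, of 0]
    unfolding US_law[OF b, of m] by metis
qed

lemma arr_product:
  fixes a :: "real \<Rightarrow> real" and b :: "real \<times> real \<Rightarrow> real"
  assumes a[measurable]: "a \<in> borel_measurable borel" and b[measurable]: "b \<in> borel_measurable borel"
    and ia: "integrable M (\<lambda>\<omega>. arr m \<omega> * a (before m \<omega>))" and ib: "integrable M (\<lambda>\<omega>. b (U 0 \<omega>, S 0 \<omega>))"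
  shows "integrable M (\<lambda>\<omega>. arr m \<omega> * (a (before m \<omega>) * b (U m \<omega>, S m \<omega>)))"
    and "expectation (\<lambda>\<omega>. arr m \<omega> * (a (before m \<omega>) * b (U m \<omega>, S m \<omega>)))
      = expectation (\<lambda>\<omega>. arr m \<omega> * a (before m \<omega>)) * expectation (\<lambda>\<omega>. b (U 0 \<omega>, S 0 \<omega>))"
proof -
  have fst_snd[measurable]: "(fst :: real \<times> real \<Rightarrow> real) \<in> borel_measurable borel" "(snd :: real \<times> real \<Rightarrow> real) \<in> borel_measurable borel"
    by (auto simp flip: borel_prod)
  have "indep_var borel (\<lambda>\<omega>. (\<lambda>(t, w). of_bool (t \<le> 1) * a w) (\<tau> m \<omega>, before m \<omega>)) borel (\<lambda>\<omega>. b (U m \<omega>, S m \<omega>))"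
    by (rule past_future_independent) (simp_all add: case_prod_beta')
  then have ind: "indep_var borel (\<lambda>\<omega>. arr m \<omega> * a (before m \<omega>)) borel (\<lambda>\<omega>. b (U m \<omega>, S m \<omega>))"
    by (simp add: arr_def)
  have ibm: "integrable M (\<lambda>\<omega>. b (U m \<omega>, S m \<omega>))"
    using ib US_expectation(1)[OF b] by simp
  show "integrable M (\<lambda>\<omega>. arr m \<omega> * (a (before m \<omega>) * b (U m \<omega>, S m \<omega>)))"
    using indep_var_integrable[OF ind ia ibm] by (simp add: mult.assoc)
  show "expectation (\<lambda>\<omega>. arr m \<omega> * (a (before m \<omega>) * b (U m \<omega>, S m \<omega>)))
      = expectation (\<lambda>\<omega>. arr m \<omega> * a (before m \<omega>)) * expectation (\<lambda>\<omega>. b (U 0 \<omega>, S 0 \<omega>))"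
    using indep_var_lebesgue_integral[OF ind ia ibm] US_expectation(2)[OF b] by (simp add: mult.assoc)
qed

subsection \<open>Campbell formula\<close>

lemma arr_range: "0 \<le> arr m \<omega>" "arr m \<omega> \<le> 1"
  by (simp_all add: arr_def)

lemma arr_integrable: "integrable M (arr m)"
  by (rule integrable_const_bound[where B = 1]) (auto simp: arr_def)

text \<open>
  By independence, the expectation of the pathwise bound on truncated interarrival times is the mean
  number of arrivals times \<open>E min U 1\<close>, and the latter is positive.
\<close>

lemma arrivals_summable: "summable (\<lambda>m. expectation (arr m))"
proof -
  \<comment> \<open>Truncation at 1 keeps the last interarrival time, which may reach far beyond time 1, under control.\<close>
  define e where "e = expectation (\<lambda>\<omega>. min (U 0 \<omega>) 1)"
  have int: "integrable M (\<lambda>\<omega>. min (U 0 \<omega>) 1)"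
    by (rule integrable_const_bound[where B = 1]) (auto intro!: AE_I2 dest: U_pos[of _ 0])
  have "0 < e"
    unfolding e_def using integral_less_AE_space[of "\<lambda>_. 0" "\<lambda>\<omega>. min (U 0 \<omega>) 1"] int
    by (simp add: U_pos emeasure_space_1)
  have [measurable]: "(\<lambda>(u, s). min u 1 :: real) \<in> borel_measurable (borel :: (real \<times> real) measure)"
    by (subst borel_prod[symmetric]) measurable
  have e_term: "expectation (\<lambda>\<omega>. arr m \<omega> * min (U m \<omega>) 1) = expectation (arr m) * e"
    "integrable M (\<lambda>\<omega>. arr m \<omega> * min (U m \<omega>) 1)" for m
    using arr_product[of "\<lambda>_. 1" "\<lambda>(u, s). min u 1" m] arr_integrable int by (simp_all add: e_def)
  have "(\<Sum>m<K. expectation (arr m)) \<le> 2 / e" for K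
  proof -
    have "(\<Sum>m<K. expectation (arr m)) * e = expectation (\<lambda>\<omega>. \<Sum>m<K. arr m \<omega> * min (U m \<omega>) 1)"
      by (subst Bochner_Integration.integral_sum) (auto simp: e_term sum_distrib_right)
    also have "\<dots> \<le> expectation (\<lambda>\<omega>. 2)"
    proof (rule integral_mono)
      fix \<omega> assume "\<omega> \<in> space M"
      then show "(\<Sum>m<K. arr m \<omega> * min (U m \<omega>) 1) \<le> 2"
        using queue_path.sum_truncated_interarrivals[OF path, of \<omega> K] by (simp add: arr_def \<tau>_def)
    qed (auto intro: e_term)
    finally show ?thesis using \<open>0 < e\<close> by (simp add: prob_space field_simps)
  qed
  then show ?thesis
    by (intro summableI_nonneg_bounded) (auto intro: integral_nonneg_AE simp: arr_range)
qed

lemma finite_arrivals: "AE \<omega> in M. finite {m. \<tau> m \<omega> \<le> 1}"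
proof -
  have "measure M {\<omega> \<in> space M. \<tau> m \<omega> \<le> 1} = expectation (arr m)" for m
  proof -
    have "expectation (arr m) = expectation (indicator {\<omega> \<in> space M. \<tau> m \<omega> \<le> 1})"
      by (intro Bochner_Integration.integral_cong) (auto simp: arr_def)
    then show ?thesis by simp
  qed
  then have "AE \<omega> in M. eventually (\<lambda>m. \<omega> \<in> space M - {\<omega> \<in> space M. \<tau> m \<omega> \<le> 1}) sequentially"
    using arrivals_summable by (intro borel_cantelli_AE1) (auto simp: emeasure_eq_measure)
  then show ?thesis
  proof eventually_elim
    case (elim \<omega>)
    then obtain N where "\<And>m. N \<le> m \<Longrightarrow> \<not> \<tau> m \<omega> \<le> 1"
      by (auto simp: eventually_sequentially)
    then have "{m. \<tau> m \<omega> \<le> 1} \<subseteq> {..<N}" by (auto simp: not_less[symmetric])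
    then show ?case by (rule finite_subset) simp
  qed
qed

text \<open>
  Integrability of \<open>a(workload found on arrival)\<close> with respect to the Palm measure of the arrivals in \<open>[0,1]\<close>, that
  is, finiteness of the expected sum of absolute values.
\<close>

definition palm_integrable :: "(real \<Rightarrow> real) \<Rightarrow> bool" where
  "palm_integrable a \<longleftrightarrow> (\<forall>m. integrable M (\<lambda>\<omega>. arr m \<omega> * a (before m \<omega>))) \<and>
     summable (\<lambda>m. expectation (\<lambda>\<omega>. arr m \<omega> * \<bar>a (before m \<omega>)\<bar>))"

text \<open>
  The unnormalized Palm expectation: the expected sum over the arrivals in \<open>[0,1]\<close>.
\<close>

definition palm_mean :: "(real \<Rightarrow> real) \<Rightarrow> real" where
  "palm_mean a = (\<Sum>m. expectation (\<lambda>\<omega>. arr m \<omega> * a (before m \<omega>)))"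

definition arrival_sum :: "(nat \<Rightarrow> 'a \<Rightarrow> real) \<Rightarrow> 'a \<Rightarrow> real" where
  "arrival_sum g \<omega> = arrival_integral (\<lambda>m. \<tau> m \<omega>) (\<lambda>m. g m \<omega>)"

lemma arrival_sum_eq: "arrival_sum g \<omega> = (\<Sum>m. arr m \<omega> * g m \<omega>)"
  by (simp add: arrival_sum_def arrival_integral_def arr_def mult.commute)

lemma arrival_sum_meas[measurable]:
  "(\<And>m. g m \<in> borel_measurable M) \<Longrightarrow> arrival_sum g \<in> borel_measurable M"
  unfolding arrival_sum_eq[abs_def] by measurable

lemma arrival_sum_add_AE:
  "AE \<omega> in M. arrival_sum (\<lambda>m \<omega>. g m \<omega> + h m \<omega>) \<omega> = arrival_sum g \<omega> + arrival_sum h \<omega>"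
  using finite_arrivals
  by eventually_elim (simp add: arrival_sum_def arrival_integral_finite sum.distrib)

lemma arrival_sum_add:
  assumes m: "\<And>m. g m \<in> borel_measurable M" "\<And>m. h m \<in> borel_measurable M"
    and int: "integrable M (arrival_sum g)" "integrable M (arrival_sum h)"
  shows "integrable M (arrival_sum (\<lambda>m \<omega>. g m \<omega> + h m \<omega>))"
    "expectation (arrival_sum (\<lambda>m \<omega>. g m \<omega> + h m \<omega>)) = expectation (arrival_sum g) + expectation (arrival_sum h)"
proof -
  note [measurable] = m
  have meas: "arrival_sum (\<lambda>m \<omega>. g m \<omega> + h m \<omega>) \<in> borel_measurable M"
    "(\<lambda>\<omega>. arrival_sum g \<omega> + arrival_sum h \<omega>) \<in> borel_measurable M"
    by measurable
  show "integrable M (arrival_sum (\<lambda>m \<omega>. g m \<omega> + h m \<omega>))"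
    using integrable_cong_AE[OF meas arrival_sum_add_AE] int by simp
  show "expectation (arrival_sum (\<lambda>m \<omega>. g m \<omega> + h m \<omega>)) = expectation (arrival_sum g) + expectation (arrival_sum h)"
    using integral_cong_AE[OF meas arrival_sum_add_AE] int by simp
qed

lemma arrival_sum_scale:
  assumes m: "\<And>m. g m \<in> borel_measurable M" and int: "integrable M (arrival_sum g)"
  shows "integrable M (arrival_sum (\<lambda>m \<omega>. c * g m \<omega>))"
    "expectation (arrival_sum (\<lambda>m \<omega>. c * g m \<omega>)) = c * expectation (arrival_sum g)"
proof -
  note [measurable] = m
  have eq: "AE \<omega> in M. arrival_sum (\<lambda>m \<omega>. c * g m \<omega>) \<omega> = c * arrival_sum g \<omega>"
    using finite_arrivals
    by eventually_elim (simp add: arrival_sum_def arrival_integral_finite sum_distrib_left)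
  have meas: "arrival_sum (\<lambda>m \<omega>. c * g m \<omega>) \<in> borel_measurable M"
    "(\<lambda>\<omega>. c * arrival_sum g \<omega>) \<in> borel_measurable M"
    by measurable
  show "integrable M (arrival_sum (\<lambda>m \<omega>. c * g m \<omega>))"
    using integrable_cong_AE[OF meas eq] int by simp
  show "expectation (arrival_sum (\<lambda>m \<omega>. c * g m \<omega>)) = c * expectation (arrival_sum g)"
    using integral_cong_AE[OF meas eq] by simp
qed

lemma arrival_sum_series:
  assumes int: "\<And>m. integrable M (\<lambda>\<omega>. arr m \<omega> * g m \<omega>)"
    and sum: "summable (\<lambda>m. expectation (\<lambda>\<omega>. \<bar>arr m \<omega> * g m \<omega>\<bar>))"
  shows "integrable M (arrival_sum g)"
    and "expectation (arrival_sum g) = (\<Sum>m. expectation (\<lambda>\<omega>. arr m \<omega> * g m \<omega>))"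
proof -
  have "AE \<omega> in M. summable (\<lambda>m. norm (arr m \<omega> * g m \<omega>))"
    using finite_arrivals by eventually_elim (auto intro!: summable_finite simp: arr_def)
  note * = this
  show "integrable M (arrival_sum g)"
    unfolding arrival_sum_eq[abs_def] using integrable_suminf[OF int *] sum by simp
  show "expectation (arrival_sum g) = (\<Sum>m. expectation (\<lambda>\<omega>. arr m \<omega> * g m \<omega>))"
    unfolding arrival_sum_eq[abs_def] using integral_suminf[OF int *] sum by simp
qed

text \<open>
  Campbell's formula with independent marks: whether arrival \<open>m\<close> occurs before time 1 and what it finds are
  independent of its marks, so each summand factorizes.
\<close>

lemma campbell_product:
  fixes a :: "real \<Rightarrow> real" and b :: "real \<times> real \<Rightarrow> real"
  assumes a[measurable]: "a \<in> borel_measurable borel" and b[measurable]: "b \<in> borel_measurable borel"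
    and pa: "palm_integrable a" and ib: "integrable M (\<lambda>\<omega>. b (U 0 \<omega>, S 0 \<omega>))"
  shows "integrable M (arrival_sum (\<lambda>m \<omega>. a (before m \<omega>) * b (U m \<omega>, S m \<omega>)))"
    and "expectation (arrival_sum (\<lambda>m \<omega>. a (before m \<omega>) * b (U m \<omega>, S m \<omega>)))
      = palm_mean a * expectation (\<lambda>\<omega>. b (U 0 \<omega>, S 0 \<omega>))"
proof -
  let ?g = "\<lambda>m \<omega>. a (before m \<omega>) * b (U m \<omega>, S m \<omega>)"
  have ia: "integrable M (\<lambda>\<omega>. arr m \<omega> * a (before m \<omega>))" for m
    using pa by (simp add: palm_integrable_def)
  have ia': "integrable M (\<lambda>\<omega>. arr m \<omega> * \<bar>a (before m \<omega>)\<bar>)" for m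
    using integrable_abs[OF ia[of m]] by (simp add: abs_mult arr_range)
  have sa': "summable (\<lambda>m. expectation (\<lambda>\<omega>. arr m \<omega> * \<bar>a (before m \<omega>)\<bar>))"
    using pa by (simp add: palm_integrable_def)
  have sa: "summable (\<lambda>m. expectation (\<lambda>\<omega>. arr m \<omega> * a (before m \<omega>)))"
  proof (rule summable_comparison_test'[OF sa'])
    show "norm (expectation (\<lambda>\<omega>. arr m \<omega> * a (before m \<omega>))) \<le> expectation (\<lambda>\<omega>. arr m \<omega> * \<bar>a (before m \<omega>)\<bar>)" for m
      using integral_abs_bound[of M "\<lambda>\<omega>. arr m \<omega> * a (before m \<omega>)"] by (simp add: abs_mult arr_range)
  qed
  have "expectation (\<lambda>\<omega>. \<bar>arr m \<omega> * ?g m \<omega>\<bar>)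
      = expectation (\<lambda>\<omega>. arr m \<omega> * \<bar>a (before m \<omega>)\<bar>) * expectation (\<lambda>\<omega>. \<bar>b (U 0 \<omega>, S 0 \<omega>)\<bar>)" for m
    using arr_product(2)[of "\<lambda>x. \<bar>a x\<bar>" "\<lambda>x. \<bar>b x\<bar>" m] ia' ib by (simp add: abs_mult arr_range)
  then have "summable (\<lambda>m. expectation (\<lambda>\<omega>. \<bar>arr m \<omega> * ?g m \<omega>\<bar>))"
    using sa' by (simp add: summable_mult2)
  note ser = arrival_sum_series[OF arr_product(1)[OF a b ia ib] this]
  show "integrable M (arrival_sum ?g)" by (rule ser)
  show "expectation (arrival_sum ?g) = palm_mean a * expectation (\<lambda>\<omega>. b (U 0 \<omega>, S 0 \<omega>))"
    unfolding ser(2) arr_product(2)[OF a b ia ib] palm_mean_def using sa by (simp add: suminf_mult2)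
qed

lemma palm_integrable_bound:
  assumes [measurable]: "a \<in> borel_measurable borel" and pc: "palm_integrable c"
    and le: "\<And>w. 0 \<le> w \<Longrightarrow> \<bar>a w\<bar> \<le> c w"
  shows "palm_integrable a"
proof -
  have ic: "integrable M (\<lambda>\<omega>. arr m \<omega> * c (before m \<omega>))" for m
    using pc by (simp add: palm_integrable_def)
  have c_abs: "\<bar>c (before m \<omega>)\<bar> = c (before m \<omega>)" for m \<omega>
    using le[OF before_nonneg, of m \<omega>] by linarith
  have ia: "integrable M (\<lambda>\<omega>. arr m \<omega> * a (before m \<omega>))" for m
    by (rule Bochner_Integration.integrable_bound[OF ic[of m]])
      (auto simp: abs_mult arr_range c_abs intro!: mult_left_mono le before_nonneg)
  have "summable (\<lambda>m. expectation (\<lambda>\<omega>. arr m \<omega> * \<bar>a (before m \<omega>)\<bar>))"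
  proof (rule summable_comparison_test')
    show "summable (\<lambda>m. expectation (\<lambda>\<omega>. arr m \<omega> * c (before m \<omega>)))"
      using pc by (simp add: palm_integrable_def c_abs)
    show "norm (expectation (\<lambda>\<omega>. arr m \<omega> * \<bar>a (before m \<omega>)\<bar>)) \<le> expectation (\<lambda>\<omega>. arr m \<omega> * c (before m \<omega>))" for m
    proof -
      have "expectation (\<lambda>\<omega>. arr m \<omega> * \<bar>a (before m \<omega>)\<bar>) \<le> expectation (\<lambda>\<omega>. arr m \<omega> * c (before m \<omega>))"
        using integrable_abs[OF ia[of m]]
        by (intro integral_mono ic) (auto simp: abs_mult arr_range intro!: mult_left_mono le before_nonneg)
      moreover have "0 \<le> expectation (\<lambda>\<omega>. arr m \<omega> * \<bar>a (before m \<omega>)\<bar>)"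
        by (auto intro!: integral_nonneg_AE simp: arr_range)
      ultimately show ?thesis by simp
    qed
  qed
  then show ?thesis using ia by (simp add: palm_integrable_def)
qed

lemma palm_integrable_const: "palm_integrable (\<lambda>_. c)"
  using arr_integrable arrivals_summable by (auto simp: palm_integrable_def intro!: summable_mult2)

end

lemma mark_proj_meas[measurable]:
  "(\<lambda>p. fst p :: real) \<in> borel_measurable (borel :: (real \<times> real) measure)"
  "(\<lambda>p. snd p :: real) \<in> borel_measurable (borel :: (real \<times> real) measure)"
  by (auto simp flip: borel_prod)

context stationary_queue
begin

text \<open>
  The expected number of arrivals in \<open>[0,1]\<close>, shown below to be \<open>1 / E U\<close>.
\<close>

definition \<Lambda> :: real where "\<Lambda> = palm_mean (\<lambda>_. 1)"

lemma arrival_sum_marks: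
  fixes b :: "real \<times> real \<Rightarrow> real"
  assumes "b \<in> borel_measurable borel" "integrable M (\<lambda>\<omega>. b (U 0 \<omega>, S 0 \<omega>))"
  shows "integrable M (arrival_sum (\<lambda>m \<omega>. b (U m \<omega>, S m \<omega>)))"
    "expectation (arrival_sum (\<lambda>m \<omega>. b (U m \<omega>, S m \<omega>))) = \<Lambda> * expectation (\<lambda>\<omega>. b (U 0 \<omega>, S 0 \<omega>))"
  using campbell_product[of "\<lambda>_. 1" b] assms palm_integrable_const by (simp_all add: \<Lambda>_def)

lemma arrival_sum_dominated:
  fixes b :: "real \<times> real \<Rightarrow> real"
  assumes g[measurable]: "\<And>m. g m \<in> borel_measurable M"
    and b: "b \<in> borel_measurable borel" "integrable M (\<lambda>\<omega>. b (U 0 \<omega>, S 0 \<omega>))"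
    and le: "\<And>m \<omega>. \<omega> \<in> space M \<Longrightarrow> \<bar>g m \<omega>\<bar> \<le> b (U m \<omega>, S m \<omega>)"
  shows "integrable M (arrival_sum g)"
    "\<bar>expectation (arrival_sum g)\<bar> \<le> \<Lambda> * expectation (\<lambda>\<omega>. b (U 0 \<omega>, S 0 \<omega>))"
proof -
  note B = arrival_sum_marks[OF b]
  have AE_le: "AE \<omega> in M. \<bar>arrival_sum g \<omega>\<bar> \<le> arrival_sum (\<lambda>m \<omega>. b (U m \<omega>, S m \<omega>)) \<omega>"
    using finite_arrivals AE_space
  proof eventually_elim
    case (elim \<omega>)
    then show ?case
      by (auto simp: arrival_sum_def arrival_integral_finite intro!: order_trans[OF sum_abs] sum_mono le)
  qed
  show int: "integrable M (arrival_sum g)"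
    by (rule Bochner_Integration.integrable_bound[OF B(1)]) (use AE_le in auto)
  have "\<bar>expectation (arrival_sum g)\<bar> \<le> expectation (\<lambda>\<omega>. \<bar>arrival_sum g \<omega>\<bar>)"
    by (rule integral_abs_bound)
  also have "\<dots> \<le> expectation (arrival_sum (\<lambda>m \<omega>. b (U m \<omega>, S m \<omega>)))"
    using AE_le int B(1) by (intro integral_mono_AE) auto
  finally show "\<bar>expectation (arrival_sum g)\<bar> \<le> \<Lambda> * expectation (\<lambda>\<omega>. b (U 0 \<omega>, S 0 \<omega>))"
    by (simp add: B(2))
qed

section \<open>Rate conservation in expectation\<close>

text \<open>
  The expectation of the pathwise identity. The left-hand side \<open>F(Z(1)) - F(Z(0))\<close> is integrable because the
  right-hand side is, and then has mean zero as a difference of two variables with the same law.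
\<close>

theorem rate_conservation:
  fixes F D :: "real \<times> real \<Rightarrow> real"
  assumes FD: "flow_antiderivative F D"
    and F[measurable]: "F \<in> borel_measurable borel" and D[measurable]: "D \<in> borel_measurable borel"
    and iD: "integrable M (\<lambda>\<omega>. D (V0 \<omega>, R0 \<omega>))"
    and iJ: "integrable M (arrival_sum (\<lambda>m \<omega>. F (before m \<omega> + S m \<omega>, U m \<omega>) - F (before m \<omega>, 0)))"
      (is "integrable M ?J")
  shows "expectation (\<lambda>\<omega>. D (V0 \<omega>, R0 \<omega>))
    + expectation (arrival_sum (\<lambda>m \<omega>. F (before m \<omega> + S m \<omega>, U m \<omega>) - F (before m \<omega>, 0))) = 0"
proof -
  have pairs[measurable]: "(\<lambda>\<omega>. (W 1 \<omega>, R 1 \<omega>)) \<in> measurable M borel" "(\<lambda>\<omega>. (V0 \<omega>, R0 \<omega>)) \<in> measurable M borel"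
    by (auto simp flip: borel_prod)
  note time = expectation_of_time_integral[OF D iD]
  let ?I = "\<lambda>\<omega>. LINT t:{0..1}|lborel. D (W t \<omega>, R t \<omega>)"
  have eq: "AE \<omega> in M. F (W 1 \<omega>, R 1 \<omega>) - F (V0 \<omega>, R0 \<omega>) = ?I \<omega> + ?J \<omega>"
    using finite_arrivals time(1) AE_space
  proof eventually_elim
    case (elim \<omega>)
    have "((\<lambda>t. D (W t \<omega>, R t \<omega>)) has_integral F (W 1 \<omega>, R 1 \<omega>) - F (V0 \<omega>, R0 \<omega>) - ?J \<omega>) {0..1}"
      using queue_path.rate_conservation_path[OF path FD] elim
      unfolding W_def R_def arrival_sum_def before_def[symmetric] \<tau>_def[symmetric] after_eq
      by (simp add: W_def R_def)
    then have "?I \<omega> = F (W 1 \<omega>, R 1 \<omega>) - F (V0 \<omega>, R0 \<omega>) - ?J \<omega>"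
      using set_borel_integral_eq_integral(2)[OF elim(2)] by (simp add: integral_unique)
    then show ?case by simp
  qed
  have meas: "(\<lambda>\<omega>. F (W 1 \<omega>, R 1 \<omega>) - F (V0 \<omega>, R0 \<omega>)) \<in> borel_measurable M"
    "(\<lambda>\<omega>. ?I \<omega> + ?J \<omega>) \<in> borel_measurable M"
    using time(2) iJ by (auto intro!: borel_measurable_diff borel_measurable_add)
  have int: "integrable M (\<lambda>\<omega>. F (W 1 \<omega>, R 1 \<omega>) - F (V0 \<omega>, R0 \<omega>))"
    using integrable_cong_AE[OF meas eq] time(2) iJ by simp
  have "0 = expectation (\<lambda>\<omega>. F (W 1 \<omega>, R 1 \<omega>) - F (V0 \<omega>, R0 \<omega>))"
    by (rule same_law_integrable_difference[symmetric]) (use int state_law[of 1 F] in auto)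
  also have "\<dots> = expectation (\<lambda>\<omega>. ?I \<omega> + ?J \<omega>)"
    by (rule integral_cong_AE[OF meas eq])
  also have "\<dots> = expectation (\<lambda>\<omega>. D (V0 \<omega>, R0 \<omega>)) + expectation ?J"
    using time(2,3) iJ by simp
  finally show ?thesis by simp
qed

lemma moments:
  "integrable M (\<lambda>\<omega>. U 0 \<omega>)" "integrable M (\<lambda>\<omega>. S 0 \<omega>)"
  "integrable M (\<lambda>\<omega>. (U 0 \<omega>)\<^sup>2)" "integrable M (\<lambda>\<omega>. (S 0 \<omega>)\<^sup>2)"
  using lower_moments[OF U_meas less_imp_le[OF U_pos] U_third_moment]
    lower_moments[OF S_meas S_nonneg S_third_moment] by auto

lemma EU_pos: "0 < expectation (U 0)"
  by (intro expectation_positive moments U_pos)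

text \<open>
  Rate conservation for the residual interarrival time itself: it decreases at rate 1 and jumps by the new interarrival time.
\<close>

lemma Lambda_EU: "\<Lambda> * expectation (U 0) = 1"
proof -
  have FD: "flow_antiderivative (\<lambda>p. snd p) (\<lambda>p. - 1)"
    using flow_antiderivative_linear_argument[of "\<lambda>x. x" "\<lambda>_. 1" 0 1] by (simp add: case_prod_beta')
  have J: "integrable M (arrival_sum (\<lambda>m \<omega>. U m \<omega>))"
    "expectation (arrival_sum (\<lambda>m \<omega>. U m \<omega>)) = \<Lambda> * expectation (U 0)"
    using arrival_sum_marks[of fst] moments(1) by simp_all
  have "expectation (\<lambda>\<omega>. - 1 :: real) + expectation (arrival_sum (\<lambda>m \<omega>. U m \<omega>)) = 0"
    using rate_conservation[OF FD] J(1) by simp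
  then show ?thesis using J(2) by (simp add: prob_space)
qed

lemma Lambda_pos: "0 < \<Lambda>"
  using Lambda_EU EU_pos zero_less_mult_pos2[of \<Lambda> "expectation (U 0)"] by simp

text \<open>
  Rate conservation for (truncated) \<open>r\<^sup>2/2\<close>, which decreases at rate \<open>r\<close> and jumps by \<open>u\<^sup>2/2\<close>.
\<close>

lemma residual_mean:
  "integrable M R0" "expectation R0 \<le> \<Lambda> * expectation (\<lambda>\<omega>. (U 0 \<omega>)\<^sup>2) / 2"
proof -
  have "expectation (\<lambda>\<omega>. min (R0 \<omega>) (real n)) \<le> \<Lambda> * expectation (\<lambda>\<omega>. (U 0 \<omega>)\<^sup>2) / 2" for n
  proof -
    obtain \<phi> where \<phi>: "\<And>y. (\<phi> has_real_derivative min (max y 0) (real n)) (at y)" "\<phi> 0 = 0"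
      using truncated_square[of n] by blast
    note [measurable] = DERIV_borel_measurable[OF \<phi>(1)]
    have FD: "flow_antiderivative (\<lambda>p. \<phi> (snd p)) (\<lambda>p. - min (max (snd p) 0) (real n))"
      using flow_antiderivative_linear_argument[OF \<phi>(1), of 0 1] by (simp add: case_prod_beta')
    have bound: "\<bar>\<phi> u\<bar> \<le> u\<^sup>2 / 2" for u
      using taylor2_bound[OF \<phi>(1) truncation_Lipschitz, of 0 u] \<phi>(2) by simp
    have dom: "integrable M (arrival_sum (\<lambda>m \<omega>. \<phi> (U m \<omega>)))"
      "\<bar>expectation (arrival_sum (\<lambda>m \<omega>. \<phi> (U m \<omega>)))\<bar> \<le> \<Lambda> * expectation (\<lambda>\<omega>. (U 0 \<omega>)\<^sup>2 / 2)"
      using arrival_sum_dominated[of "\<lambda>m \<omega>. \<phi> (U m \<omega>)" "\<lambda>p. (fst p)\<^sup>2 / 2"] bound moments(3) by simp_all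
    have iD: "integrable M (\<lambda>\<omega>. - min (max (R0 \<omega>) 0) (real n))"
      by (rule integrable_const_bound[where B = "real n"]) auto
    have "expectation (\<lambda>\<omega>. - min (max (R0 \<omega>) 0) (real n)) + expectation (arrival_sum (\<lambda>m \<omega>. \<phi> (U m \<omega>))) = 0"
      using rate_conservation[OF FD] iD dom(1) \<phi>(2) by simp
    moreover have "expectation (\<lambda>\<omega>. - min (max (R0 \<omega>) 0) (real n)) = - expectation (\<lambda>\<omega>. min (R0 \<omega>) (real n))"
    proof -
      have "min (max (R0 \<omega>) 0) (real n) = min (R0 \<omega>) (real n)" if "\<omega> \<in> space M" for \<omega>
        using R0_pos[OF that] by simp
      then have "expectation (\<lambda>\<omega>. min (max (R0 \<omega>) 0) (real n)) = expectation (\<lambda>\<omega>. min (R0 \<omega>) (real n))"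
        by (rule Bochner_Integration.integral_cong[OF refl])
      then show ?thesis by simp
    qed
    ultimately show ?thesis using dom(2) by simp
  qed
  note bound = this
  have nn: "0 \<le> R0 \<omega>" if "\<omega> \<in> space M" for \<omega>
    using R0_pos[OF that] by simp
  show "integrable M R0"
    by (rule integrable_of_truncations(1)[OF R0_meas nn bound])
  show "expectation R0 \<le> \<Lambda> * expectation (\<lambda>\<omega>. (U 0 \<omega>)\<^sup>2) / 2"
    by (rule integrable_of_truncations(2)[OF R0_meas nn bound])
qed

subsection \<open>The drift-compensated workload\<close>

definition \<rho> :: real where "\<rho> = expectation (S 0) / expectation (U 0)"

definition \<delta> :: real where "\<delta> = 1 - \<rho>"

text \<open>
  The net input at an arrival: the jump of \<open>v - \<rho> r\<close>. The factor \<open>\<rho>\<close> is chosen to give it mean zero.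
\<close>

definition net :: "nat \<Rightarrow> 'a \<Rightarrow> real" where "net m \<omega> = S m \<omega> - \<rho> * U m \<omega>"

lemma rho_nonneg: "0 \<le> \<rho>" and delta_pos: "0 < \<delta>"
proof -
  have "0 \<le> expectation (S 0)" by (auto intro!: integral_nonneg_AE simp: S_nonneg)
  then show "0 \<le> \<rho>" using EU_pos by (simp add: \<rho>_def)
  show "0 < \<delta>" using stable EU_pos by (simp add: \<delta>_def \<rho>_def)
qed

lemma net_meas[measurable]: "net m \<in> borel_measurable M"
  unfolding net_def by measurable

lemma net_mean: "integrable M (net 0)" "expectation (net 0) = 0"
proof -
  show "integrable M (net 0)" unfolding net_def using moments by auto
  have "expectation (net 0) = expectation (S 0) - \<rho> * expectation (U 0)"
    unfolding net_def using moments by simp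
  then show "expectation (net 0) = 0" using EU_pos by (simp add: \<rho>_def)
qed

lemma net_moments: "integrable M (\<lambda>\<omega>. (net 0 \<omega>)\<^sup>2)" "integrable M (\<lambda>\<omega>. \<bar>net 0 \<omega>\<bar> ^ 3)"
proof -
  have *: "\<bar>net 0 \<omega>\<bar> ^ k \<le> S 0 \<omega> ^ k + \<rho> ^ k * U 0 \<omega> ^ k" if "\<omega> \<in> space M" for \<omega> k
  proof -
    have nn: "0 \<le> S 0 \<omega>" "0 \<le> \<rho> * U 0 \<omega>"
      using that S_nonneg U_pos rho_nonneg by (auto simp: less_imp_le)
    then have "\<bar>net 0 \<omega>\<bar> \<le> max (S 0 \<omega>) (\<rho> * U 0 \<omega>)" by (auto simp: net_def)
    then have "\<bar>net 0 \<omega>\<bar> ^ k \<le> max (S 0 \<omega>) (\<rho> * U 0 \<omega>) ^ k" by (intro power_mono) auto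
    also have "\<dots> \<le> S 0 \<omega> ^ k + (\<rho> * U 0 \<omega>) ^ k" using nn by (auto simp: max_def)
    finally show ?thesis by (simp add: power_mult_distrib)
  qed
  have "integrable M (\<lambda>\<omega>. \<bar>net 0 \<omega>\<bar> ^ 2)"
    by (rule Bochner_Integration.integrable_bound[of M "\<lambda>\<omega>. S 0 \<omega> ^ 2 + \<rho> ^ 2 * U 0 \<omega> ^ 2"])
      (use moments in \<open>auto intro!: AE_I2 dest: *[of _ 2]\<close>)
  then show "integrable M (\<lambda>\<omega>. (net 0 \<omega>)\<^sup>2)" by simp
  show "integrable M (\<lambda>\<omega>. \<bar>net 0 \<omega>\<bar> ^ 3)"
    by (rule Bochner_Integration.integrable_bound[of M "\<lambda>\<omega>. S 0 \<omega> ^ 3 + \<rho> ^ 3 * U 0 \<omega> ^ 3"])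
      (use U_third_moment S_third_moment in \<open>auto intro!: AE_I2 dest: *[of _ 3]\<close>)
qed

lemma net_variance:
  "expectation (\<lambda>\<omega>. (net 0 \<omega>)\<^sup>2) = variance (S 0) + \<rho>\<^sup>2 * variance (U 0)"
proof -
  have i: "integrable M (\<lambda>\<omega>. U 0 \<omega> * S 0 \<omega>)"
    and e: "expectation (\<lambda>\<omega>. U 0 \<omega> * S 0 \<omega>) = expectation (U 0) * expectation (S 0)"
    using indep_var_integrable[OF indep_US moments(1,2)] indep_var_lebesgue_integral[OF indep_US moments(1,2)]
    by simp_all
  have "(\<lambda>\<omega>. (net 0 \<omega>)\<^sup>2) = (\<lambda>\<omega>. (S 0 \<omega>)\<^sup>2 - 2 * \<rho> * (U 0 \<omega> * S 0 \<omega>) + \<rho>\<^sup>2 * (U 0 \<omega>)\<^sup>2)"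
    by (simp add: net_def fun_eq_iff power2_eq_square algebra_simps)
  then have "expectation (\<lambda>\<omega>. (net 0 \<omega>)\<^sup>2) = expectation (\<lambda>\<omega>. (S 0 \<omega>)\<^sup>2)
      - 2 * \<rho> * (expectation (U 0) * expectation (S 0)) + \<rho>\<^sup>2 * expectation (\<lambda>\<omega>. (U 0 \<omega>)\<^sup>2)"
    using i moments by (simp add: e)
  moreover have "\<rho> * expectation (U 0) = expectation (S 0)"
    using EU_pos by (simp add: \<rho>_def)
  ultimately show ?thesis
    unfolding variance_eq[OF moments(1,3)] variance_eq[OF moments(2,4)]
    by (simp add: right_diff_distrib power_mult_distrib[symmetric] power2_eq_square mult_ac)
qed

text \<open>
  Rate conservation for \<open>\<phi>(\<delta>(v - \<rho> r))\<close>. While the server is busy the argument moves at rate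
  \<open>-\<delta>(1 - \<rho>) = -\<delta>\<^sup>2\<close>; while it is idle (\<open>v = 0\<close>) only the part \<open>\<delta>\<rho>\<close> remains, which accounts for the correction
  on \<open>{V0 = 0}\<close>. The part of a jump that is linear in the net input has mean zero by Campbell's formula.
\<close>

lemma smooth_balance:
  fixes \<phi> \<phi>' :: "real \<Rightarrow> real"
  assumes \<phi>: "\<And>x. (\<phi> has_real_derivative \<phi>' x) (at x)"
    and L: "\<And>x y. \<bar>\<phi>' x - \<phi>' y\<bar> \<le> L * \<bar>x - y\<bar>"
    and pi: "palm_integrable (\<lambda>w. \<phi>' (\<delta> * w))"
    and iD: "integrable M (\<lambda>\<omega>. \<phi>' (\<delta> * V0 \<omega> - \<delta> * \<rho> * R0 \<omega>))"
  defines "rem \<equiv> \<lambda>m \<omega>. \<phi> (\<delta> * before m \<omega> + \<delta> * net m \<omega>) - \<phi> (\<delta> * before m \<omega>)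
      - \<delta> * net m \<omega> * \<phi>' (\<delta> * before m \<omega>)"
  shows "integrable M (arrival_sum rem)"
    and "\<bar>expectation (arrival_sum rem)\<bar> \<le> \<Lambda> * (L / 2 * \<delta>\<^sup>2 * expectation (\<lambda>\<omega>. (net 0 \<omega>)\<^sup>2))"
    and "integrable M (\<lambda>\<omega>. of_bool (V0 \<omega> = 0) * \<phi>' (- (\<delta> * \<rho> * R0 \<omega>)))"
    and "\<delta>\<^sup>2 * expectation (\<lambda>\<omega>. \<phi>' (\<delta> * V0 \<omega> - \<delta> * \<rho> * R0 \<omega>))
      = \<delta> * expectation (\<lambda>\<omega>. of_bool (V0 \<omega> = 0) * \<phi>' (- (\<delta> * \<rho> * R0 \<omega>))) + expectation (arrival_sum rem)"
proof -
  note [measurable] = DERIV_borel_measurable[OF \<phi>] borel_measurable_continuous_onI[OF Lipschitz_continuous[OF L]]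
  have rem_meas: "rem m \<in> borel_measurable M" for m
    unfolding rem_def by measurable
  have *: "\<bar>rem m \<omega>\<bar> \<le> L / 2 * \<delta>\<^sup>2 * (net m \<omega>)\<^sup>2" for m \<omega>
    using taylor2_bound[OF \<phi> L, of "\<delta> * before m \<omega>" "\<delta> * net m \<omega>"]
    by (simp add: rem_def power_mult_distrib mult_ac)
  have dom': "integrable M (arrival_sum rem)"
    "\<bar>expectation (arrival_sum rem)\<bar> \<le> \<Lambda> * expectation (\<lambda>\<omega>. L / 2 * \<delta>\<^sup>2 * (net 0 \<omega>)\<^sup>2)"
    using arrival_sum_dominated[of rem "\<lambda>p. L / 2 * \<delta>\<^sup>2 * (snd p - \<rho> * fst p)\<^sup>2", OF rem_meas]
      * net_moments(1) by (simp_all add: net_def)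
  show rem_int: "integrable M (arrival_sum rem)" by (rule dom')
  show "\<bar>expectation (arrival_sum rem)\<bar> \<le> \<Lambda> * (L / 2 * \<delta>\<^sup>2 * expectation (\<lambda>\<omega>. (net 0 \<omega>)\<^sup>2))"
    using dom'(2) by simp
  have lin: "integrable M (arrival_sum (\<lambda>m \<omega>. \<phi>' (\<delta> * before m \<omega>) * (\<delta> * net m \<omega>)))"
    "expectation (arrival_sum (\<lambda>m \<omega>. \<phi>' (\<delta> * before m \<omega>) * (\<delta> * net m \<omega>))) = 0"
    using campbell_product[of "\<lambda>w. \<phi>' (\<delta> * w)" "\<lambda>p. \<delta> * (snd p - \<rho> * fst p)"] pi net_mean
    by (simp_all add: net_def[abs_def])
  show idle_int: "integrable M (\<lambda>\<omega>. of_bool (V0 \<omega> = 0) * \<phi>' (- (\<delta> * \<rho> * R0 \<omega>)))"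
    by (rule Bochner_Integration.integrable_bound[OF iD]) (auto intro!: AE_I2)
  let ?F = "\<lambda>p. \<phi> (\<delta> * fst p - \<delta> * \<rho> * snd p)"
  let ?D = "\<lambda>p. - (\<delta> * of_bool (0 < fst p) - \<delta> * \<rho>) * \<phi>' (\<delta> * fst p - \<delta> * \<rho> * snd p)"
  have FD: "flow_antiderivative ?F ?D"
    using flow_antiderivative_linear_argument[OF \<phi>, of \<delta> "- (\<delta> * \<rho>)"] by (simp add: case_prod_beta')
  have \<delta>2: "\<delta> - \<delta> * \<rho> = \<delta>\<^sup>2"
    by (simp add: \<delta>_def power2_eq_square algebra_simps)
  \<comment> \<open>On \<open>{V0 = 0}\<close> the missing drift \<open>\<delta>\<close> is added back, so that the busy rate \<open>\<delta>\<^sup>2\<close> appears everywhere.\<close>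
  have D_eq: "?D (V0 \<omega>, R0 \<omega>) = \<delta> * (of_bool (V0 \<omega> = 0) * \<phi>' (- (\<delta> * \<rho> * R0 \<omega>)))
      - \<delta>\<^sup>2 * \<phi>' (\<delta> * V0 \<omega> - \<delta> * \<rho> * R0 \<omega>)" if "\<omega> \<in> space M" for \<omega>
    using V0_nonneg[OF that] unfolding \<delta>2[symmetric] by (auto simp: algebra_simps)
  have D_int: "integrable M (\<lambda>\<omega>. ?D (V0 \<omega>, R0 \<omega>))"
    using idle_int iD by (subst Bochner_Integration.integrable_cong[OF refl D_eq]) auto
  have J_eq: "?F (before m \<omega> + S m \<omega>, U m \<omega>) - ?F (before m \<omega>, 0)
      = rem m \<omega> + \<phi>' (\<delta> * before m \<omega>) * (\<delta> * net m \<omega>)" for m \<omega>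
    by (simp add: rem_def net_def algebra_simps)
  have J: "integrable M (arrival_sum (\<lambda>m \<omega>. ?F (before m \<omega> + S m \<omega>, U m \<omega>) - ?F (before m \<omega>, 0)))"
    "expectation (arrival_sum (\<lambda>m \<omega>. ?F (before m \<omega> + S m \<omega>, U m \<omega>) - ?F (before m \<omega>, 0)))
      = expectation (arrival_sum rem)"
    unfolding J_eq using arrival_sum_add[OF rem_meas _ rem_int lin(1)] lin(2) by simp_all
  have "expectation (\<lambda>\<omega>. ?D (V0 \<omega>, R0 \<omega>)) + expectation (arrival_sum rem) = 0"
    using rate_conservation[OF FD _ _ D_int J(1)] J(2) by simp
  moreover have "expectation (\<lambda>\<omega>. ?D (V0 \<omega>, R0 \<omega>))
    = \<delta> * expectation (\<lambda>\<omega>. of_bool (V0 \<omega> = 0) * \<phi>' (- (\<delta> * \<rho> * R0 \<omega>)))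
      - \<delta>\<^sup>2 * expectation (\<lambda>\<omega>. \<phi>' (\<delta> * V0 \<omega> - \<delta> * \<rho> * R0 \<omega>))"
    using idle_int iD by (subst Bochner_Integration.integral_cong[OF refl D_eq]) simp_all
  ultimately show "\<delta>\<^sup>2 * expectation (\<lambda>\<omega>. \<phi>' (\<delta> * V0 \<omega> - \<delta> * \<rho> * R0 \<omega>))
      = \<delta> * expectation (\<lambda>\<omega>. of_bool (V0 \<omega> = 0) * \<phi>' (- (\<delta> * \<rho> * R0 \<omega>))) + expectation (arrival_sum rem)"
    by simp
qed

text \<open>
  For a truncated square the idle correction vanishes, since its derivative is zero on the negative half-line. The truncated means
  of the positive part of \<open>\<delta>(V0 - \<rho> R0)\<close> are then bounded by the second-order jump term, uniformly in \<open>n\<close>.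
\<close>

lemma workload_integrable: "integrable M V0"
proof -
  define C where "C = \<Lambda> * (1 / 2 * \<delta>\<^sup>2 * expectation (\<lambda>\<omega>. (net 0 \<omega>)\<^sup>2)) / \<delta>\<^sup>2"
  let ?Q = "\<lambda>\<omega>. max (\<delta> * V0 \<omega> - \<delta> * \<rho> * R0 \<omega>) 0"
  have "expectation (\<lambda>\<omega>. min (?Q \<omega>) (real n)) \<le> C" for n
  proof -
    obtain \<phi> where \<phi>: "\<And>y. (\<phi> has_real_derivative min (max y 0) (real n)) (at y)"
      using truncated_square[of n] by blast
    have pi: "palm_integrable (\<lambda>w. min (max (\<delta> * w) 0) (real n))"
      by (rule palm_integrable_bound[OF _ palm_integrable_const[of "real n"]]) auto
    have iD: "integrable M (\<lambda>\<omega>. min (?Q \<omega>) (real n))"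
      by (rule integrable_const_bound[where B = "real n"]) auto
    note bal = smooth_balance[OF \<phi> truncation_Lipschitz pi iD]
    have "of_bool (V0 \<omega> = 0) * min (max (- (\<delta> * \<rho> * R0 \<omega>)) 0) (real n) = 0" if "\<omega> \<in> space M" for \<omega>
      using R0_pos[OF that] rho_nonneg delta_pos by (simp add: max_def)
    then have idle: "expectation (\<lambda>\<omega>. of_bool (V0 \<omega> = 0) * min (max (- (\<delta> * \<rho> * R0 \<omega>)) 0) (real n)) = 0"
      by (intro integral_eq_zero_AE AE_I2) auto
    have "\<delta>\<^sup>2 * expectation (\<lambda>\<omega>. min (?Q \<omega>) (real n))
        \<le> \<Lambda> * (1 / 2 * \<delta>\<^sup>2 * expectation (\<lambda>\<omega>. (net 0 \<omega>)\<^sup>2))"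
      using bal(2) bal(4)[unfolded idle] by simp
    then show ?thesis using delta_pos by (simp add: C_def pos_le_divide_eq mult.commute)
  qed
  then have Q: "integrable M ?Q"
    by (intro integrable_of_truncations(1)) auto
  show ?thesis
  proof (rule Bochner_Integration.integrable_bound)
    show "integrable M (\<lambda>\<omega>. ?Q \<omega> / \<delta> + \<rho> * R0 \<omega>)" using Q residual_mean(1) by auto
    show "AE \<omega> in M. norm (V0 \<omega>) \<le> norm (?Q \<omega> / \<delta> + \<rho> * R0 \<omega>)"
    proof (rule AE_I2)
      fix \<omega> assume \<omega>: "\<omega> \<in> space M"
      have "\<delta> * V0 \<omega> \<le> ?Q \<omega> + \<delta> * \<rho> * R0 \<omega>" by simp
      then have "V0 \<omega> \<le> ?Q \<omega> / \<delta> + \<rho> * R0 \<omega>"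
        using delta_pos by (simp add: field_simps)
      then show "norm (V0 \<omega>) \<le> norm (?Q \<omega> / \<delta> + \<rho> * R0 \<omega>)"
        using V0_nonneg[OF \<omega>] by simp
    qed
  qed simp
qed

subsection \<open>Time averages and arrival averages\<close>

definition cycle :: "(real \<Rightarrow> real) \<Rightarrow> nat \<Rightarrow> 'a \<Rightarrow> real" where
  "cycle k m \<omega> = integral {0..U m \<omega>} (\<lambda>t. k (max 0 (before m \<omega> + S m \<omega> - t)))"

lemma cycle_meas:
  assumes "continuous_on UNIV k"
  shows "cycle k m \<in> borel_measurable M"
proof -
  have "(\<lambda>\<omega>. (before m \<omega> + S m \<omega>, U m \<omega>)) \<in> measurable M borel"
    by (subst borel_prod[symmetric]) measurable
  from measurable_compose[OF this running_integral_meas[OF assms]] show ?thesis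
    by (simp add: cycle_def[abs_def])
qed

text \<open>
  Palm inversion: a stationary time average equals the expected sum over arrivals of cycle integrals. The
  incomplete cycles at both ends of \<open>[0,1]\<close> have equal means by stationarity and cancel.
\<close>

lemma cycle_formula:
  fixes k :: "real \<Rightarrow> real"
  assumes k: "continuous_on UNIV k" and B: "\<And>x. \<bar>k x\<bar> \<le> B"
  shows "integrable M (arrival_sum (cycle k))"
    and "expectation (\<lambda>\<omega>. k (V0 \<omega>)) = expectation (arrival_sum (cycle k))"
proof -
  have [measurable]: "k \<in> borel_measurable borel"
    by (rule borel_measurable_continuous_onI[OF k])
  have "\<bar>cycle k m \<omega>\<bar> \<le> B * U m \<omega>" if "\<omega> \<in> space M" for m \<omega>
  proof -
    have "norm (cycle k m \<omega>) \<le> B * (U m \<omega> - 0)"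
      unfolding cycle_def using U_pos[OF that, of m] B
      by (intro integral_bound continuous_on_compose2[OF k] continuous_intros) auto
    then show ?thesis by simp
  qed
  then show int: "integrable M (arrival_sum (cycle k))"
    using arrival_sum_dominated(1)[of "cycle k" "\<lambda>p. B * fst p"] cycle_meas[OF k] moments(1) by simp
  have FD: "flow_antiderivative (\<lambda>p. integral {0..snd p} (\<lambda>t. k (max 0 (fst p - t)))) (\<lambda>p. - k (fst p))"
    using flow_antiderivative_running_integral[OF k] by (simp add: case_prod_beta')
  have iD: "integrable M (\<lambda>\<omega>. - k (V0 \<omega>))"
    by (rule integrable_const_bound[where B = B]) (auto simp: B)
  have "expectation (\<lambda>\<omega>. - k (V0 \<omega>)) + expectation (arrival_sum (cycle k)) = 0"
    using rate_conservation[OF FD running_integral_meas[OF k]] iD int by (simp add: cycle_def[abs_def])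
  then show "expectation (\<lambda>\<omega>. k (V0 \<omega>)) = expectation (arrival_sum (cycle k))"
    by simp
qed

lemma cycle_near:
  fixes k :: "real \<Rightarrow> real"
  assumes L: "\<And>x y. \<bar>k x - k y\<bar> \<le> L * \<bar>x - y\<bar>" and \<omega>: "\<omega> \<in> space M"
  shows "\<bar>cycle k m \<omega> - U m \<omega> * k (before m \<omega>)\<bar> \<le> L * (S m \<omega> + U m \<omega>) * U m \<omega>"
proof -
  have L0: "0 \<le> L" using L[of 0 1] by simp
  note k = Lipschitz_continuous[OF L]
  note U0 = U_pos[OF \<omega>, of m] and S0 = S_nonneg[OF \<omega>, of m] and b0 = before_nonneg[of m \<omega>]
  let ?g = "\<lambda>t. k (max 0 (before m \<omega> + S m \<omega> - t)) - k (before m \<omega>)"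
  have cont: "continuous_on {0..U m \<omega>} (\<lambda>t. k (max 0 (before m \<omega> + S m \<omega> - t)))"
    by (intro continuous_on_compose2[OF k] continuous_intros) auto
  have "integral {0..U m \<omega>} ?g = cycle k m \<omega> - U m \<omega> * k (before m \<omega>)"
    unfolding cycle_def using U0
    by (subst Henstock_Kurzweil_Integration.integral_diff) (auto intro: integrable_continuous_interval cont)
  moreover have "norm (integral {0..U m \<omega>} ?g) \<le> (L * (S m \<omega> + U m \<omega>)) * (U m \<omega> - 0)"
  proof (rule integral_bound)
    show "continuous_on {0..U m \<omega>} ?g"
      by (intro continuous_on_diff cont continuous_on_const)
    fix t assume t: "t \<in> {0..U m \<omega>}"
    have "\<bar>?g t\<bar> \<le> L * \<bar>max 0 (before m \<omega> + S m \<omega> - t) - before m \<omega>\<bar>"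
      by (rule L)
    also have "\<dots> \<le> L * (S m \<omega> + U m \<omega>)"
      using t S0 b0 U0 L0 by (intro mult_left_mono) auto
    finally show "norm (?g t) \<le> L * (S m \<omega> + U m \<omega>)" by simp
  qed (use U0 in simp)
  ultimately show ?thesis by simp
qed

lemma mean_SU: "integrable M (\<lambda>\<omega>. (S 0 \<omega> + U 0 \<omega>) * U 0 \<omega>)"
  "expectation (\<lambda>\<omega>. (S 0 \<omega> + U 0 \<omega>) * U 0 \<omega>)
     = expectation (S 0) * expectation (U 0) + expectation (\<lambda>\<omega>. (U 0 \<omega>)\<^sup>2)"
proof -
  have i: "integrable M (\<lambda>\<omega>. U 0 \<omega> * S 0 \<omega>)"
    and e: "expectation (\<lambda>\<omega>. U 0 \<omega> * S 0 \<omega>) = expectation (U 0) * expectation (S 0)"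
    using indep_var_integrable[OF indep_US moments(1,2)] indep_var_lebesgue_integral[OF indep_US moments(1,2)]
    by simp_all
  have eq: "(\<lambda>\<omega>. (S 0 \<omega> + U 0 \<omega>) * U 0 \<omega>) = (\<lambda>\<omega>. U 0 \<omega> * S 0 \<omega> + (U 0 \<omega>)\<^sup>2)"
    by (simp add: fun_eq_iff algebra_simps power2_eq_square)
  show "integrable M (\<lambda>\<omega>. (S 0 \<omega> + U 0 \<omega>) * U 0 \<omega>)"
    unfolding eq using i moments(3) by simp
  show "expectation (\<lambda>\<omega>. (S 0 \<omega> + U 0 \<omega>) * U 0 \<omega>)
     = expectation (S 0) * expectation (U 0) + expectation (\<lambda>\<omega>. (U 0 \<omega>)\<^sup>2)"
    unfolding eq using i e moments(3) by simp
qed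

text \<open>
  Within a cycle the workload stays within distance \<open>S + U\<close> of the value found on arrival, so the cycle integral of \<open>k\<close>
  is \<open>U k(x)\<close> up to \<open>L (S + U) U\<close>. As \<open>U\<close> is independent of \<open>x\<close>, the main part has mean \<open>E U\<close> times the Palm mean, and
  \<open>\<Lambda> E U = 1\<close> allows solving for the latter.
\<close>

lemma cycle_expansion:
  fixes k :: "real \<Rightarrow> real"
  assumes L: "\<And>x y. \<bar>k x - k y\<bar> \<le> L * \<bar>x - y\<bar>" and B: "\<And>x. \<bar>k x\<bar> \<le> B"
  defines "cyc \<equiv> \<lambda>m \<omega>. cycle k m \<omega> - U m \<omega> * k (before m \<omega>)"
  shows "integrable M (arrival_sum cyc)"
    and "\<bar>expectation (arrival_sum cyc)\<bar>
      \<le> L * (expectation (S 0) + \<Lambda> * expectation (\<lambda>\<omega>. (U 0 \<omega>)\<^sup>2))"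
    and "palm_mean k = \<Lambda> * (expectation (\<lambda>\<omega>. k (V0 \<omega>)) - expectation (arrival_sum cyc))"
proof -
  note k = Lipschitz_continuous[OF L]
  note [measurable] = borel_measurable_continuous_onI[OF k] cycle_meas[OF k]
  have cyc_meas[measurable]: "cyc m \<in> borel_measurable M" for m
    unfolding cyc_def by measurable
  have dom: "integrable M (arrival_sum cyc)"
    "\<bar>expectation (arrival_sum cyc)\<bar> \<le> \<Lambda> * expectation (\<lambda>\<omega>. L * ((S 0 \<omega> + U 0 \<omega>) * U 0 \<omega>))"
    using arrival_sum_dominated[of cyc "\<lambda>p. L * ((snd p + fst p) * fst p)"] cycle_near[OF L]
      mean_SU(1) by (simp_all add: cyc_def mult.assoc)
  show ci: "integrable M (arrival_sum cyc)" by (rule dom)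
  have "\<Lambda> * expectation (\<lambda>\<omega>. L * ((S 0 \<omega> + U 0 \<omega>) * U 0 \<omega>))
      = L * (expectation (S 0) * (\<Lambda> * expectation (U 0)) + \<Lambda> * expectation (\<lambda>\<omega>. (U 0 \<omega>)\<^sup>2))"
    unfolding integral_mult_right_zero mean_SU(2) by (simp add: algebra_simps)
  from dom(2)[unfolded this Lambda_EU] show "\<bar>expectation (arrival_sum cyc)\<bar>
      \<le> L * (expectation (S 0) + \<Lambda> * expectation (\<lambda>\<omega>. (U 0 \<omega>)\<^sup>2))"
    by simp
  have "palm_integrable k"
    by (rule palm_integrable_bound[OF _ palm_integrable_const[of B]]) (auto simp: B)
  then have prod: "integrable M (arrival_sum (\<lambda>m \<omega>. k (before m \<omega>) * U m \<omega>))"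
    "expectation (arrival_sum (\<lambda>m \<omega>. k (before m \<omega>) * U m \<omega>)) = palm_mean k * expectation (U 0)"
    using campbell_product[of k fst] moments(1) by simp_all
  have "cycle k = (\<lambda>m \<omega>. cyc m \<omega> + k (before m \<omega>) * U m \<omega>)"
    by (simp add: cyc_def fun_eq_iff mult.commute)
  then have "expectation (arrival_sum (cycle k))
      = expectation (arrival_sum cyc) + palm_mean k * expectation (U 0)"
    using arrival_sum_add(2)[OF _ _ ci prod(1)] prod(2) by simp
  then have "\<Lambda> * (expectation (\<lambda>\<omega>. k (V0 \<omega>)) - expectation (arrival_sum cyc))
      = palm_mean k * (\<Lambda> * expectation (U 0))"
    using cycle_formula(2)[OF k B] by simp
  then show "palm_mean k = \<Lambda> * (expectation (\<lambda>\<omega>. k (V0 \<omega>)) - expectation (arrival_sum cyc))"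
    by (simp add: Lambda_EU)
qed

text \<open>
  The expansion of cycles for \<open>k(w) = min w n\<close> bounds the Palm mean of \<open>min w n\<close> by \<open>\<Lambda> (E V0 + const)\<close>,
  uniformly in \<open>n\<close>. Truncation is removed first for each finite partial sum over arrivals.
\<close>

lemma palm_integrable_workload: "palm_integrable (\<lambda>w. w)"
proof -
  define C where "C = \<Lambda> * (expectation V0 + (expectation (S 0) + \<Lambda> * expectation (\<lambda>\<omega>. (U 0 \<omega>)\<^sup>2)))"
  have bound: "palm_mean (\<lambda>w. min (max w 0) (real n)) \<le> C" for n
  proof -
    note ce = cycle_expansion[OF truncation_Lipschitz[of _ n], of "real n"]
    have "expectation (\<lambda>\<omega>. min (max (V0 \<omega>) 0) (real n)) \<le> expectation V0"
      using V0_nonneg by (intro integral_mono workload_integrable integrable_const_bound[where B = "real n"]) auto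
    moreover have "\<bar>min (max x 0) (real n)\<bar> \<le> real n" for x by auto
    ultimately show ?thesis
      using ce Lambda_pos unfolding C_def by (subst ce(3)) (auto intro!: mult_left_mono)
  qed
  have int_le: "integrable M (\<lambda>\<omega>. \<Sum>m<K. arr m \<omega> * before m \<omega>) \<and>
      expectation (\<lambda>\<omega>. \<Sum>m<K. arr m \<omega> * before m \<omega>) \<le> C" for K
  proof -
    have "expectation (\<lambda>\<omega>. min (\<Sum>m<K. arr m \<omega> * before m \<omega>) (real n)) \<le> C" for n
    proof -
      let ?k = "\<lambda>w. min (max w 0) (real n)"
      have pi: "palm_integrable ?k"
        by (rule palm_integrable_bound[OF _ palm_integrable_const[of "real n"]]) auto
      have ik: "integrable M (\<lambda>\<omega>. arr m \<omega> * ?k (before m \<omega>))" for m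
        using pi by (simp add: palm_integrable_def)
      have "summable (\<lambda>m. expectation (\<lambda>\<omega>. arr m \<omega> * ?k (before m \<omega>)))"
        using pi by (simp add: palm_integrable_def)
      have "expectation (\<lambda>\<omega>. min (\<Sum>m<K. arr m \<omega> * before m \<omega>) (real n))
          \<le> expectation (\<lambda>\<omega>. \<Sum>m<K. arr m \<omega> * ?k (before m \<omega>))"
      proof (rule integral_mono)
        have nn: "0 \<le> (\<Sum>m<K. arr m \<omega> * before m \<omega>)" for \<omega>
          by (intro sum_nonneg mult_nonneg_nonneg arr_range before_nonneg)
        show "integrable M (\<lambda>\<omega>. min (\<Sum>m<K. arr m \<omega> * before m \<omega>) (real n))"
          by (rule integrable_const_bound[where B = "real n"])
            (auto intro!: AE_I2 simp: min_def abs_of_nonneg[OF nn])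
        fix \<omega>
        have "min (\<Sum>m<K. arr m \<omega> * before m \<omega>) (real n) \<le> (\<Sum>m<K. min (arr m \<omega> * before m \<omega>) (real n))"
          by (rule min_sum_le) (auto simp: arr_range before_nonneg)
        also have "\<dots> = (\<Sum>m<K. arr m \<omega> * ?k (before m \<omega>))"
          by (intro sum.cong) (auto simp: arr_def before_nonneg)
        finally show "min (\<Sum>m<K. arr m \<omega> * before m \<omega>) (real n) \<le> (\<Sum>m<K. arr m \<omega> * ?k (before m \<omega>))" .
      qed (auto intro: ik)
      also have "\<dots> = (\<Sum>m<K. expectation (\<lambda>\<omega>. arr m \<omega> * ?k (before m \<omega>)))"
        by (rule Bochner_Integration.integral_sum) (rule ik)
      also have "\<dots> \<le> palm_mean ?k"
        unfolding palm_mean_def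
        by (rule sum_le_suminf) (auto intro!: \<open>summable _\<close> integral_nonneg_AE simp: arr_range)
      also have "\<dots> \<le> C" by (rule bound)
      finally show ?thesis .
    qed
    note trunc = this
    have nn: "0 \<le> (\<Sum>m<K. arr m \<omega> * before m \<omega>)" for \<omega>
      by (intro sum_nonneg mult_nonneg_nonneg arr_range before_nonneg)
    show ?thesis
      by (intro conjI integrable_of_truncations[OF _ nn trunc]) measurable
  qed
  have int: "integrable M (\<lambda>\<omega>. arr m \<omega> * before m \<omega>)" for m
  proof (rule Bochner_Integration.integrable_bound)
    show "integrable M (\<lambda>\<omega>. \<Sum>k<Suc m. arr k \<omega> * before k \<omega>)" using int_le by blast
    show "AE \<omega> in M. norm (arr m \<omega> * before m \<omega>) \<le> norm (\<Sum>k<Suc m. arr k \<omega> * before k \<omega>)"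
    proof (rule AE_I2)
      fix \<omega>
      have "arr m \<omega> * before m \<omega> \<le> (\<Sum>k<Suc m. arr k \<omega> * before k \<omega>)"
        by (rule member_le_sum) (auto simp: arr_range before_nonneg)
      then show "norm (arr m \<omega> * before m \<omega>) \<le> norm (\<Sum>k<Suc m. arr k \<omega> * before k \<omega>)"
        by (simp add: arr_range before_nonneg)
    qed
  qed simp
  have "summable (\<lambda>m. expectation (\<lambda>\<omega>. arr m \<omega> * before m \<omega>))"
  proof (rule summableI_nonneg_bounded)
    show "0 \<le> expectation (\<lambda>\<omega>. arr m \<omega> * before m \<omega>)" for m
      by (auto intro!: integral_nonneg_AE simp: arr_range before_nonneg)
    show "(\<Sum>m<K. expectation (\<lambda>\<omega>. arr m \<omega> * before m \<omega>)) \<le> C" for K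
      using int_le[of K] by (subst (asm) Bochner_Integration.integral_sum) (auto intro: int)
  qed
  then show ?thesis
    using int by (simp add: palm_integrable_def before_nonneg)
qed

lemma palm_integrable_affine: "palm_integrable (\<lambda>w. c + d * w)"
proof -
  have i: "integrable M (\<lambda>\<omega>. arr m \<omega> * before m \<omega>)" for m
    using palm_integrable_workload by (simp add: palm_integrable_def)
  have s: "summable (\<lambda>m. expectation (\<lambda>\<omega>. arr m \<omega> * before m \<omega>))"
    using palm_integrable_workload by (simp add: palm_integrable_def before_nonneg)
  have i2: "integrable M (\<lambda>\<omega>. arr m \<omega> * (c' + d' * before m \<omega>))" for m c' d'
    using i[of m] arr_integrable[of m] by (auto simp: distrib_left mult.left_commute)
  have e2: "expectation (\<lambda>\<omega>. arr m \<omega> * (\<bar>c\<bar> + \<bar>d\<bar> * before m \<omega>))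
      = \<bar>c\<bar> * expectation (arr m) + \<bar>d\<bar> * expectation (\<lambda>\<omega>. arr m \<omega> * before m \<omega>)" for m
    using i[of m] arr_integrable[of m] by (simp add: distrib_left mult.left_commute mult.commute)
  have "summable (\<lambda>m. expectation (\<lambda>\<omega>. arr m \<omega> * \<bar>c + d * before m \<omega>\<bar>))"
  proof (rule summable_comparison_test')
    show "summable (\<lambda>m. expectation (\<lambda>\<omega>. arr m \<omega> * (\<bar>c\<bar> + \<bar>d\<bar> * before m \<omega>)))"
      unfolding e2 by (intro summable_add summable_mult arrivals_summable s)
    fix m
    have "expectation (\<lambda>\<omega>. arr m \<omega> * \<bar>c + d * before m \<omega>\<bar>) \<le> expectation (\<lambda>\<omega>. arr m \<omega> * (\<bar>c\<bar> + \<bar>d\<bar> * before m \<omega>))"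
    proof (rule integral_mono)
      show "integrable M (\<lambda>\<omega>. arr m \<omega> * \<bar>c + d * before m \<omega>\<bar>)"
        using integrable_abs[OF i2[of m c d]] by (simp add: abs_mult arr_range)
      fix \<omega>
      have "\<bar>c + d * before m \<omega>\<bar> \<le> \<bar>c\<bar> + \<bar>d\<bar> * before m \<omega>"
        using abs_triangle_ineq[of c "d * before m \<omega>"] by (simp add: abs_mult before_nonneg)
      then show "arr m \<omega> * \<bar>c + d * before m \<omega>\<bar> \<le> arr m \<omega> * (\<bar>c\<bar> + \<bar>d\<bar> * before m \<omega>)"
        by (intro mult_left_mono arr_range)
    qed (rule i2)
    moreover have "0 \<le> expectation (\<lambda>\<omega>. arr m \<omega> * \<bar>c + d * before m \<omega>\<bar>)"
      by (auto intro!: integral_nonneg_AE simp: arr_range)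
    ultimately show "norm (expectation (\<lambda>\<omega>. arr m \<omega> * \<bar>c + d * before m \<omega>\<bar>))
        \<le> expectation (\<lambda>\<omega>. arr m \<omega> * (\<bar>c\<bar> + \<bar>d\<bar> * before m \<omega>))" by simp
  qed
  then show ?thesis using i2 by (simp add: palm_integrable_def)
qed

section \<open>The error terms\<close>

text \<open>
  Balance equation with the second-order term of the jumps separated and rewritten as a time average. The linear growth of
  \<open>\<phi>'\<close> is integrable both in time and over arrivals because the workload has a finite mean under both averages.
\<close>

lemma stein_balance:
  fixes \<phi> \<phi>' \<phi>'' :: "real \<Rightarrow> real"
  assumes \<phi>: "\<And>x. (\<phi> has_real_derivative \<phi>' x) (at x)"
    and \<phi>': "\<And>x. (\<phi>' has_real_derivative \<phi>'' x) (at x)"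
    and L: "\<And>x y. \<bar>\<phi>' x - \<phi>' y\<bar> \<le> L * \<bar>x - y\<bar>"
    and B: "\<And>x. \<bar>\<phi>'' x\<bar> \<le> B"
    and K: "\<And>x y. \<bar>\<phi>'' x - \<phi>'' y\<bar> \<le> K * \<bar>x - y\<bar>"
  defines "rem \<equiv> \<lambda>m \<omega>. \<phi> (\<delta> * before m \<omega> + \<delta> * net m \<omega>) - \<phi> (\<delta> * before m \<omega>)
      - \<delta> * net m \<omega> * \<phi>' (\<delta> * before m \<omega>) - 1/2 * (\<delta> * net m \<omega>)\<^sup>2 * \<phi>'' (\<delta> * before m \<omega>)"
    and "cyc \<equiv> \<lambda>m \<omega>. cycle (\<lambda>w. \<phi>'' (\<delta> * w)) m \<omega> - U m \<omega> * \<phi>'' (\<delta> * before m \<omega>)"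
  shows "integrable M (\<lambda>\<omega>. \<phi>' (\<delta> * V0 \<omega>))"
    and "integrable M (\<lambda>\<omega>. \<phi>' (\<delta> * V0 \<omega> - \<delta> * \<rho> * R0 \<omega>))"
    and "integrable M (\<lambda>\<omega>. of_bool (V0 \<omega> = 0) * \<phi>' (- (\<delta> * \<rho> * R0 \<omega>)))"
    and "integrable M (arrival_sum rem)"
    and "\<bar>expectation (arrival_sum rem)\<bar> \<le> K / 6 * \<delta> ^ 3 * \<Lambda> * expectation (\<lambda>\<omega>. \<bar>net 0 \<omega>\<bar> ^ 3)"
    and "integrable M (arrival_sum cyc)"
    and "\<bar>expectation (arrival_sum cyc)\<bar>
      \<le> K * \<delta> * (expectation (S 0) + \<Lambda> * expectation (\<lambda>\<omega>. (U 0 \<omega>)\<^sup>2))"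
    and "\<delta>\<^sup>2 * expectation (\<lambda>\<omega>. \<phi>' (\<delta> * V0 \<omega> - \<delta> * \<rho> * R0 \<omega>))
      = \<delta> * expectation (\<lambda>\<omega>. of_bool (V0 \<omega> = 0) * \<phi>' (- (\<delta> * \<rho> * R0 \<omega>))) + expectation (arrival_sum rem)
        + 1/2 * \<delta>\<^sup>2 * \<Lambda> * expectation (\<lambda>\<omega>. (net 0 \<omega>)\<^sup>2)
          * (expectation (\<lambda>\<omega>. \<phi>'' (\<delta> * V0 \<omega>)) - expectation (arrival_sum cyc))"
proof -
  note [measurable] = DERIV_borel_measurable[OF \<phi>] DERIV_borel_measurable[OF \<phi>']
    borel_measurable_continuous_onI[OF Lipschitz_continuous[OF K]]
  have growth: "\<bar>\<phi>' x\<bar> \<le> \<bar>\<phi>' 0\<bar> + L * \<bar>x\<bar>" for x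
    using L[of x 0, unfolded diff_zero] by linarith
  have iV: "integrable M (\<lambda>\<omega>. \<bar>\<phi>' 0\<bar> + L * \<bar>Q \<omega>\<bar>)" if "integrable M Q" for Q
    using that by auto
  have growth_int: "integrable M (\<lambda>\<omega>. \<phi>' (Q \<omega>))" if "integrable M Q" for Q
  proof (rule Bochner_Integration.integrable_bound[OF iV[OF that]])
    show "AE \<omega> in M. norm (\<phi>' (Q \<omega>)) \<le> norm (\<bar>\<phi>' 0\<bar> + L * \<bar>Q \<omega>\<bar>)"
      using growth by (auto intro!: AE_I2 order_trans[OF growth])
  qed (use that in measurable)
  show "integrable M (\<lambda>\<omega>. \<phi>' (\<delta> * V0 \<omega>))"
    by (rule growth_int) (use workload_integrable in auto)
  show iD: "integrable M (\<lambda>\<omega>. \<phi>' (\<delta> * V0 \<omega> - \<delta> * \<rho> * R0 \<omega>))"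
    by (rule growth_int) (use workload_integrable residual_mean(1) in auto)
  have pi: "palm_integrable (\<lambda>w. \<phi>' (\<delta> * w))"
  proof (rule palm_integrable_bound[OF _ palm_integrable_affine[of "\<bar>\<phi>' 0\<bar>" "L * \<delta>"]])
    fix w :: real assume "0 \<le> w"
    then show "\<bar>\<phi>' (\<delta> * w)\<bar> \<le> \<bar>\<phi>' 0\<bar> + L * \<delta> * w"
      using growth[of "\<delta> * w"] delta_pos by (simp add: abs_mult mult.assoc)
  qed measurable
  note bal = smooth_balance[OF \<phi> L pi iD]
  show "integrable M (\<lambda>\<omega>. of_bool (V0 \<omega> = 0) * \<phi>' (- (\<delta> * \<rho> * R0 \<omega>)))" by (rule bal)
  have rem_meas[measurable]: "rem m \<in> borel_measurable M" for m
    unfolding rem_def by measurable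
  have rem_le: "\<bar>rem m \<omega>\<bar> \<le> K / 6 * \<delta> ^ 3 * \<bar>net m \<omega>\<bar> ^ 3" for m \<omega>
    using taylor3_bound[OF \<phi> \<phi>' K, of "\<delta> * before m \<omega>" "\<delta> * net m \<omega>"] delta_pos
    by (simp add: rem_def abs_mult power_mult_distrib mult_ac)
  have dom: "integrable M (arrival_sum rem)"
    "\<bar>expectation (arrival_sum rem)\<bar> \<le> \<Lambda> * expectation (\<lambda>\<omega>. K / 6 * \<delta> ^ 3 * \<bar>net 0 \<omega>\<bar> ^ 3)"
    using arrival_sum_dominated[of rem "\<lambda>p. K / 6 * \<delta> ^ 3 * \<bar>snd p - \<rho> * fst p\<bar> ^ 3"]
      rem_le net_moments(2) by (simp_all add: net_def)
  show ri: "integrable M (arrival_sum rem)" by (rule dom)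
  show "\<bar>expectation (arrival_sum rem)\<bar> \<le> K / 6 * \<delta> ^ 3 * \<Lambda> * expectation (\<lambda>\<omega>. \<bar>net 0 \<omega>\<bar> ^ 3)"
    using dom(2) by (simp add: mult_ac)
  have K': "\<bar>\<phi>'' (\<delta> * x) - \<phi>'' (\<delta> * y)\<bar> \<le> (K * \<delta>) * \<bar>x - y\<bar>" for x y
    using K[of "\<delta> * x" "\<delta> * y"] delta_pos by (simp add: abs_mult mult.assoc flip: right_diff_distrib)
  note ce = cycle_expansion[OF K' B, folded cyc_def]
  show "integrable M (arrival_sum cyc)" by (rule ce)
  show "\<bar>expectation (arrival_sum cyc)\<bar>
      \<le> K * \<delta> * (expectation (S 0) + \<Lambda> * expectation (\<lambda>\<omega>. (U 0 \<omega>)\<^sup>2))" by (rule ce)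
  have "palm_integrable (\<lambda>w. \<phi>'' (\<delta> * w))"
    by (rule palm_integrable_bound[OF _ palm_integrable_const[of B]]) (auto simp: B)
  then have quad: "integrable M (arrival_sum (\<lambda>m \<omega>. \<phi>'' (\<delta> * before m \<omega>) * (1/2 * \<delta>\<^sup>2 * (net m \<omega>)\<^sup>2)))"
    "expectation (arrival_sum (\<lambda>m \<omega>. \<phi>'' (\<delta> * before m \<omega>) * (1/2 * \<delta>\<^sup>2 * (net m \<omega>)\<^sup>2)))
      = palm_mean (\<lambda>w. \<phi>'' (\<delta> * w)) * (1/2 * \<delta>\<^sup>2 * expectation (\<lambda>\<omega>. (net 0 \<omega>)\<^sup>2))"
    using campbell_product[of "\<lambda>w. \<phi>'' (\<delta> * w)" "\<lambda>p. 1/2 * \<delta>\<^sup>2 * (snd p - \<rho> * fst p)\<^sup>2"] net_moments(1)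
    by (simp_all add: net_def)
  have "(\<lambda>m \<omega>. \<phi> (\<delta> * before m \<omega> + \<delta> * net m \<omega>) - \<phi> (\<delta> * before m \<omega>)
      - \<delta> * net m \<omega> * \<phi>' (\<delta> * before m \<omega>))
    = (\<lambda>m \<omega>. rem m \<omega> + \<phi>'' (\<delta> * before m \<omega>) * (1/2 * \<delta>\<^sup>2 * (net m \<omega>)\<^sup>2))"
    by (simp add: rem_def fun_eq_iff power_mult_distrib algebra_simps)
  then have "expectation (arrival_sum (\<lambda>m \<omega>. \<phi> (\<delta> * before m \<omega> + \<delta> * net m \<omega>) - \<phi> (\<delta> * before m \<omega>)
      - \<delta> * net m \<omega> * \<phi>' (\<delta> * before m \<omega>)))
    = expectation (arrival_sum rem) + palm_mean (\<lambda>w. \<phi>'' (\<delta> * w)) * (1/2 * \<delta>\<^sup>2 * expectation (\<lambda>\<omega>. (net 0 \<omega>)\<^sup>2))"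
    using arrival_sum_add(2)[OF rem_meas _ ri quad(1)] quad(2) by simp
  then show "\<delta>\<^sup>2 * expectation (\<lambda>\<omega>. \<phi>' (\<delta> * V0 \<omega> - \<delta> * \<rho> * R0 \<omega>))
      = \<delta> * expectation (\<lambda>\<omega>. of_bool (V0 \<omega> = 0) * \<phi>' (- (\<delta> * \<rho> * R0 \<omega>))) + expectation (arrival_sum rem)
        + 1/2 * \<delta>\<^sup>2 * \<Lambda> * expectation (\<lambda>\<omega>. (net 0 \<omega>)\<^sup>2)
          * (expectation (\<lambda>\<omega>. \<phi>'' (\<delta> * V0 \<omega>)) - expectation (arrival_sum cyc))"
    using bal(4) ce(3) by (simp add: mult_ac)
qed

definition X :: "real \<Rightarrow> 'a \<Rightarrow> real" where "X t \<omega> = \<delta> * W t \<omega>"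

lemma X_0: "\<omega> \<in> space M \<Longrightarrow> X 0 \<omega> = \<delta> * V0 \<omega>"
  by (simp add: X_def initial_state)

lemma X_left_limit:
  assumes "\<omega> \<in> space M"
  shows "left_limit (\<lambda>t. X t \<omega>) (\<tau> m \<omega>) = \<delta> * before m \<omega>"
  using queue_path.left_limit_workload[OF path[OF assms]]
  by (simp add: X_def W_def \<tau>_def before_def)

text \<open>
  The right end point \<open>t = U m\<close> is excluded, as the next arrival occurs there; it does not affect the integral in the cycle term.
\<close>

lemma X_between:
  assumes "\<omega> \<in> space M" "0 \<le> t" "t < U m \<omega>"
  shows "X (\<tau> m \<omega> + t) \<omega> = \<delta> * max 0 (before m \<omega> + S m \<omega> - t)"
proof -
  interpret P: queue_path "V0 \<omega>" "R0 \<omega>" "\<lambda>k. U k \<omega>" "\<lambda>k. S k \<omega>"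
    by (rule path[OF assms(1)])
  show ?thesis
    using P.state_between(1)[of m "\<tau> m \<omega> + t"] assms
    by (simp add: X_def W_def \<tau>_def P.t_arr_Suc P.w_after_eq before_def)
qed

text \<open>
  The Taylor coefficient is normalized by the cube of \<open>\<delta> (S - \<rho> U)\<close>, but multiplied only by that of \<open>S - \<rho> U\<close>; hence
  the factor \<open>6/\<delta>\<^sup>3\<close>. If the net input vanishes, both sides are zero.
\<close>

lemma jump_term_eq:
  assumes d: "deriv \<phi> = \<phi>'" "deriv \<phi>' = \<phi>''" and \<omega>: "\<omega> \<in> space M"
  shows "jump_term \<delta> \<rho> X \<tau> U S \<phi> \<omega> = arrival_sum (\<lambda>m \<omega>. 6 / \<delta> ^ 3 *
     (\<phi> (\<delta> * before m \<omega> + \<delta> * net m \<omega>) - \<phi> (\<delta> * before m \<omega>)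
      - \<delta> * net m \<omega> * \<phi>' (\<delta> * before m \<omega>) - 1/2 * (\<delta> * net m \<omega>)\<^sup>2 * \<phi>'' (\<delta> * before m \<omega>))) \<omega>"
  unfolding jump_term_def arrival_sum_def X_left_limit[OF \<omega>] taylor_coeff3_def d net_def[symmetric]
proof (rule arg_cong[of _ _ "arrival_integral _"], rule ext)
  fix m
  show "net m \<omega> ^ 3 * ((\<phi> (\<delta> * before m \<omega> + \<delta> * net m \<omega>) - \<phi> (\<delta> * before m \<omega>)
        - \<delta> * net m \<omega> * \<phi>' (\<delta> * before m \<omega>) - 1 / 2 * (\<delta> * net m \<omega>)\<^sup>2 * \<phi>'' (\<delta> * before m \<omega>))
        / (1 / 6 * (\<delta> * net m \<omega>) ^ 3))
    = 6 / \<delta> ^ 3 * (\<phi> (\<delta> * before m \<omega> + \<delta> * net m \<omega>) - \<phi> (\<delta> * before m \<omega>)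
        - \<delta> * net m \<omega> * \<phi>' (\<delta> * before m \<omega>) - 1 / 2 * (\<delta> * net m \<omega>)\<^sup>2 * \<phi>'' (\<delta> * before m \<omega>))"
    (is "_ ^ 3 * (?r / _) = _ * ?r")
  proof (cases "net m \<omega> = 0")
    case False
    define r where "r = ?r"
    show ?thesis
      unfolding r_def[symmetric] using False delta_pos by (simp add: power_mult_distrib field_simps)
  qed simp
qed

lemma cycle_term_eq:
  assumes d: "deriv \<phi> = \<phi>'" "deriv \<phi>' = \<phi>''" and cont: "continuous_on UNIV \<phi>''" and \<omega>: "\<omega> \<in> space M"
  shows "cycle_term X \<tau> U \<phi> \<omega>
    = arrival_sum (\<lambda>m \<omega>. cycle (\<lambda>w. \<phi>'' (\<delta> * w)) m \<omega> - U m \<omega> * \<phi>'' (\<delta> * before m \<omega>)) \<omega>"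
  unfolding cycle_term_def arrival_sum_def X_left_limit[OF \<omega>] Let_def d taylor_coeff1_mult
proof (rule arg_cong[of _ _ "arrival_integral _"], rule ext)
  fix m
  let ?k = "\<lambda>w. \<phi>'' (\<delta> * w)"
  have k: "continuous_on UNIV ?k"
    by (intro continuous_on_compose2[OF cont] continuous_intros) auto
  note [measurable] = borel_measurable_continuous_onI[OF cont]
  let ?g = "\<lambda>t. ?k (max 0 (before m \<omega> + S m \<omega> - t)) - ?k (before m \<omega>)"
  have "X (\<tau> m \<omega> + t) \<omega> = \<delta> * max 0 (before m \<omega> + S m \<omega> - t)" if "t \<in> {0..U m \<omega>} - {U m \<omega>}" for t
    using that by (intro X_between[OF \<omega>]) auto
  then have ae: "AE t in lborel. indicator {0..U m \<omega>} t *
        (\<phi>'' (\<delta> * before m \<omega> + (X (\<tau> m \<omega> + t) \<omega> - \<delta> * before m \<omega>)) - ?k (before m \<omega>))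
      = indicator {0..U m \<omega>} t * ?g t"
    using AE_lborel_singleton[of "U m \<omega>"] by (auto simp: indicator_def)
  have state: "(\<lambda>t. X t \<omega>) \<in> borel_measurable borel"
    using measurable_compose[OF measurable_Pair2'[OF \<omega>] state_meas(1)] by (simp add: X_def)
  have "(LINT t:{0..U m \<omega>}|lborel.
        \<phi>'' (\<delta> * before m \<omega> + (X (\<tau> m \<omega> + t) \<omega> - \<delta> * before m \<omega>)) - ?k (before m \<omega>))
      = (LINT t:{0..U m \<omega>}|lborel. ?g t)"
    unfolding set_lebesgue_integral_def real_scaleR_def
  proof (rule integral_cong_AE[OF _ _ ae])
    have [measurable]: "(\<lambda>t. X (\<tau> m \<omega> + t) \<omega>) \<in> borel_measurable borel"
      by (rule measurable_compose[OF _ state]) simp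
    show "(\<lambda>t. indicator {0..U m \<omega>} t *
        (\<phi>'' (\<delta> * before m \<omega> + (X (\<tau> m \<omega> + t) \<omega> - \<delta> * before m \<omega>)) - ?k (before m \<omega>)))
      \<in> borel_measurable lborel"
      unfolding measurable_lborel1 by measurable
  qed measurable
  also have "\<dots> = cycle ?k m \<omega> - U m \<omega> * ?k (before m \<omega>)"
  proof -
    have c: "set_integrable lborel {0..U m \<omega>} (\<lambda>_. ?k (before m \<omega>))"
      by (rule borel_integrable_atLeastAtMost') simp
    have "(LINT t:{0..U m \<omega>}|lborel. ?k (before m \<omega>)) = U m \<omega> * ?k (before m \<omega>)"
      using U_pos[OF \<omega>, of m] by (simp add: set_lebesgue_integral_def)
    then show ?thesis
      unfolding cycle_def running_integral_LINT(1)[OF k]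
      using set_integral_diff(2)[OF running_integral_LINT(2)[OF k] c] by simp
  qed
  finally show "(LINT t:{0..U m \<omega>}|lborel.
        \<phi>'' (\<delta> * before m \<omega> + (X (\<tau> m \<omega> + t) \<omega> - \<delta> * before m \<omega>)) - \<phi>'' (\<delta> * before m \<omega>))
      = cycle ?k m \<omega> - U m \<omega> * \<phi>'' (\<delta> * before m \<omega>)" .
qed

lemma residual_term_eq:
  assumes "deriv \<phi> = \<phi>'" "0 < \<rho>" "\<omega> \<in> space M"
  shows "residual_term \<delta> \<rho> X R \<phi> \<omega>
    = (\<phi>' (\<delta> * V0 \<omega>) - \<phi>' (\<delta> * V0 \<omega> - \<delta> * \<rho> * R0 \<omega>)) / (\<delta> * \<rho>)"
  using assms delta_pos R0_pos[OF assms(3)]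
  by (simp add: residual_term_def taylor_coeff1_def X_0 initial_state field_simps)

lemma idle_term_eq:
  assumes "deriv \<phi> = \<phi>'" "\<phi>' 0 = 0" "0 < \<rho>" "\<omega> \<in> space M"
  shows "idle_term \<delta> \<rho> X R \<phi> \<omega>
    = - (of_bool (V0 \<omega> = 0) * \<phi>' (- (\<delta> * \<rho> * R0 \<omega>)) / (\<delta> * \<rho>))"
  using assms delta_pos R0_pos[OF assms(4)]
  by (simp add: idle_term_def taylor_coeff1_def X_0 initial_state field_simps)

text \<open>
  Substituting the definitions of the error terms into the balance equation. The values \<open>\<phi>'(\<delta>(V0 - \<rho> R0))\<close> and the idle terms
  cancel in \<open>\<epsilon>\<^sub>0 + \<epsilon>\<^sub>A\<close>, leaving, up to sign, the generator of the limiting diffusion at \<open>X\<close>.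
\<close>

lemma error_terms:
  fixes \<phi> \<phi>' \<phi>'' :: "real \<Rightarrow> real"
  assumes d: "deriv \<phi> = \<phi>'" "deriv \<phi>' = \<phi>''" and \<phi>0: "\<phi>' 0 = 0" and \<rho>: "0 < \<rho>"
    and \<phi>: "\<And>x. (\<phi> has_real_derivative \<phi>' x) (at x)"
    and \<phi>': "\<And>x. (\<phi>' has_real_derivative \<phi>'' x) (at x)"
    and L: "\<And>x y. \<bar>\<phi>' x - \<phi>' y\<bar> \<le> L * \<bar>x - y\<bar>"
    and B: "\<And>x. \<bar>\<phi>'' x\<bar> \<le> B"
    and K: "\<And>x y. \<bar>\<phi>'' x - \<phi>'' y\<bar> \<le> K * \<bar>x - y\<bar>"
  shows "integrable M (residual_term \<delta> \<rho> X R \<phi>)" "integrable M (idle_term \<delta> \<rho> X R \<phi>)"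
    and "integrable M (jump_term \<delta> \<rho> X \<tau> U S \<phi>)" "integrable M (cycle_term X \<tau> U \<phi>)"
    and "integrable M (\<lambda>\<omega>. \<phi>' (X 0 \<omega>))" "integrable M (\<lambda>\<omega>. \<phi>'' (X 0 \<omega>))"
    and "eps0 M \<delta> \<rho> X R \<phi> + epsA M \<Lambda> \<delta> \<rho> X \<tau> U S \<phi>
      = \<delta>\<^sup>2 * expectation (\<lambda>\<omega>. \<phi>' (X 0 \<omega>))
        - 1/2 * \<delta>\<^sup>2 * \<Lambda> * expectation (\<lambda>\<omega>. (net 0 \<omega>)\<^sup>2) * expectation (\<lambda>\<omega>. \<phi>'' (X 0 \<omega>))"
    and "\<bar>eps0 M \<delta> \<rho> X R \<phi>\<bar> \<le> \<delta> ^ 3 * \<rho> * L * expectation (R 0)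
      + \<delta>\<^sup>2 * \<rho> * L * expectation (\<lambda>\<omega>. of_bool (X 0 \<omega> = 0) * R 0 \<omega>)"
    and "\<bar>epsA M \<Lambda> \<delta> \<rho> X \<tau> U S \<phi>\<bar>
      \<le> K / 6 * \<delta> ^ 3 * \<Lambda> * expectation (\<lambda>\<omega>. \<bar>net 0 \<omega>\<bar> ^ 3)
        + 1/2 * \<delta>\<^sup>2 * \<Lambda> * expectation (\<lambda>\<omega>. (net 0 \<omega>)\<^sup>2)
          * (K * \<delta> * (expectation (S 0) + \<Lambda> * expectation (\<lambda>\<omega>. (U 0 \<omega>)\<^sup>2)))"
proof -
  define rem where "rem = (\<lambda>m \<omega>. \<phi> (\<delta> * before m \<omega> + \<delta> * net m \<omega>) - \<phi> (\<delta> * before m \<omega>)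
      - \<delta> * net m \<omega> * \<phi>' (\<delta> * before m \<omega>) - 1/2 * (\<delta> * net m \<omega>)\<^sup>2 * \<phi>'' (\<delta> * before m \<omega>))"
  define cyc where "cyc = (\<lambda>m \<omega>. cycle (\<lambda>w. \<phi>'' (\<delta> * w)) m \<omega> - U m \<omega> * \<phi>'' (\<delta> * before m \<omega>))"
  note bal = stein_balance[OF \<phi> \<phi>' L B K, folded rem_def cyc_def]
  note cont = Lipschitz_continuous[OF K]
  note [measurable] = DERIV_borel_measurable[OF \<phi>] DERIV_borel_measurable[OF \<phi>']
    borel_measurable_continuous_onI[OF cont]
  have rem_meas: "rem m \<in> borel_measurable M" for m
    unfolding rem_def by measurable
  have L0: "0 \<le> L" using L[of 0 1] by simp
  note res = residual_term_eq[OF d(1) \<rho>] and idl = idle_term_eq[OF d(1) \<phi>0 \<rho>]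
  have jmp: "jump_term \<delta> \<rho> X \<tau> U S \<phi> \<omega> = arrival_sum (\<lambda>m \<omega>. 6 / \<delta> ^ 3 * rem m \<omega>) \<omega>" if "\<omega> \<in> space M" for \<omega>
    using jump_term_eq[OF d that] by (simp add: rem_def)
  have cyt: "cycle_term X \<tau> U \<phi> \<omega> = arrival_sum cyc \<omega>" if "\<omega> \<in> space M" for \<omega>
    using cycle_term_eq[OF d cont that] by (simp add: cyc_def)
  note scale = arrival_sum_scale[OF rem_meas bal(4), of "6 / \<delta> ^ 3"]
  show res_int: "integrable M (residual_term \<delta> \<rho> X R \<phi>)"
    by (subst Bochner_Integration.integrable_cong[OF refl res], assumption) (use bal(1,2) in auto)
  show idl_int: "integrable M (idle_term \<delta> \<rho> X R \<phi>)"
    by (subst Bochner_Integration.integrable_cong[OF refl idl], assumption) (use bal(3) in auto)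
  show "integrable M (jump_term \<delta> \<rho> X \<tau> U S \<phi>)"
    by (subst Bochner_Integration.integrable_cong[OF refl jmp], assumption) (rule scale)
  show "integrable M (cycle_term X \<tau> U \<phi>)"
    by (subst Bochner_Integration.integrable_cong[OF refl cyt], assumption) (rule bal)
  show "integrable M (\<lambda>\<omega>. \<phi>' (X 0 \<omega>))"
    using bal(1) by (subst Bochner_Integration.integrable_cong[OF refl, of _ _ "\<lambda>\<omega>. \<phi>' (\<delta> * V0 \<omega>)"]) (auto simp: X_0)
  show "integrable M (\<lambda>\<omega>. \<phi>'' (X 0 \<omega>))"
    by (rule integrable_const_bound[where B = B]) (auto simp: B X_def)
  have EX: "expectation (\<lambda>\<omega>. g (X 0 \<omega>)) = expectation (\<lambda>\<omega>. g (\<delta> * V0 \<omega>))" for g :: "real \<Rightarrow> real"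
    by (rule Bochner_Integration.integral_cong) (auto simp: X_0)
  have Eres: "expectation (residual_term \<delta> \<rho> X R \<phi>)
      = (expectation (\<lambda>\<omega>. \<phi>' (\<delta> * V0 \<omega>)) - expectation (\<lambda>\<omega>. \<phi>' (\<delta> * V0 \<omega> - \<delta> * \<rho> * R0 \<omega>))) / (\<delta> * \<rho>)"
    by (subst Bochner_Integration.integral_cong[OF refl res], assumption) (use bal(1,2) in simp)
  have Eidl: "expectation (idle_term \<delta> \<rho> X R \<phi>)
      = - (expectation (\<lambda>\<omega>. of_bool (V0 \<omega> = 0) * \<phi>' (- (\<delta> * \<rho> * R0 \<omega>))) / (\<delta> * \<rho>))"
    by (subst Bochner_Integration.integral_cong[OF refl idl], assumption) (use bal(3) in simp)
  have Ejmp: "expectation (jump_term \<delta> \<rho> X \<tau> U S \<phi>) = 6 / \<delta> ^ 3 * expectation (arrival_sum rem)"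
    by (subst Bochner_Integration.integral_cong[OF refl jmp], assumption) (rule scale)
  have Ecyt: "expectation (cycle_term X \<tau> U \<phi>) = expectation (arrival_sum cyc)"
    by (rule Bochner_Integration.integral_cong[OF refl cyt])
  have e0: "eps0 M \<delta> \<rho> X R \<phi>
    = \<delta>\<^sup>2 * (expectation (\<lambda>\<omega>. \<phi>' (\<delta> * V0 \<omega>)) - expectation (\<lambda>\<omega>. \<phi>' (\<delta> * V0 \<omega> - \<delta> * \<rho> * R0 \<omega>)))
      + \<delta> * expectation (\<lambda>\<omega>. of_bool (V0 \<omega> = 0) * \<phi>' (- (\<delta> * \<rho> * R0 \<omega>)))"
    unfolding eps0_def Eres Eidl using delta_pos \<rho> by (simp add: power2_eq_square power3_eq_cube)
  have eA: "epsA M \<Lambda> \<delta> \<rho> X \<tau> U S \<phi> = expectation (arrival_sum rem)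
    - 1/2 * \<delta>\<^sup>2 * \<Lambda> * expectation (\<lambda>\<omega>. (net 0 \<omega>)\<^sup>2) * expectation (arrival_sum cyc)"
    unfolding epsA_def Ejmp Ecyt net_def using delta_pos by simp
  show "eps0 M \<delta> \<rho> X R \<phi> + epsA M \<Lambda> \<delta> \<rho> X \<tau> U S \<phi>
      = \<delta>\<^sup>2 * expectation (\<lambda>\<omega>. \<phi>' (X 0 \<omega>))
        - 1/2 * \<delta>\<^sup>2 * \<Lambda> * expectation (\<lambda>\<omega>. (net 0 \<omega>)\<^sup>2) * expectation (\<lambda>\<omega>. \<phi>'' (X 0 \<omega>))"
    unfolding e0 eA EX using bal(8) by (simp add: right_diff_distrib)
  have dr: "0 < \<delta> * \<rho>" using delta_pos \<rho> by simp
  have lip: "\<bar>\<phi>' x - \<phi>' (x - \<delta> * \<rho> * R0 \<omega>)\<bar> \<le> (\<delta> * \<rho>) * (L * R0 \<omega>)" if "\<omega> \<in> space M" for x \<omega>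
    using L[of x "x - \<delta> * \<rho> * R0 \<omega>"] delta_pos \<rho> R0_pos[OF that] by (simp add: abs_mult mult_ac)
  have R_int: "integrable M (R 0)"
    using residual_mean(1) by (subst Bochner_Integration.integrable_cong[OF refl initial_state(2)]) auto
  have Ri_int: "integrable M (\<lambda>\<omega>. of_bool (X 0 \<omega> = 0) * R 0 \<omega>)"
    by (rule Bochner_Integration.integrable_bound[OF R_int]) (auto simp: X_def)
  have "\<bar>expectation (residual_term \<delta> \<rho> X R \<phi>)\<bar> \<le> expectation (\<lambda>\<omega>. L * R 0 \<omega>)"
  proof (rule integral_abs_bound[THEN order_trans], rule integral_mono)
    show "\<bar>residual_term \<delta> \<rho> X R \<phi> \<omega>\<bar> \<le> L * R 0 \<omega>" if "\<omega> \<in> space M" for \<omega>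
      using lip[OF that, of "\<delta> * V0 \<omega>"] delta_pos \<rho>
      by (simp add: res[OF that] initial_state[OF that] abs_mult abs_divide pos_divide_le_eq mult_ac)
  qed (use res_int R_int in auto)
  then have "\<delta> ^ 3 * \<rho> * \<bar>expectation (residual_term \<delta> \<rho> X R \<phi>)\<bar> \<le> \<delta> ^ 3 * \<rho> * (L * expectation (R 0))"
    using delta_pos \<rho> by (intro mult_left_mono) auto
  moreover have "\<bar>expectation (idle_term \<delta> \<rho> X R \<phi>)\<bar> \<le> expectation (\<lambda>\<omega>. L * (of_bool (X 0 \<omega> = 0) * R 0 \<omega>))"
  proof (rule integral_abs_bound[THEN order_trans], rule integral_mono)
    show "\<bar>idle_term \<delta> \<rho> X R \<phi> \<omega>\<bar> \<le> L * (of_bool (X 0 \<omega> = 0) * R 0 \<omega>)" if "\<omega> \<in> space M" for \<omega>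
      using lip[OF that, of 0] \<rho> \<phi>0 delta_pos
      by (simp add: idl[OF that] initial_state[OF that] X_0[OF that] abs_mult abs_divide pos_divide_le_eq mult_ac)
  qed (use idl_int Ri_int in auto)
  then have "\<delta>\<^sup>2 * \<rho> * \<bar>expectation (idle_term \<delta> \<rho> X R \<phi>)\<bar>
      \<le> \<delta>\<^sup>2 * \<rho> * (L * expectation (\<lambda>\<omega>. of_bool (X 0 \<omega> = 0) * R 0 \<omega>))"
    using delta_pos \<rho> by (intro mult_left_mono) auto
  moreover have "\<bar>eps0 M \<delta> \<rho> X R \<phi>\<bar> \<le> \<delta> ^ 3 * \<rho> * \<bar>expectation (residual_term \<delta> \<rho> X R \<phi>)\<bar>
      + \<delta>\<^sup>2 * \<rho> * \<bar>expectation (idle_term \<delta> \<rho> X R \<phi>)\<bar>"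
    unfolding eps0_def
    using abs_triangle_ineq4[of "\<delta> ^ 3 * \<rho> * expectation (residual_term \<delta> \<rho> X R \<phi>)"
        "\<delta>\<^sup>2 * \<rho> * expectation (idle_term \<delta> \<rho> X R \<phi>)"] delta_pos \<rho>
    by (simp add: abs_mult)
  ultimately show "\<bar>eps0 M \<delta> \<rho> X R \<phi>\<bar> \<le> \<delta> ^ 3 * \<rho> * L * expectation (R 0)
      + \<delta>\<^sup>2 * \<rho> * L * expectation (\<lambda>\<omega>. of_bool (X 0 \<omega> = 0) * R 0 \<omega>)"
    unfolding mult.assoc by linarith
  let ?c = "1/2 * \<delta>\<^sup>2 * \<Lambda> * expectation (\<lambda>\<omega>. (net 0 \<omega>)\<^sup>2)"
  have c: "0 \<le> ?c"
    using Lambda_pos by (intro mult_nonneg_nonneg integral_nonneg_AE) auto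
  have "\<bar>?c * expectation (arrival_sum cyc)\<bar>
      \<le> ?c * (K * \<delta> * (expectation (S 0) + \<Lambda> * expectation (\<lambda>\<omega>. (U 0 \<omega>)\<^sup>2)))"
    unfolding abs_mult[of ?c] abs_of_nonneg[OF c] by (rule mult_left_mono[OF bal(7) c])
  then show "\<bar>epsA M \<Lambda> \<delta> \<rho> X \<tau> U S \<phi>\<bar>
      \<le> K / 6 * \<delta> ^ 3 * \<Lambda> * expectation (\<lambda>\<omega>. \<bar>net 0 \<omega>\<bar> ^ 3)
        + ?c * (K * \<delta> * (expectation (S 0) + \<Lambda> * expectation (\<lambda>\<omega>. (U 0 \<omega>)\<^sup>2)))"
    unfolding eA using bal(5) abs_triangle_ineq4[of "expectation (arrival_sum rem)" "?c * expectation (arrival_sum cyc)"]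
    by linarith
qed

end

section \<open>Stein approximation of the stationary workload\<close>

theorem theorem1:
  fixes M :: "'a measure" and N :: "'b measure"
    and U S :: "nat \<Rightarrow> 'a \<Rightarrow> real" and V0 R0 :: "'a \<Rightarrow> real" and Y :: "'b \<Rightarrow> real"
    and lam \<mu> \<rho> \<delta> cU2 cS2 ES \<theta> s2 :: real
    and \<tau> :: "nat \<Rightarrow> 'a \<Rightarrow> real" and V X R :: "real \<Rightarrow> 'a \<Rightarrow> real"
    and f :: "(real \<Rightarrow> real) \<Rightarrow> real \<Rightarrow> real"
  assumes M: "prob_space M"
    and meas: "V0 \<in> borel_measurable M" "R0 \<in> borel_measurable M"
      "\<And>m. U m \<in> borel_measurable M" "\<And>m. S m \<in> borel_measurable M"
    and range: "\<And>\<omega>. \<omega> \<in> space M \<Longrightarrow> 0 \<le> V0 \<omega>" "\<And>\<omega>. \<omega> \<in> space M \<Longrightarrow> 0 < R0 \<omega>"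
      "\<And>m \<omega>. \<omega> \<in> space M \<Longrightarrow> 0 < U m \<omega>" "\<And>m \<omega>. \<omega> \<in> space M \<Longrightarrow> 0 \<le> S m \<omega>"
    and ident: "\<And>m. distr M borel (U m) = distr M borel (U 0)"
      "\<And>m. distr M borel (S m) = distr M borel (S 0)"
    \<comment> \<open>the pair \<open>(V0, R0)\<close> and all the \<open>U m\<close> and \<open>S m\<close> are mutually independent\<close>
    and indep: "prob_space.indep_vars M (\<lambda>_. borel)
        (case_nat (\<lambda>\<omega>. (V0 \<omega>, R0 \<omega>)) (\<lambda>m \<omega>. (U m \<omega>, S m \<omega>))) UNIV"
      "\<And>m. prob_space.indep_var M borel (U m) borel (S m)"
    and lam: "lam = rate M (U 0)" and mu: "\<mu> = rate M (S 0)"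
    and rho: "\<rho> = lam / \<mu>" and delta: "\<delta> = 1 - \<rho>"
    and cU2: "cU2 = scv M (U 0)" and cS2: "cS2 = scv M (S 0)"
    and ES: "ES = (\<integral>\<omega>. S 0 \<omega> \<partial>M)" "0 < ES"
    and tau: "\<tau> = (\<lambda>m \<omega>. arrival_time (R0 \<omega>) (\<lambda>k. U k \<omega>) m)"
    and V: "V = (\<lambda>t \<omega>. workload (V0 \<omega>) (R0 \<omega>) (\<lambda>k. U k \<omega>) (\<lambda>k. S k \<omega>) t)"
    and X: "X = (\<lambda>t \<omega>. \<delta> * V t \<omega>)"
    and R: "R = (\<lambda>t \<omega>. residual_interarrival (R0 \<omega>) (\<lambda>k. U k \<omega>) t)"
    and no_simultaneous: "AE \<omega> in M. \<forall>m. \<not> depletes_at (\<lambda>t. V t \<omega>) (\<tau> m \<omega>)"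
    and stationary: "\<And>t. 0 \<le> t \<Longrightarrow>
        distr M borel (\<lambda>\<omega>. (X t \<omega>, R t \<omega>)) = distr M borel (\<lambda>\<omega>. (X 0 \<omega>, R 0 \<omega>))"
    and moments: "integrable M (\<lambda>\<omega>. (U 0 \<omega>) ^ 3)" "integrable M (\<lambda>\<omega>. (S 0 \<omega>) ^ 3)"
    and stable: "\<rho> < 1"
    and nonlattice: "nonlattice M (U 0)"
    and Y: "distributed N lborel Y (exponential_density (1 / (\<rho> * ES * (cU2 + cS2) / 2)))"
    and theta: "\<theta> = \<delta>\<^sup>2" and s2: "s2 = \<delta>\<^sup>2 * \<rho> * ES * (cU2 + cS2)"
    and f: "f = (\<lambda>h. stein_solution \<theta> s2 (\<integral>y. h (Y y) \<partial>N) h)"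
  shows
    \<comment> \<open>the first three conjuncts say that the expectations in the last two are well defined\<close>
    "integrable M (X 0) \<and> integrable M (R 0) \<and>
    (\<forall>h\<in>Lip1. integrable M (residual_term \<delta> \<rho> X R (f h)) \<and> integrable M (idle_term \<delta> \<rho> X R (f h))
      \<and> integrable M (jump_term \<delta> \<rho> X \<tau> U S (f h)) \<and> integrable M (cycle_term X \<tau> U (f h))) \<and>
    wasserstein M (X 0) N Y \<le>
      (SUP h\<in>Lip1. ereal (\<bar>eps0 M \<delta> \<rho> X R (f h)\<bar> + \<bar>epsA M lam \<delta> \<rho> X \<tau> U S (f h)\<bar>)) \<and>
    (\<forall>h\<in>Lip1.
      \<bar>eps0 M \<delta> \<rho> X R (f h)\<bar>
        \<le> \<delta> * \<rho> * lam * (\<integral>\<omega>. (U 0 \<omega>)\<^sup>2 \<partial>M) / 2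
           + \<rho> * (\<integral>\<omega>. of_bool (X 0 \<omega> = 0) * R 0 \<omega> \<partial>M) \<and>
      \<bar>epsA M lam \<delta> \<rho> X \<tau> U S (f h)\<bar>
        \<le> 2 * \<delta> * (\<integral>\<omega>. \<bar>S 0 \<omega> - \<rho> * U 0 \<omega>\<bar> ^ 3 \<partial>M) / (3 * ES\<^sup>2 * (cU2 + cS2))
           + 2 * \<delta> * (ES + lam * (\<integral>\<omega>. (U 0 \<omega>)\<^sup>2 \<partial>M)))"
proof -
  interpret P: prob_space M by (rule M)
  have iU: "integrable M (U 0)" "integrable M (\<lambda>\<omega>. (U 0 \<omega>)\<^sup>2)"
    using P.lower_moments[OF meas(3) less_imp_le[OF range(3)] moments(1)] by auto
  have EU: "0 < (\<integral>\<omega>. U 0 \<omega> \<partial>M)"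
    by (rule P.expectation_positive[OF iU(1) range(3)])
  have rho_eq: "\<rho> = ES / (\<integral>\<omega>. U 0 \<omega> \<partial>M)"
    by (simp add: rho lam mu rate_def ES(1))
  have \<rho>: "0 < \<rho>" and \<delta>: "0 < \<delta>"
    using ES(2) EU stable by (simp_all add: rho_eq delta)
  interpret W: workload_model M V0 R0 U S
    by unfold_locales (use meas range in auto)
  have X_eq: "X = (\<lambda>t \<omega>. \<delta> * W.W t \<omega>)" and R_eq: "R = W.R" and tau_eq: "\<tau> = W.\<tau>"
    by (simp_all add: X V R tau W.W_def W.R_def W.\<tau>_def fun_eq_iff)
  have pair_meas: "(\<lambda>\<omega>. (X t \<omega>, R t \<omega>)) \<in> measurable M borel" for t
    unfolding X_eq R_eq by (subst borel_prod[symmetric]) measurable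
  \<comment> \<open>Stationarity is assumed for \<open>(X, R)\<close>; dividing by \<open>\<delta>\<close> transfers it to the workload.\<close>
  have scale_meas: "(\<lambda>p. (fst p / \<delta>, snd p)) \<in> measurable borel (borel :: (real \<times> real) measure)"
    by (intro borel_measurable_continuous_onI continuous_intros) (use \<delta> in auto)
  have stat: "distr M borel (\<lambda>\<omega>. (W.W t \<omega>, W.R t \<omega>)) = distr M borel (\<lambda>\<omega>. (V0 \<omega>, R0 \<omega>))" if "0 \<le> t" for t
  proof -
    have "distr M borel (\<lambda>\<omega>. (W.W s \<omega>, W.R s \<omega>))
        = distr (distr M borel (\<lambda>\<omega>. (X s \<omega>, R s \<omega>))) borel (\<lambda>p. (fst p / \<delta>, snd p))" for s
      using \<delta> by (subst distr_distr[OF scale_meas pair_meas]) (simp add: comp_def X_eq R_eq)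
    then have "distr M borel (\<lambda>\<omega>. (W.W t \<omega>, W.R t \<omega>)) = distr M borel (\<lambda>\<omega>. (W.W 0 \<omega>, W.R 0 \<omega>))"
      using stationary[OF that] by simp
    also have "\<dots> = distr M borel (\<lambda>\<omega>. (V0 \<omega>, R0 \<omega>))"
      by (rule distr_cong) (auto simp: W.initial_state)
    finally show ?thesis .
  qed
  interpret Q: stationary_queue M V0 R0 U S
  proof unfold_locales
    show "(\<integral>\<omega>. S 0 \<omega> \<partial>M) < (\<integral>\<omega>. U 0 \<omega> \<partial>M)"
      using stable EU by (simp add: rho_eq ES(1))
  qed (fact ident indep stat moments)+
  have lam_eq: "lam = Q.\<Lambda>"
    using Q.Lambda_EU EU by (simp add: lam rate_def field_simps)
  have Q_rho: "Q.\<rho> = \<rho>" and Q_delta: "Q.\<delta> = \<delta>"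
    by (simp_all add: Q.\<rho>_def Q.\<delta>_def rho_eq ES(1) delta)
  have Q_X: "Q.X = X"
    by (simp add: X_eq Q.X_def Q_delta fun_eq_iff)
  have Q_net: "Q.net m \<omega> = S m \<omega> - \<rho> * U m \<omega>" for m \<omega>
    by (simp add: Q.net_def Q_rho)
  have lam_pos: "0 < lam" using Q.Lambda_pos lam_eq by simp
  have rho_lam: "\<rho> = lam * ES" by (simp add: rho_eq lam rate_def)
  \<comment> \<open>A nonlattice variable is not constant; this makes the exponential limit nondegenerate.\<close>
  have cU2_pos: "0 < cU2"
    using nonlattice_variance_pos[OF M iU EU nonlattice] lam_pos by (simp add: cU2 scv_def flip: lam)
  have cS2_nonneg: "0 \<le> cS2"
    by (simp add: cS2 scv_def P.variance_positive)
  have "ES * ES * (cU2 + cS2) = P.expectation (\<lambda>\<omega>. (S 0 \<omega> - \<rho> * U 0 \<omega>)\<^sup>2)"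
    using Q.net_variance ES(2)
    by (simp add: Q_net Q_rho rho_lam cU2 cS2 scv_def rate_def lam flip: ES(1))
      (simp add: power2_eq_square field_simps)
  then have s2_eq: "s2 = \<delta>\<^sup>2 * lam * P.expectation (\<lambda>\<omega>. (Q.net 0 \<omega>)\<^sup>2)"
    by (simp add: s2 rho_lam Q_net mult_ac)
  have s2_pos: "0 < s2"
    unfolding s2 using \<delta> \<rho> ES(2) cU2_pos cS2_nonneg by (intro mult_pos_pos) auto
  have theta_pos: "0 < \<theta>" using \<delta> by (simp add: theta)
  \<comment> \<open>The rate of \<open>Y\<close> is the exponent \<open>2\<theta>/\<sigma>\<^sup>2\<close> of the homogeneous Stein equation.\<close>
  have l_eq: "1 / (\<rho> * ES * (cU2 + cS2) / 2) = 2 * \<theta> / s2"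
    using \<delta> by (simp add: s2 theta)
  have Eh: "(\<integral>y. h (Y y) \<partial>N) = exp_shift_mean (2 * \<theta> / s2) h 0" if "h \<in> Lip1" for h
    using distributed_integral[OF Y[unfolded l_eq], of h] Lip1_measurable[OF that] s2_pos theta_pos
    by (simp add: exp_shift_mean_def)
  have iX: "integrable M (X 0)"
    using Q.workload_integrable
    by (subst Bochner_Integration.integrable_cong[OF refl, of _ _ "\<lambda>\<omega>. \<delta> * V0 \<omega>"])
      (auto simp: X_eq W.initial_state)
  have iR: "integrable M (R 0)"
    using Q.residual_mean(1)
    by (subst Bochner_Integration.integrable_cong[OF refl, of _ _ R0]) (auto simp: R_eq W.initial_state)
  have ER: "(\<integral>\<omega>. R 0 \<omega> \<partial>M) \<le> lam * (\<integral>\<omega>. (U 0 \<omega>)\<^sup>2 \<partial>M) / 2"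
  proof -
    have "(\<integral>\<omega>. R 0 \<omega> \<partial>M) = (\<integral>\<omega>. R0 \<omega> \<partial>M)"
      by (rule Bochner_Integration.integral_cong) (auto simp: R_eq W.initial_state)
    then show ?thesis using Q.residual_mean(2) lam_eq by simp
  qed
  have main: "integrable M (residual_term \<delta> \<rho> X R (f h)) \<and> integrable M (idle_term \<delta> \<rho> X R (f h))
      \<and> integrable M (jump_term \<delta> \<rho> X \<tau> U S (f h)) \<and> integrable M (cycle_term X \<tau> U (f h))
      \<and> (\<integral>\<omega>. h (X 0 \<omega>) \<partial>M) - (\<integral>y. h (Y y) \<partial>N)
          = eps0 M \<delta> \<rho> X R (f h) + epsA M lam \<delta> \<rho> X \<tau> U S (f h)
      \<and> \<bar>eps0 M \<delta> \<rho> X R (f h)\<bar>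
        \<le> \<delta> * \<rho> * lam * (\<integral>\<omega>. (U 0 \<omega>)\<^sup>2 \<partial>M) / 2
           + \<rho> * (\<integral>\<omega>. of_bool (X 0 \<omega> = 0) * R 0 \<omega> \<partial>M)
      \<and> \<bar>epsA M lam \<delta> \<rho> X \<tau> U S (f h)\<bar>
        \<le> 2 * \<delta> * (\<integral>\<omega>. \<bar>S 0 \<omega> - \<rho> * U 0 \<omega>\<bar> ^ 3 \<partial>M) / (3 * ES\<^sup>2 * (cU2 + cS2))
           + 2 * \<delta> * (ES + lam * (\<integral>\<omega>. (U 0 \<omega>)\<^sup>2 \<partial>M))" if h: "h \<in> Lip1" for h
  proof -
    define c where "c = (\<integral>y. h (Y y) \<partial>N)"
    obtain \<phi> \<phi>' \<phi>'' where st: "stein_solution \<theta> s2 c h = \<phi>"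
      and d: "deriv \<phi> = \<phi>'" "deriv \<phi>' = \<phi>''" and \<phi>0: "\<phi>' 0 = 0"
      and D: "\<And>x. (\<phi> has_real_derivative \<phi>' x) (at x)" "\<And>x. (\<phi>' has_real_derivative \<phi>'' x) (at x)"
      and L: "\<And>x y. \<bar>\<phi>' x - \<phi>' y\<bar> \<le> (1 / \<theta>) * \<bar>x - y\<bar>" and B: "\<And>x. \<bar>\<phi>'' x\<bar> \<le> 1 / \<theta>"
      and K: "\<And>x y. \<bar>\<phi>'' x - \<phi>'' y\<bar> \<le> (4 / s2) * \<bar>x - y\<bar>"
      and eq: "\<And>x. - \<theta> * \<phi>' x + 1/2 * s2 * \<phi>'' x = c - h x"
      using stein_solution_properties[OF theta_pos s2_pos h, of c] Eh[OF h] unfolding c_def by metis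
    have fh: "f h = \<phi>" using st by (simp add: f c_def)
    note E = Q.error_terms[OF d \<phi>0 _ D L B K, unfolded Q_rho Q_delta Q_X, OF \<rho>, folded R_eq tau_eq lam_eq]
    have h_eq: "h (X 0 \<omega>) = c + \<theta> * \<phi>' (X 0 \<omega>) - 1/2 * s2 * \<phi>'' (X 0 \<omega>)" for \<omega>
      using eq[of "X 0 \<omega>"] by simp
    have "(\<integral>\<omega>. h (X 0 \<omega>) \<partial>M) = c + \<theta> * (\<integral>\<omega>. \<phi>' (X 0 \<omega>) \<partial>M) - 1/2 * s2 * (\<integral>\<omega>. \<phi>'' (X 0 \<omega>) \<partial>M)"
      unfolding h_eq using E(5,6) by (simp add: P.prob_space)
    then have "(\<integral>\<omega>. h (X 0 \<omega>) \<partial>M) - c = eps0 M \<delta> \<rho> X R \<phi> + epsA M lam \<delta> \<rho> X \<tau> U S \<phi>"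
      unfolding E(7) by (simp add: theta s2_eq)
    moreover have "\<bar>eps0 M \<delta> \<rho> X R \<phi>\<bar>
        \<le> \<delta> * \<rho> * lam * (\<integral>\<omega>. (U 0 \<omega>)\<^sup>2 \<partial>M) / 2
           + \<rho> * (\<integral>\<omega>. of_bool (X 0 \<omega> = 0) * R 0 \<omega> \<partial>M)"
    proof -
      have "\<delta> ^ 3 * \<rho> * (1 / \<theta>) = \<delta> * \<rho>" "\<delta>\<^sup>2 * \<rho> * (1 / \<theta>) = \<rho>"
        using \<delta> by (simp_all add: theta power2_eq_square power3_eq_cube)
      moreover have "\<delta> * \<rho> * (\<integral>\<omega>. R 0 \<omega> \<partial>M) \<le> \<delta> * \<rho> * (lam * (\<integral>\<omega>. (U 0 \<omega>)\<^sup>2 \<partial>M) / 2)"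
        using ER \<delta> \<rho> by (intro mult_left_mono) auto
      ultimately show ?thesis using E(8) by (simp add: mult.assoc)
    qed
    moreover have "\<bar>epsA M lam \<delta> \<rho> X \<tau> U S \<phi>\<bar>
        \<le> 2 * \<delta> * (\<integral>\<omega>. \<bar>S 0 \<omega> - \<rho> * U 0 \<omega>\<bar> ^ 3 \<partial>M) / (3 * ES\<^sup>2 * (cU2 + cS2))
           + 2 * \<delta> * (ES + lam * (\<integral>\<omega>. (U 0 \<omega>)\<^sup>2 \<partial>M))"
    proof -
      have e1: "4 / s2 / 6 * \<delta> ^ 3 * lam = 2 * \<delta> / (3 * ES\<^sup>2 * (cU2 + cS2))"
        unfolding s2 rho_lam using \<delta> lam_pos by (simp add: power2_eq_square power3_eq_cube)
      have e2: "1/2 * \<delta>\<^sup>2 * lam * P.expectation (\<lambda>\<omega>. (Q.net 0 \<omega>)\<^sup>2) * (4 / s2 * \<delta> * b) = 2 * \<delta> * b" for b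
      proof -
        have "1/2 * \<delta>\<^sup>2 * lam * P.expectation (\<lambda>\<omega>. (Q.net 0 \<omega>)\<^sup>2) = s2 / 2"
          unfolding s2_eq by simp
        then show ?thesis using s2_pos by simp
      qed
      show ?thesis
        using E(9)[unfolded e1 e2, unfolded Q_net, folded ES(1)] by (simp only: times_divide_eq_left mult.assoc)
    qed
    ultimately show ?thesis
      using E(1-4) by (simp add: fh c_def)
  qed
  have "wasserstein M (X 0) N Y
      \<le> (SUP h\<in>Lip1. ereal (\<bar>eps0 M \<delta> \<rho> X R (f h)\<bar> + \<bar>epsA M lam \<delta> \<rho> X \<tau> U S (f h)\<bar>))"
    unfolding wasserstein_def
  proof (rule SUP_mono)
    fix h assume "h \<in> Lip1"
    then have "\<bar>(\<integral>\<omega>. h (X 0 \<omega>) \<partial>M) - (\<integral>\<omega>. h (Y \<omega>) \<partial>N)\<bar>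
        \<le> \<bar>eps0 M \<delta> \<rho> X R (f h)\<bar> + \<bar>epsA M lam \<delta> \<rho> X \<tau> U S (f h)\<bar>"
      using main[of h] abs_triangle_ineq by metis
    with \<open>h \<in> Lip1\<close> show "\<exists>k\<in>Lip1. ereal \<bar>(\<integral>\<omega>. h (X 0 \<omega>) \<partial>M) - (\<integral>\<omega>. h (Y \<omega>) \<partial>N)\<bar>
        \<le> ereal (\<bar>eps0 M \<delta> \<rho> X R (f k)\<bar> + \<bar>epsA M lam \<delta> \<rho> X \<tau> U S (f k)\<bar>)"
      by (intro bexI[of _ h]) auto
  qed
  then show ?thesis
    using iX iR main by blast
qed

end
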